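(* Let $M(\phi,\xi,\eta,g_M)$ be a cosymplectic manifold, let $(N,g_N)$ be a Riemannian manifold, and let $F:M(\phi,\xi,\eta,g_M)\to(N,g_N)$ be an anti-invariant Riemannian submersion such that $\phi(\ker F_* )=(\ker F_* )^\perp$. Then $F$ is harmonic if and only if $\operatorname{Trace}\,\phi\mathcal{T}_V=0$ for all $V\in\Gamma(\ker F_* )$.
   Context: An almost contact metric structure $(\phi,\xi,\eta,g)$ on a $(2m+1)$-dimensional manifold $M$ consists of a $(1,1)$-tensor field $\phi$, a vector field $\xi$, a 1-form $\eta$ and a Riemannian metric $g$ with $\phi^2=-I+\eta\otimes\xi$, $\phi\xi=0$, $\eta\circ\phi=0$, $\eta(\xi)=1$, $g(\phi X,\phi Y)=g(X,Y)-\eta(X)\eta(Y)$, $\eta(X)=g(X,\xi)$. It is cosymplectic if it is normal ($[\phi,\phi]+2d\eta\otimes\xi=0$) and both $\eta$ and $\Phi(X,Y)=g(X,\phi Y)$ are closed; the structure equation of a cosymplectic manifold is $(\nabla_X\phi)Y=0$, where $\nabla$ is the Levi-Civita connection of $g$, and then $\nabla_X\xi=0$. A Riemannian submersion $F:(M,g_M)\to(N,g_N)$ is a smooth surjective map of maximal rank whose differential $F_*$ preserves the lengths of horizontal vectors. Vectors in $\ker F_*$ are vertical and vectors in $(\ker F_* )^\perp$ are horizontal; $\mathcal{V}$ and $\mathcal{H}$ are the orthogonal projections on $\ker F_*$ and $(\ker F_* )^\perp$. $F$ is anti-invariant if $\phi(\ker F_* )\subseteq(\ker F_* )^\perp$.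 O'Neill's tensor $\mathcal{T}$: for vector fields $E,G$ on $M$, $\mathcal{T}_EG=\mathcal{H}\nabla_{\mathcal{V}E}\mathcal{V}G+\mathcal{V}\nabla_{\mathcal{V}E}\mathcal{H}G$. For vertical $V$, $\phi\mathcal{T}_V$ denotes the endomorphism $E\mapsto\phi(\mathcal{T}_VE)$. The second fundamental form of $F$ is $(\nabla F_* )(X,Y)=\nabla^F_XF_*(Y)-F_*(\nabla_XY)$, where $\nabla^F$ is the pullback connection. $F$ is harmonic if $\operatorname{trace}(\nabla F_* )=0$. *)

theory Defs
  imports "HOL-Analysis.Analysis"
begin

text \<open>
  A manifold is a whole type \<open>'a\<close> (Hausdorff and second countable by its sort) with an atlas of
  charts into a finite-dimensional inner product space \<open>'e\<close>. The sort \<open>euclidean_space\<close> is not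
  used for \<open>'e\<close> because it excludes dimension 0, which the base of a submersion may have.
\<close>

fun Ck_on :: "nat \<Rightarrow> 'e::real_normed_vector set \<Rightarrow> ('e \<Rightarrow> 'c::real_normed_vector) \<Rightarrow> bool" where
  "Ck_on 0 S f \<longleftrightarrow> continuous_on S f"
| "Ck_on (Suc k) S f \<longleftrightarrow>
     (\<forall>x\<in>S. f differentiable (at x)) \<and> (\<forall>w. Ck_on k S (\<lambda>x. frechet_derivative f (at x) w))"

text \<open>Intended for open \<open>S\<close> in a finite-dimensional space.\<close>

definition Cinf_on :: "'e::real_normed_vector set \<Rightarrow> ('e \<Rightarrow> 'c::real_normed_vector) \<Rightarrow> bool" where
  "Cinf_on S f \<longleftrightarrow> (\<forall>k. Ck_on k S f)"

type_synonym ('a, 'e) chart = "'a set \<times> ('a \<Rightarrow> 'e)"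
type_synonym ('a, 'e) atlas = "('a, 'e) chart set"

text \<open>The atlas is not required to be maximal; all notions below depend only on the smooth
  structure that it generates.\<close>

definition smooth_manifold ::
  "('a::{t2_space,second_countable_topology}, 'e::real_inner) atlas \<Rightarrow> bool" where
  "smooth_manifold M \<longleftrightarrow>
     (\<exists>B. finite B \<and> span B = (UNIV :: 'e set)) \<and>
     (\<Union>(U, c)\<in>M. U) = UNIV \<and>
     (\<forall>(U, c)\<in>M. open U \<and> open (c ` U) \<and> homeomorphism U (c ` U) c (inv_into U c)) \<and>
     (\<forall>(U, c)\<in>M. \<forall>(V, d)\<in>M. Cinf_on (c ` (U \<inter> V)) (d \<circ> inv_into U c))"

definition smooth_fun ::
  "('a::topological_space, 'e::real_inner) atlas \<Rightarrow> 'a set \<Rightarrow> ('a \<Rightarrow> real) \<Rightarrow> bool" where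
  "smooth_fun M W f \<longleftrightarrow> (\<forall>(U, c)\<in>M. Cinf_on (c ` (U \<inter> W)) (f \<circ> inv_into U c))"

definition smooth_near ::
  "('a::topological_space, 'e::real_inner) atlas \<Rightarrow> 'a \<Rightarrow> ('a \<Rightarrow> real) \<Rightarrow> bool" where
  "smooth_near M p f \<longleftrightarrow> (\<exists>W. open W \<and> p \<in> W \<and> smooth_fun M W f)"

definition smooth_map ::
  "('a::topological_space, 'e::real_inner) atlas \<Rightarrow>
   ('b::topological_space, 'f::real_inner) atlas \<Rightarrow> ('a \<Rightarrow> 'b) \<Rightarrow> bool" where
  "smooth_map M N F \<longleftrightarrow>
     continuous_on UNIV F \<and>
     (\<forall>(U, c)\<in>M. \<forall>(V, d)\<in>N. Cinf_on (c ` (U \<inter> F -` V)) (d \<circ> F \<circ> inv_into U c))"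


section \<open>Tangent vectors and vector fields\<close>

text \<open>Tangent vectors act on functions as directional derivatives. The type \<open>'a tvec\<close> of all real
  functionals on functions serves only as an ambient real vector space; the tangent space at a
  point is the subspace \<open>tangent_space\<close> of it.\<close>

typedef 'a tvec = "UNIV :: (('a \<Rightarrow> real) \<Rightarrow> real) set"
  morphisms act Tvec
  by simp

lemma act_Tvec [simp]: "act (Tvec D) = D"
  by (simp add: Tvec_inverse)

lemma tvec_eqI: "(\<And>f. act u f = act v f) \<Longrightarrow> u = v"
  by (metis act_inject ext)

instantiation tvec :: (type) real_vector
begin

definition zero_tvec :: "'a tvec" where
  "zero_tvec = Tvec (\<lambda>f. 0)"

definition plus_tvec :: "'a tvec \<Rightarrow> 'a tvec \<Rightarrow> 'a tvec" where
  "plus_tvec u v = Tvec (\<lambda>f. act u f + act v f)"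

definition minus_tvec :: "'a tvec \<Rightarrow> 'a tvec \<Rightarrow> 'a tvec" where
  "minus_tvec u v = Tvec (\<lambda>f. act u f - act v f)"

definition uminus_tvec :: "'a tvec \<Rightarrow> 'a tvec" where
  "uminus_tvec u = Tvec (\<lambda>f. - act u f)"

definition scaleR_tvec :: "real \<Rightarrow> 'a tvec \<Rightarrow> 'a tvec" where
  "scaleR_tvec r u = Tvec (\<lambda>f. r * act u f)"

instance
  by standard
    (auto intro!: tvec_eqI simp: zero_tvec_def plus_tvec_def minus_tvec_def uminus_tvec_def
      scaleR_tvec_def algebra_simps)

end

text \<open>The tangent vector at \<open>p\<close> with coordinates \<open>w\<close> in the chart. It is set to 0 on functions that
  are not smooth near \<open>p\<close>, so that vectors agreeing on germs of smooth functions are equal; hence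
  the vectors at \<open>p\<close> given by any two charts around \<open>p\<close> form the same set.\<close>

definition chart_vec ::
  "('a::topological_space, 'e::real_inner) atlas \<Rightarrow> ('a, 'e) chart \<Rightarrow> 'a \<Rightarrow> 'e \<Rightarrow> 'a tvec" where
  "chart_vec M \<kappa> p w = Tvec (\<lambda>f.
     if smooth_near M p f
     then frechet_derivative (f \<circ> inv_into (fst \<kappa>) (snd \<kappa>)) (at (snd \<kappa> p)) w
     else 0)"

definition tangent_space ::
  "('a::topological_space, 'e::real_inner) atlas \<Rightarrow> 'a \<Rightarrow> 'a tvec set" where
  "tangent_space M p = {chart_vec M \<kappa> p w | \<kappa> w. \<kappa> \<in> M \<and> p \<in> fst \<kappa>}"

definition pushforward ::
  "('b::topological_space, 'f::real_inner) atlas \<Rightarrow> ('a \<Rightarrow> 'b) \<Rightarrow> 'a \<Rightarrow> 'a tvec \<Rightarrow> 'b tvec" where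
  "pushforward N F p v = Tvec (\<lambda>h. if smooth_near N (F p) h then act v (h \<circ> F) else 0)"

text \<open>Smooth sections over \<open>U\<close> of the pullback bundle \<open>F\<^sup>*TN\<close>.\<close>

definition section_along ::
  "('a::topological_space, 'e::real_inner) atlas \<Rightarrow> ('b::topological_space, 'f::real_inner) atlas \<Rightarrow>
   ('a \<Rightarrow> 'b) \<Rightarrow> 'a set \<Rightarrow> ('a \<Rightarrow> 'b tvec) \<Rightarrow> bool" where
  "section_along M N F U s \<longleftrightarrow>
     (\<forall>p\<in>U. s p \<in> tangent_space N (F p)) \<and>
     (\<forall>W h. open W \<longrightarrow> smooth_fun N W h \<longrightarrow> smooth_fun M (U \<inter> F -` W) (\<lambda>p. act (s p) h))"

definition section_near ::
  "('a::topological_space, 'e::real_inner) atlas \<Rightarrow> ('b::topological_space, 'f::real_inner) atlas \<Rightarrow>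
   ('a \<Rightarrow> 'b) \<Rightarrow> 'a \<Rightarrow> ('a \<Rightarrow> 'b tvec) \<Rightarrow> bool" where
  "section_near M N F p s \<longleftrightarrow> (\<exists>U. open U \<and> p \<in> U \<and> section_along M N F U s)"

definition vfield ::
  "('a::topological_space, 'e::real_inner) atlas \<Rightarrow> 'a set \<Rightarrow> ('a \<Rightarrow> 'a tvec) \<Rightarrow> bool" where
  "vfield M U X \<longleftrightarrow> section_along M M (\<lambda>p. p) U X"

definition vfield_near ::
  "('a::topological_space, 'e::real_inner) atlas \<Rightarrow> 'a \<Rightarrow> ('a \<Rightarrow> 'a tvec) \<Rightarrow> bool" where
  "vfield_near M p X \<longleftrightarrow> section_near M M (\<lambda>p. p) p X"

text \<open>Some smooth local vector field with value \<open>v\<close> at \<open>p\<close>, used to evaluate tensorial expressions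
  on a single tangent vector.\<close>

definition local_ext ::
  "('a::topological_space, 'e::real_inner) atlas \<Rightarrow> 'a \<Rightarrow> 'a tvec \<Rightarrow> 'a \<Rightarrow> 'a tvec" where
  "local_ext M p v = (SOME X. vfield_near M p X \<and> X p = v)"

definition lie_bracket ::
  "('a::topological_space, 'e::real_inner) atlas \<Rightarrow> ('a \<Rightarrow> 'a tvec) \<Rightarrow> ('a \<Rightarrow> 'a tvec) \<Rightarrow>
   'a \<Rightarrow> 'a tvec" where
  "lie_bracket M X Y p = Tvec (\<lambda>f.
     if smooth_near M p f
     then act (X p) (\<lambda>q. act (Y q) f) - act (Y p) (\<lambda>q. act (X q) f)
     else 0)"


section \<open>Tensor fields\<close>

definition one_form ::
  "('a::topological_space, 'e::real_inner) atlas \<Rightarrow> ('a \<Rightarrow> 'a tvec \<Rightarrow> real) \<Rightarrow> bool" where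
  "one_form M \<eta> \<longleftrightarrow>
     (\<forall>p. \<forall>u\<in>tangent_space M p. \<forall>v\<in>tangent_space M p. \<forall>a b.
        \<eta> p (a *\<^sub>R u + b *\<^sub>R v) = a * \<eta> p u + b * \<eta> p v) \<and>
     (\<forall>U X. open U \<longrightarrow> vfield M U X \<longrightarrow> smooth_fun M U (\<lambda>p. \<eta> p (X p)))"

definition endo_field ::
  "('a::topological_space, 'e::real_inner) atlas \<Rightarrow> ('a \<Rightarrow> 'a tvec \<Rightarrow> 'a tvec) \<Rightarrow> bool" where
  "endo_field M \<phi> \<longleftrightarrow>
     (\<forall>p. \<forall>u\<in>tangent_space M p. \<forall>v\<in>tangent_space M p. \<forall>a b.
        \<phi> p (a *\<^sub>R u + b *\<^sub>R v) = a *\<^sub>R \<phi> p u + b *\<^sub>R \<phi> p v) \<and>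
     (\<forall>U X. open U \<longrightarrow> vfield M U X \<longrightarrow> vfield M U (\<lambda>p. \<phi> p (X p)))"

definition riemannian_metric ::
  "('a::topological_space, 'e::real_inner) atlas \<Rightarrow> ('a \<Rightarrow> 'a tvec \<Rightarrow> 'a tvec \<Rightarrow> real) \<Rightarrow> bool" where
  "riemannian_metric M g \<longleftrightarrow>
     (\<forall>p. \<forall>u\<in>tangent_space M p. \<forall>v\<in>tangent_space M p. \<forall>w\<in>tangent_space M p. \<forall>a b.
        g p (a *\<^sub>R u + b *\<^sub>R v) w = a * g p u w + b * g p v w) \<and>
     (\<forall>p. \<forall>u\<in>tangent_space M p. \<forall>v\<in>tangent_space M p. g p u v = g p v u) \<and>
     (\<forall>p. \<forall>u\<in>tangent_space M p. u \<noteq> 0 \<longrightarrow> g p u u > 0) \<and>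
     (\<forall>U X Y. open U \<longrightarrow> vfield M U X \<longrightarrow> vfield M U Y \<longrightarrow>
        smooth_fun M U (\<lambda>p. g p (X p) (Y p)))"

definition riemannian_manifold ::
  "('a::{t2_space,second_countable_topology}, 'e::real_inner) atlas \<Rightarrow>
   ('a \<Rightarrow> 'a tvec \<Rightarrow> 'a tvec \<Rightarrow> real) \<Rightarrow> bool" where
  "riemannian_manifold M g \<longleftrightarrow> smooth_manifold M \<and> riemannian_metric M g"

text \<open>The exterior derivatives of a 1-form and of a 2-form carry the factors 1/2 and 1/3; this is the
  convention for which normality of an almost contact structure reads
  \<open>[\<phi>,\<phi>] + 2 d\<eta> \<otimes> \<xi> = 0\<close>.\<close>

definition ext_deriv1 ::
  "('a::topological_space, 'e::real_inner) atlas \<Rightarrow> ('a \<Rightarrow> 'a tvec \<Rightarrow> real) \<Rightarrow>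
   ('a \<Rightarrow> 'a tvec) \<Rightarrow> ('a \<Rightarrow> 'a tvec) \<Rightarrow> 'a \<Rightarrow> real" where
  "ext_deriv1 M \<eta> X Y p =
     (act (X p) (\<lambda>q. \<eta> q (Y q)) - act (Y p) (\<lambda>q. \<eta> q (X q)) - \<eta> p (lie_bracket M X Y p)) / 2"

definition ext_deriv2 ::
  "('a::topological_space, 'e::real_inner) atlas \<Rightarrow> ('a \<Rightarrow> 'a tvec \<Rightarrow> 'a tvec \<Rightarrow> real) \<Rightarrow>
   ('a \<Rightarrow> 'a tvec) \<Rightarrow> ('a \<Rightarrow> 'a tvec) \<Rightarrow> ('a \<Rightarrow> 'a tvec) \<Rightarrow> 'a \<Rightarrow> real" where
  "ext_deriv2 M \<omega> X Y Z p =
     (act (X p) (\<lambda>q. \<omega> q (Y q) (Z q)) + act (Y p) (\<lambda>q. \<omega> q (Z q) (X q))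
        + act (Z p) (\<lambda>q. \<omega> q (X q) (Y q))
      - \<omega> p (lie_bracket M X Y p) (Z p) - \<omega> p (lie_bracket M Y Z p) (X p)
        - \<omega> p (lie_bracket M Z X p) (Y p)) / 3"

definition nijenhuis ::
  "('a::topological_space, 'e::real_inner) atlas \<Rightarrow> ('a \<Rightarrow> 'a tvec \<Rightarrow> 'a tvec) \<Rightarrow>
   ('a \<Rightarrow> 'a tvec) \<Rightarrow> ('a \<Rightarrow> 'a tvec) \<Rightarrow> 'a \<Rightarrow> 'a tvec" where
  "nijenhuis M \<phi> X Y p =
     \<phi> p (\<phi> p (lie_bracket M X Y p))
     + lie_bracket M (\<lambda>q. \<phi> q (X q)) (\<lambda>q. \<phi> q (Y q)) p
     - \<phi> p (lie_bracket M (\<lambda>q. \<phi> q (X q)) Y p)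
     - \<phi> p (lie_bracket M X (\<lambda>q. \<phi> q (Y q)) p)"


section \<open>Cosymplectic manifolds\<close>

definition almost_contact_metric ::
  "('a::{t2_space,second_countable_topology}, 'e::real_inner) atlas \<Rightarrow>
   ('a \<Rightarrow> 'a tvec \<Rightarrow> 'a tvec) \<Rightarrow> ('a \<Rightarrow> 'a tvec) \<Rightarrow> ('a \<Rightarrow> 'a tvec \<Rightarrow> real) \<Rightarrow>
   ('a \<Rightarrow> 'a tvec \<Rightarrow> 'a tvec \<Rightarrow> real) \<Rightarrow> bool" where
  "almost_contact_metric M \<phi> \<xi> \<eta> g \<longleftrightarrow>
     riemannian_manifold M g \<and> (\<exists>m. dim (UNIV :: 'e set) = 2 * m + 1) \<and>
     endo_field M \<phi> \<and> vfield M UNIV \<xi> \<and> one_form M \<eta> \<and>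
     (\<forall>p. \<phi> p (\<xi> p) = 0 \<and> \<eta> p (\<xi> p) = 1) \<and>
     (\<forall>p. \<forall>u\<in>tangent_space M p.
        \<phi> p (\<phi> p u) = - u + \<eta> p u *\<^sub>R \<xi> p \<and> \<eta> p (\<phi> p u) = 0 \<and> \<eta> p u = g p u (\<xi> p)) \<and>
     (\<forall>p. \<forall>u\<in>tangent_space M p. \<forall>v\<in>tangent_space M p.
        g p (\<phi> p u) (\<phi> p v) = g p u v - \<eta> p u * \<eta> p v)"

definition normal_structure ::
  "('a::topological_space, 'e::real_inner) atlas \<Rightarrow> ('a \<Rightarrow> 'a tvec \<Rightarrow> 'a tvec) \<Rightarrow>
   ('a \<Rightarrow> 'a tvec) \<Rightarrow> ('a \<Rightarrow> 'a tvec \<Rightarrow> real) \<Rightarrow> bool" where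
  "normal_structure M \<phi> \<xi> \<eta> \<longleftrightarrow>
     (\<forall>p X Y. vfield_near M p X \<longrightarrow> vfield_near M p Y \<longrightarrow>
        nijenhuis M \<phi> X Y p + (2 * ext_deriv1 M \<eta> X Y p) *\<^sub>R \<xi> p = 0)"

definition fundamental_form ::
  "('a \<Rightarrow> 'a tvec \<Rightarrow> 'a tvec) \<Rightarrow> ('a \<Rightarrow> 'a tvec \<Rightarrow> 'a tvec \<Rightarrow> real) \<Rightarrow>
   'a \<Rightarrow> 'a tvec \<Rightarrow> 'a tvec \<Rightarrow> real" where
  "fundamental_form \<phi> g p u v = g p u (\<phi> p v)"

definition cosymplectic ::
  "('a::{t2_space,second_countable_topology}, 'e::real_inner) atlas \<Rightarrow>
   ('a \<Rightarrow> 'a tvec \<Rightarrow> 'a tvec) \<Rightarrow> ('a \<Rightarrow> 'a tvec) \<Rightarrow> ('a \<Rightarrow> 'a tvec \<Rightarrow> real) \<Rightarrow>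
   ('a \<Rightarrow> 'a tvec \<Rightarrow> 'a tvec \<Rightarrow> real) \<Rightarrow> bool" where
  "cosymplectic M \<phi> \<xi> \<eta> g \<longleftrightarrow>
     almost_contact_metric M \<phi> \<xi> \<eta> g \<and> normal_structure M \<phi> \<xi> \<eta> \<and>
     (\<forall>p X Y. vfield_near M p X \<longrightarrow> vfield_near M p Y \<longrightarrow> ext_deriv1 M \<eta> X Y p = 0) \<and>
     (\<forall>p X Y Z. vfield_near M p X \<longrightarrow> vfield_near M p Y \<longrightarrow> vfield_near M p Z \<longrightarrow>
        ext_deriv2 M (fundamental_form \<phi> g) X Y Z p = 0)"


section \<open>Connections\<close>

text \<open>A connection on \<open>F\<^sup>*TN\<close>, where \<open>D p v s\<close> is the derivative at \<open>p\<close> of the section \<open>s\<close> in the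
  direction \<open>v\<close>. Sections only need to be smooth near \<open>p\<close>. That \<open>D p v s\<close> depends only on the germ
  of \<open>s\<close> follows from the Leibniz rule: a function vanishing near \<open>p\<close> and equal to 1 elsewhere is
  smooth near \<open>p\<close>.\<close>

definition connection_along ::
  "('a::topological_space, 'e::real_inner) atlas \<Rightarrow> ('b::topological_space, 'f::real_inner) atlas \<Rightarrow>
   ('a \<Rightarrow> 'b) \<Rightarrow> ('a \<Rightarrow> 'a tvec \<Rightarrow> ('a \<Rightarrow> 'b tvec) \<Rightarrow> 'b tvec) \<Rightarrow> bool" where
  "connection_along M N F D \<longleftrightarrow>
     (\<forall>p s. section_near M N F p s \<longrightarrow>
        (\<forall>u\<in>tangent_space M p. D p u s \<in> tangent_space N (F p)) \<and>
        (\<forall>u\<in>tangent_space M p. \<forall>v\<in>tangent_space M p. \<forall>a b.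
           D p (a *\<^sub>R u + b *\<^sub>R v) s = a *\<^sub>R D p u s + b *\<^sub>R D p v s)) \<and>
     (\<forall>p s t. section_near M N F p s \<longrightarrow> section_near M N F p t \<longrightarrow>
        (\<forall>u\<in>tangent_space M p. D p u (\<lambda>q. s q + t q) = D p u s + D p u t)) \<and>
     (\<forall>p f s. smooth_near M p f \<longrightarrow> section_near M N F p s \<longrightarrow>
        (\<forall>u\<in>tangent_space M p.
           D p u (\<lambda>q. f q *\<^sub>R s q) = act u f *\<^sub>R s p + f p *\<^sub>R D p u s)) \<and>
     (\<forall>U X s. open U \<longrightarrow> vfield M U X \<longrightarrow> section_along M N F U s \<longrightarrow>
        section_along M N F U (\<lambda>p. D p (X p) s))"

definition levi_civita ::
  "('a::topological_space, 'e::real_inner) atlas \<Rightarrow> ('a \<Rightarrow> 'a tvec \<Rightarrow> 'a tvec \<Rightarrow> real) \<Rightarrow>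
   ('a \<Rightarrow> 'a tvec \<Rightarrow> ('a \<Rightarrow> 'a tvec) \<Rightarrow> 'a tvec) \<Rightarrow> bool" where
  "levi_civita M g D \<longleftrightarrow>
     connection_along M M (\<lambda>p. p) D \<and>
     (\<forall>p X Y. vfield_near M p X \<longrightarrow> vfield_near M p Y \<longrightarrow>
        D p (X p) Y - D p (Y p) X = lie_bracket M X Y p) \<and>
     (\<forall>p Y Z. vfield_near M p Y \<longrightarrow> vfield_near M p Z \<longrightarrow>
        (\<forall>u\<in>tangent_space M p.
           act u (\<lambda>q. g q (Y q) (Z q)) = g p (D p u Y) (Z p) + g p (Y p) (D p u Z)))"

definition pullback_connection ::
  "('a::topological_space, 'e::real_inner) atlas \<Rightarrow> ('b::topological_space, 'f::real_inner) atlas \<Rightarrow>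
   ('a \<Rightarrow> 'b) \<Rightarrow> ('b \<Rightarrow> 'b tvec \<Rightarrow> ('b \<Rightarrow> 'b tvec) \<Rightarrow> 'b tvec) \<Rightarrow>
   ('a \<Rightarrow> 'a tvec \<Rightarrow> ('a \<Rightarrow> 'b tvec) \<Rightarrow> 'b tvec) \<Rightarrow> bool" where
  "pullback_connection M N F DN DF \<longleftrightarrow>
     connection_along M N F DF \<and>
     (\<forall>p Z. vfield_near N (F p) Z \<longrightarrow>
        (\<forall>u\<in>tangent_space M p. DF p u (\<lambda>q. Z (F q)) = DN (F p) (pushforward N F p u) Z))"


section \<open>Riemannian submersions\<close>

definition vertical_space ::
  "('a::topological_space, 'e::real_inner) atlas \<Rightarrow> ('b::topological_space, 'f::real_inner) atlas \<Rightarrow>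
   ('a \<Rightarrow> 'b) \<Rightarrow> 'a \<Rightarrow> 'a tvec set" where
  "vertical_space M N F p = {v \<in> tangent_space M p. pushforward N F p v = 0}"

definition horizontal_space ::
  "('a::topological_space, 'e::real_inner) atlas \<Rightarrow> ('b::topological_space, 'f::real_inner) atlas \<Rightarrow>
   ('a \<Rightarrow> 'a tvec \<Rightarrow> 'a tvec \<Rightarrow> real) \<Rightarrow> ('a \<Rightarrow> 'b) \<Rightarrow> 'a \<Rightarrow> 'a tvec set" where
  "horizontal_space M N g F p =
     {v \<in> tangent_space M p. \<forall>u\<in>vertical_space M N F p. g p v u = 0}"

definition riemannian_submersion ::
  "('a::topological_space, 'e::real_inner) atlas \<Rightarrow> ('b::topological_space, 'f::real_inner) atlas \<Rightarrow>
   ('a \<Rightarrow> 'a tvec \<Rightarrow> 'a tvec \<Rightarrow> real) \<Rightarrow> ('b \<Rightarrow> 'b tvec \<Rightarrow> 'b tvec \<Rightarrow> real) \<Rightarrow>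
   ('a \<Rightarrow> 'b) \<Rightarrow> bool" where
  "riemannian_submersion M N gM gN F \<longleftrightarrow>
     smooth_map M N F \<and> surj F \<and>
     (\<forall>p. pushforward N F p ` tangent_space M p = tangent_space N (F p)) \<and>
     (\<forall>p. \<forall>v\<in>horizontal_space M N gM F p.
        gN (F p) (pushforward N F p v) (pushforward N F p v) = gM p v v)"

definition anti_invariant_submersion ::
  "('a::topological_space, 'e::real_inner) atlas \<Rightarrow> ('b::topological_space, 'f::real_inner) atlas \<Rightarrow>
   ('a \<Rightarrow> 'a tvec \<Rightarrow> 'a tvec) \<Rightarrow> ('a \<Rightarrow> 'a tvec \<Rightarrow> 'a tvec \<Rightarrow> real) \<Rightarrow>
   ('b \<Rightarrow> 'b tvec \<Rightarrow> 'b tvec \<Rightarrow> real) \<Rightarrow> ('a \<Rightarrow> 'b) \<Rightarrow> bool" where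
  "anti_invariant_submersion M N \<phi> gM gN F \<longleftrightarrow>
     riemannian_submersion M N gM gN F \<and>
     (\<forall>p. \<phi> p ` vertical_space M N F p \<subseteq> horizontal_space M N gM F p)"

definition vert_proj ::
  "('a::topological_space, 'e::real_inner) atlas \<Rightarrow> ('b::topological_space, 'f::real_inner) atlas \<Rightarrow>
   ('a \<Rightarrow> 'a tvec \<Rightarrow> 'a tvec \<Rightarrow> real) \<Rightarrow> ('a \<Rightarrow> 'b) \<Rightarrow> 'a \<Rightarrow> 'a tvec \<Rightarrow> 'a tvec" where
  "vert_proj M N g F p v =
     (THE u. u \<in> vertical_space M N F p \<and> v - u \<in> horizontal_space M N g F p)"

definition hor_proj ::
  "('a::topological_space, 'e::real_inner) atlas \<Rightarrow> ('b::topological_space, 'f::real_inner) atlas \<Rightarrow>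
   ('a \<Rightarrow> 'a tvec \<Rightarrow> 'a tvec \<Rightarrow> real) \<Rightarrow> ('a \<Rightarrow> 'b) \<Rightarrow> 'a \<Rightarrow> 'a tvec \<Rightarrow> 'a tvec" where
  "hor_proj M N g F p v =
     (THE u. u \<in> horizontal_space M N g F p \<and> v - u \<in> vertical_space M N F p)"

definition oneill_T ::
  "('a::topological_space, 'e::real_inner) atlas \<Rightarrow> ('b::topological_space, 'f::real_inner) atlas \<Rightarrow>
   ('a \<Rightarrow> 'a tvec \<Rightarrow> 'a tvec \<Rightarrow> real) \<Rightarrow> ('a \<Rightarrow> 'a tvec \<Rightarrow> ('a \<Rightarrow> 'a tvec) \<Rightarrow> 'a tvec) \<Rightarrow>
   ('a \<Rightarrow> 'b) \<Rightarrow> ('a \<Rightarrow> 'a tvec) \<Rightarrow> ('a \<Rightarrow> 'a tvec) \<Rightarrow> 'a \<Rightarrow> 'a tvec" where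
  "oneill_T M N g D F E G p =
     hor_proj M N g F p (D p (vert_proj M N g F p (E p)) (\<lambda>q. vert_proj M N g F q (G q)))
     + vert_proj M N g F p (D p (vert_proj M N g F p (E p)) (\<lambda>q. hor_proj M N g F q (G q)))"

definition phi_T ::
  "('a::topological_space, 'e::real_inner) atlas \<Rightarrow> ('b::topological_space, 'f::real_inner) atlas \<Rightarrow>
   ('a \<Rightarrow> 'a tvec \<Rightarrow> 'a tvec) \<Rightarrow> ('a \<Rightarrow> 'a tvec \<Rightarrow> 'a tvec \<Rightarrow> real) \<Rightarrow>
   ('a \<Rightarrow> 'a tvec \<Rightarrow> ('a \<Rightarrow> 'a tvec) \<Rightarrow> 'a tvec) \<Rightarrow>
   ('a \<Rightarrow> 'b) \<Rightarrow> ('a \<Rightarrow> 'a tvec) \<Rightarrow> 'a \<Rightarrow> 'a tvec \<Rightarrow> 'a tvec" where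
  "phi_T M N \<phi> g D F V p e = \<phi> p (oneill_T M N g D F V (local_ext M p e) p)"

text \<open>Trace of an endomorphism of the finite-dimensional subspace \<open>S\<close>, as the sum of the diagonal
  coefficients with respect to some basis of \<open>S\<close>.\<close>

definition trace_on :: "'v::real_vector set \<Rightarrow> ('v \<Rightarrow> 'v) \<Rightarrow> real" where
  "trace_on S A =
     (let B = (SOME B. independent B \<and> span B = S) in \<Sum>b\<in>B. representation B (A b) b)"

definition orthonormal_basis :: "('v::real_vector \<Rightarrow> 'v \<Rightarrow> real) \<Rightarrow> 'v set \<Rightarrow> 'v set \<Rightarrow> bool" where
  "orthonormal_basis G S B \<longleftrightarrow>
     independent B \<and> span B = S \<and> (\<forall>a\<in>B. \<forall>b\<in>B. G a b = (if a = b then 1 else 0))"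

definition metric_trace ::
  "('v::real_vector \<Rightarrow> 'v \<Rightarrow> real) \<Rightarrow> 'v set \<Rightarrow> ('v \<Rightarrow> 'v \<Rightarrow> 'w::real_vector) \<Rightarrow> 'w" where
  "metric_trace G S \<beta> = (let B = (SOME B. orthonormal_basis G S B) in \<Sum>e\<in>B. \<beta> e e)"

definition second_fundamental_form ::
  "('b::topological_space, 'f::real_inner) atlas \<Rightarrow> ('a \<Rightarrow> 'b) \<Rightarrow>
   ('a \<Rightarrow> 'a tvec \<Rightarrow> ('a \<Rightarrow> 'a tvec) \<Rightarrow> 'a tvec) \<Rightarrow>
   ('a \<Rightarrow> 'a tvec \<Rightarrow> ('a \<Rightarrow> 'b tvec) \<Rightarrow> 'b tvec) \<Rightarrow>
   ('a \<Rightarrow> 'a tvec) \<Rightarrow> ('a \<Rightarrow> 'a tvec) \<Rightarrow> 'a \<Rightarrow> 'b tvec" where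
  "second_fundamental_form N F D DF X Y p =
     DF p (X p) (\<lambda>q. pushforward N F q (Y q)) - pushforward N F p (D p (X p) Y)"

definition harmonic_map ::
  "('a::topological_space, 'e::real_inner) atlas \<Rightarrow> ('b::topological_space, 'f::real_inner) atlas \<Rightarrow>
   ('a \<Rightarrow> 'a tvec \<Rightarrow> 'a tvec \<Rightarrow> real) \<Rightarrow> ('a \<Rightarrow> 'b) \<Rightarrow>
   ('a \<Rightarrow> 'a tvec \<Rightarrow> ('a \<Rightarrow> 'a tvec) \<Rightarrow> 'a tvec) \<Rightarrow>
   ('a \<Rightarrow> 'a tvec \<Rightarrow> ('a \<Rightarrow> 'b tvec) \<Rightarrow> 'b tvec) \<Rightarrow> bool" where
  "harmonic_map M N g F D DF \<longleftrightarrow>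
     (\<forall>p. metric_trace (g p) (tangent_space M p)
        (\<lambda>x y. second_fundamental_form N F D DF (local_ext M p x) (local_ext M p y) p) = 0)"

definition vertical_sections ::
  "('a::topological_space, 'e::real_inner) atlas \<Rightarrow> ('b::topological_space, 'f::real_inner) atlas \<Rightarrow>
   ('a \<Rightarrow> 'b) \<Rightarrow> ('a \<Rightarrow> 'a tvec) set" where
  "vertical_sections M N F = {V. vfield M UNIV V \<and> (\<forall>p. V p \<in> vertical_space M N F p)}"

end

theory Submission
  imports Defs
begin

text \<open>
  Let \<open>K = \<Sum> \<nabla>\<^bsub>c\<^esub> E\<^sub>c\<close> be summed over an orthonormal basis of the vertical space at \<open>p\<close>, where \<open>E\<^sub>c\<close> is a
  vertical field extending \<open>c\<close>. By Koszul's formula for basic fields the second fundamental form of a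
  Riemannian submersion vanishes on horizontal vectors, so its trace is \<open>- F\<^sub>* K\<close>. As \<open>\<phi>\<close> exchanges
  vertical and horizontal vectors and \<open>T\<^sub>V\<close> is skew, the vertical and the horizontal part of the trace
  of \<open>\<phi>T\<^sub>V\<close> agree (this is trace \<open>AB\<close> = trace \<open>BA\<close>). Since \<open>T\<close> is symmetric on vertical vectors and
  \<open>\<nabla>\<phi> = 0\<close>, the trace equals \<open>- 2 g(\<phi>V, K)\<close>. Every horizontal vector is of the form \<open>\<phi>V\<close> with a
  global vertical section \<open>V\<close>, so both conditions say that \<open>K\<close> has no horizontal part.

  The projections are smooth because \<open>\<H>X\<close> is the horizontal lift of \<open>F\<^sub>*X\<close>, whose coefficients in a
  local orthogonal frame \<open>E\<close> are \<open>g\<^sub>N(F\<^sub>*X, F\<^sub>*E) / g\<^sub>M(E, E)\<close>. The equation \<open>\<nabla>\<phi> = 0\<close> follows pointwise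
  from normality, \<open>d\<eta> = 0\<close> and \<open>d\<Phi> = 0\<close>.
\<close>

section \<open>Calculus of \<open>C\<^sup>k\<close> functions\<close>

text \<open>The notions in the statement are evaluated through choices: \<open>local_ext\<close>
  picks a field through a vector, \<open>metric_trace\<close> and \<open>trace_on\<close> pick a
  basis. Tensoriality and independence of the basis must therefore come before any computation.
  Moreover metric, \<phi> and connections are constrained only on tangent spaces inside the ambient
  type \<open>tvec\<close>, so linear algebra is redone relative to a subspace
  (\<open>inner_on\<close>). The two halves of the trace are compared by a double sum, not by
  carrying a basis from vertical to horizontal vectors: the hypothesis on \<phi> forces \<xi> to be
  vertical, and \<phi> kills \<xi>, so \<phi> is not injective there. Each half contributes -
  g(\<phi>V, K), whence the 2. The trace condition is quantified over global sections, while the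
  construction from a vector yields only a local vertical field. This is why bump functions are
  needed, and with them compactness of balls in a model space given only as a finite-dimensional
  inner product space.\<close>

lemma Ck_on_cong:
  assumes "open S" "\<And>x. x \<in> S \<Longrightarrow> f x = g x" "Ck_on k S f"
  shows "Ck_on k S g"
  using assms(2,3)
proof (induction k arbitrary: f g)
  case 0
  then show ?case by (simp cong: continuous_on_cong)
next
  case (Suc k)
  have d: "g differentiable (at x)" if "x \<in> S" for x
  proof -
    have "(f has_derivative frechet_derivative f (at x)) (at x)"
      using Suc.prems(2) that by (simp add: frechet_derivative_works)
    from has_derivative_transform_within_open[OF this \<open>open S\<close> that Suc.prems(1)]
    show ?thesis by (auto simp: differentiable_def)
  qed
  have "frechet_derivative f (at x) = frechet_derivative g (at x)" if "x \<in> S" for x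
    using frechet_derivative_transform_within_open[of f x S g] Suc.prems that \<open>open S\<close> by auto
  then have "Ck_on k S (\<lambda>x. frechet_derivative g (at x) w)" for w
    using Suc.IH[of "\<lambda>x. frechet_derivative f (at x) w"] Suc.prems by auto
  with d show ?case by simp
qed

text \<open>By uniqueness of derivatives an explicit formula \<open>D\<close> may replace the
  choice-defined \<open>frechet_derivative\<close>; the calculus rules below are proved in this
  way.\<close>

lemma Ck_on_SucI:
  assumes "open S" "\<And>x. x \<in> S \<Longrightarrow> (f has_derivative D x) (at x)"
    "\<And>w. Ck_on k S (\<lambda>x. D x w)"
  shows "Ck_on (Suc k) S f"
proof -
  have "D x w = frechet_derivative f (at x) w" if "x \<in> S" for x w
    using frechet_derivative_at[OF assms(2)[OF that]] by simp
  then have "Ck_on k S (\<lambda>x. frechet_derivative f (at x) w)" for w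
    using Ck_on_cong[OF \<open>open S\<close> _ assms(3)[of w]] by auto
  then show ?thesis using assms(2) by (auto simp: differentiable_def)
qed

lemma Ck_on_SucD:
  assumes "Ck_on (Suc k) S f" "x \<in> S"
  shows "(f has_derivative frechet_derivative f (at x)) (at x)"
  using assms by (simp add: frechet_derivative_works)

lemma Ck_on_mono: "Ck_on k S f \<Longrightarrow> T \<subseteq> S \<Longrightarrow> Ck_on k T f"
  by (induction k arbitrary: f) (auto intro: continuous_on_subset)

lemma Ck_on_pred: "Ck_on (Suc k) S f \<Longrightarrow> Ck_on k S f"
proof (induction k arbitrary: f)
  case 0
  then show ?case
    by (auto intro!: continuous_at_imp_continuous_on differentiable_imp_continuous_within)
next
  case (Suc k)
  have "f differentiable (at x)" if "x \<in> S" for x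
    using Suc.prems that unfolding Ck_on.simps(2)[of "Suc k"] by blast
  moreover have "Ck_on k S (\<lambda>x. frechet_derivative f (at x) w)" for w
    using Suc.prems unfolding Ck_on.simps(2)[of "Suc k"] by (blast intro: Suc.IH)
  ultimately show ?case by simp
qed

text \<open>Continuity on an open \<open>T\<close> is continuity at each of its points, so every
  layer of the recursion is a condition on neighbourhoods of points.\<close>

lemma Ck_on_local:
  "(\<And>x. x \<in> S \<Longrightarrow> \<exists>T. open T \<and> x \<in> T \<and> Ck_on k T f) \<Longrightarrow> Ck_on k S f"
proof (induction k arbitrary: f)
  case 0
  have "continuous (at x) f" if "x \<in> S" for x
    using 0[OF that] by (auto simp: continuous_on_eq_continuous_at)
  then show ?case by (simp add: continuous_at_imp_continuous_on)
next
  case (Suc k)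
  have "\<exists>T. open T \<and> x \<in> T \<and> Ck_on k T (\<lambda>x. frechet_derivative f (at x) w)" if "x \<in> S" for x w
    using Suc.prems[OF that] by auto
  then have "Ck_on k S (\<lambda>x. frechet_derivative f (at x) w)" for w
    by (intro Suc.IH) auto
  moreover have "f differentiable (at x)" if "x \<in> S" for x
    using Suc.prems[OF that] by auto
  ultimately show ?case by simp
qed

lemma Ck_on_const: "open S \<Longrightarrow> Ck_on k S (\<lambda>x. c)"
  by (induction k arbitrary: c) (simp_all add: continuous_on_const)

lemma Ck_on_linear:
  assumes "open S" "bounded_linear L"
  shows "Ck_on k S L"
proof (cases k)
  case 0
  then show ?thesis
    using assms(2) by (simp add: linear_continuous_on)
next
  case (Suc j)
  show ?thesis unfolding Suc
    by (rule Ck_on_SucI[OF assms(1) bounded_linear_imp_has_derivative[OF assms(2)]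
          Ck_on_const[OF assms(1)]])
qed

lemma Ck_on_linear_comp:
  assumes "open S" "bounded_linear L" "Ck_on k S f"
  shows "Ck_on k S (\<lambda>x. L (f x))"
  using assms(3)
proof (induction k arbitrary: f)
  case 0
  then show ?case by (simp add: bounded_linear.continuous_on[OF assms(2)])
next
  case (Suc k)
  show ?case
  proof (rule Ck_on_SucI[OF assms(1)])
    fix x assume "x \<in> S"
    then show "((\<lambda>x. L (f x)) has_derivative (\<lambda>w. L (frechet_derivative f (at x) w))) (at x)"
      using bounded_linear.has_derivative[OF assms(2) Ck_on_SucD[OF Suc.prems]] by blast
  next
    fix w
    show "Ck_on k S (\<lambda>x. L (frechet_derivative f (at x) w))"
      using Suc.prems by (intro Suc.IH) simp
  qed
qed

lemma Ck_on_add: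
  assumes "open S" "Ck_on k S f" "Ck_on k S g"
  shows "Ck_on k S (\<lambda>x. f x + g x)"
  using assms(2,3)
proof (induction k arbitrary: f g)
  case 0
  then show ?case by (auto intro: continuous_intros)
next
  case (Suc k)
  show ?case
  proof (rule Ck_on_SucI[OF assms(1)])
    fix x assume "x \<in> S"
    then show "((\<lambda>x. f x + g x) has_derivative
        (\<lambda>w. frechet_derivative f (at x) w + frechet_derivative g (at x) w)) (at x)"
      using Suc.prems by (intro has_derivative_add Ck_on_SucD)
  next
    fix w
    show "Ck_on k S (\<lambda>x. frechet_derivative f (at x) w + frechet_derivative g (at x) w)"
      using Suc.prems by (intro Suc.IH) simp_all
  qed
qed

lemma Ck_on_scaleR:
  fixes f :: "_ \<Rightarrow> real"
  assumes "open S" "Ck_on k S f" "Ck_on k S g"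
  shows "Ck_on k S (\<lambda>x. f x *\<^sub>R g x)"
  using assms(2,3)
proof (induction k arbitrary: f g)
  case 0
  then show ?case by (auto intro: continuous_intros)
next
  case (Suc k)
  show ?case
  proof (rule Ck_on_SucI[OF assms(1)])
    fix x assume "x \<in> S"
    then show "((\<lambda>x. f x *\<^sub>R g x) has_derivative
        (\<lambda>w. f x *\<^sub>R frechet_derivative g (at x) w + frechet_derivative f (at x) w *\<^sub>R g x)) (at x)"
      using Suc.prems by (intro has_derivative_scaleR Ck_on_SucD)
  next
    \<comment> \<open>The product rule leaves one factor undifferentiated; it is one order better
      than required, so \<open>Ck_on_pred\<close> applies to it.\<close>
    fix w
    show "Ck_on k S (\<lambda>x. f x *\<^sub>R frechet_derivative g (at x) w + frechet_derivative f (at x) w *\<^sub>R g x)"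
      using Suc.prems by (intro Ck_on_add[OF assms(1)] Suc.IH Ck_on_pred[of k S f] Ck_on_pred[of k S g]) simp_all
  qed
qed

lemma Ck_on_sum:
  assumes "open S" "\<And>i. i \<in> I \<Longrightarrow> Ck_on k S (f i)"
  shows "Ck_on k S (\<lambda>x. \<Sum>i\<in>I. f i x)"
  using assms(2)
  by (induction I rule: infinite_finite_induct)
    (auto intro: Ck_on_add[OF assms(1)] Ck_on_const[OF assms(1)])

text \<open>The derivative of 1/f contains 1/f again, so the induction keeps \<open>f\<close> fixed
  and uses the claim for 1/f at the previous order.\<close>

lemma Ck_on_inverse:
  fixes f :: "_ \<Rightarrow> real"
  assumes "open S" "Ck_on k S f" "\<And>x. x \<in> S \<Longrightarrow> f x \<noteq> 0"
  shows "Ck_on k S (\<lambda>x. inverse (f x))"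
  using assms(2)
proof (induction k)
  case 0
  then show ?case using assms(3) by (auto intro: continuous_intros)
next
  case (Suc k)
  show ?case
  proof (rule Ck_on_SucI[OF assms(1)])
    fix x assume "x \<in> S"
    then show "((\<lambda>x. inverse (f x)) has_derivative
        (\<lambda>w. - (inverse (f x) * frechet_derivative f (at x) w * inverse (f x)))) (at x)"
      using Suc.prems assms(3) by (intro Deriv.has_derivative_inverse Ck_on_SucD) auto
  next
    fix w
    have i: "Ck_on k S (\<lambda>x. inverse (f x))" using Suc.IH Ck_on_pred[OF Suc.prems] .
    have "Ck_on k S (\<lambda>x. frechet_derivative f (at x) w)" using Suc.prems by simp
    then have "Ck_on k S (\<lambda>x. (inverse (f x) *\<^sub>R frechet_derivative f (at x) w) *\<^sub>R inverse (f x))"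
      by (intro Ck_on_scaleR[OF assms(1)] i)
    then show "Ck_on k S (\<lambda>x. - (inverse (f x) * frechet_derivative f (at x) w * inverse (f x)))"
      using Ck_on_linear_comp[OF assms(1) bounded_linear_minus[OF bounded_linear_ident]] by fastforce
  qed
qed

text \<open>The direction in the chain rule varies with the point, so it is expanded in an
  orthonormal basis.\<close>

lemma Ck_on_compose:
  fixes f :: "'e::real_normed_vector \<Rightarrow> 'f::real_inner" and g :: "'f \<Rightarrow> 'c::real_normed_vector"
  assumes B: "finite B" "\<And>x::'f. (\<Sum>b\<in>B. (b \<bullet> x) *\<^sub>R b) = x"
    and "open S" "open T" "f ` S \<subseteq> T"
    and "Ck_on k S f" "Ck_on k T g"
  shows "Ck_on k S (\<lambda>x. g (f x))"
  using assms(6,7)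
proof (induction k arbitrary: g)
  case 0
  then show ?case using \<open>f ` S \<subseteq> T\<close> by (auto intro: continuous_on_compose2)
next
  case (Suc k)
  let ?D = "\<lambda>x. frechet_derivative f (at x)" and ?E = "\<lambda>y. frechet_derivative g (at y)"
  show ?case
  proof (rule Ck_on_SucI[OF \<open>open S\<close>])
    fix x assume "x \<in> S"
    then have "f x \<in> T" using \<open>f ` S \<subseteq> T\<close> by auto
    have "((\<lambda>x. g (f x)) has_derivative (\<lambda>w. ?E (f x) (?D x w))) (at x)"
      using Ck_on_SucD[OF Suc.prems(1) \<open>x \<in> S\<close>] Ck_on_SucD[OF Suc.prems(2) \<open>f x \<in> T\<close>]
      by (rule has_derivative_compose)
    moreover have "?E (f x) (?D x w) = (\<Sum>b\<in>B. (b \<bullet> ?D x w) *\<^sub>R ?E (f x) b)" for w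
    proof -
      have l: "linear (?E (f x))"
        using Suc.prems(2) \<open>f x \<in> T\<close> by (simp add: linear_frechet_derivative)
      have "?E (f x) (?D x w) = ?E (f x) (\<Sum>b\<in>B. (b \<bullet> ?D x w) *\<^sub>R b)"
        by (simp add: B)
      then show ?thesis by (simp add: linear_sum[OF l] linear_cmul[OF l])
    qed
    ultimately show "((\<lambda>x. g (f x)) has_derivative
        (\<lambda>w. \<Sum>b\<in>B. (b \<bullet> ?D x w) *\<^sub>R ?E (f x) b)) (at x)" by simp
  next
    fix w
    have "Ck_on k S (\<lambda>x. ?E (f x) b)" for b
      using Suc.IH[of "\<lambda>y. ?E y b"] Ck_on_pred[OF Suc.prems(1)] Suc.prems(2) by simp
    moreover have "Ck_on k S (\<lambda>x. b \<bullet> ?D x w)" for b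
      using Suc.prems(1) by (intro Ck_on_linear_comp[OF \<open>open S\<close> bounded_linear_inner_right]) simp
    ultimately show "Ck_on k S (\<lambda>x. \<Sum>b\<in>B. (b \<bullet> ?D x w) *\<^sub>R ?E (f x) b)"
      by (intro Ck_on_sum[OF \<open>open S\<close>] Ck_on_scaleR[OF \<open>open S\<close>])
  qed
qed

lemma Cinf_on_derivative: "Cinf_on S f \<Longrightarrow> Cinf_on S (\<lambda>x. frechet_derivative f (at x) w)"
  unfolding Cinf_on_def using Ck_on.simps(2) by blast

lemma Cinf_on_has_derivative:
  "Cinf_on S f \<Longrightarrow> x \<in> S \<Longrightarrow> (f has_derivative frechet_derivative f (at x)) (at x)"
  unfolding Cinf_on_def using Ck_on_SucD[of 0] by blast

subsection \<open>A bump function\<close>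

text \<open>The powers in the denominator close the family under differentiation: the derivative is
  a combination of members \<open>n + 2\<close> and \<open>n + 1\<close>. Smoothness is then one
  induction for all \<open>n\<close> at once.\<close>

definition flat :: "nat \<Rightarrow> real \<Rightarrow> real" where
  "flat n t = (if t > 0 then exp (- 1 / t) / t ^ n else 0)"

text \<open>With x = 1/t, the limit from the right is that of x^n exp(-x) at infinity; from the left
  the function is 0.\<close>

lemma flat_tendsto_0: "(flat n \<longlongrightarrow> 0) (at 0)"
proof -
  have "((\<lambda>x::real. x ^ n / exp x) \<longlongrightarrow> 0) at_top" by (rule tendsto_power_div_exp_0)
  then have "((\<lambda>t::real. inverse t ^ n / exp (inverse t)) \<longlongrightarrow> 0) (at_right 0)"
    by (rule filterlim_compose[OF _ filterlim_inverse_at_top_right])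
  moreover have "\<forall>\<^sub>F t in at_right 0. inverse t ^ n / exp (inverse t) = flat n t"
    by (rule eventually_at_right_less[THEN eventually_mono])
      (simp add: flat_def exp_minus divide_simps)
  ultimately have r: "(flat n \<longlongrightarrow> 0) (at_right 0)"
    by (rule Lim_transform_eventually)
  have "\<forall>\<^sub>F t in at_left 0. 0 = flat n t"
    by (auto simp: eventually_at_filter flat_def)
  then have "(flat n \<longlongrightarrow> 0) (at_left 0)"
    by (rule Lim_transform_eventually[OF tendsto_const])
  with r show ?thesis by (simp add: filterlim_split_at)
qed

lemma flat_has_derivative:
  "(flat n has_real_derivative flat (n + 2) t - real n * flat (n + 1) t) (at t)"
proof (cases t "0::real" rule: linorder_cases)
  case less
  have "((\<lambda>t. 0) has_real_derivative 0) (at t)" by simp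
  then have "(flat n has_real_derivative 0) (at t)"
    by (rule has_field_derivative_transform_within_open[of _ _ _ "{..<0}"])
      (use less in \<open>auto simp: flat_def\<close>)
  then show ?thesis using less by (simp add: flat_def)
next
  case equal
  \<comment> \<open>The difference quotient of \<open>flat n\<close> at 0 is exactly
    \<open>flat (n + 1)\<close>.\<close>
  have "(flat n has_real_derivative 0) (at 0)"
    unfolding has_field_derivative_iff
  proof (rule Lim_transform_eventually[OF flat_tendsto_0[of "n + 1"]])
    show "\<forall>\<^sub>F h in at 0. flat (n + 1) h = (flat n h - flat n 0) / (h - 0)"
      by (auto simp: flat_def eventually_at_filter field_simps)
  qed
  then show ?thesis using equal by (simp add: flat_def)
next
  case greater
  have e: "((\<lambda>t. exp (- 1 / t)) has_real_derivative exp (- 1 / t) / t\<^sup>2) (at t)"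
    using greater by (auto intro!: derivative_eq_intros simp: power2_eq_square)
  have p: "((\<lambda>t. t ^ n) has_real_derivative real n * t ^ n / t) (at t)"
  proof -
    have "real n * t ^ (n - Suc 0) = real n * t ^ n / t" using greater by (cases n) auto
    with DERIV_pow[of n t UNIV] show ?thesis by (simp only:)
  qed
  have "((\<lambda>t. exp (- 1 / t) / t ^ n) has_real_derivative
      flat (n + 2) t - real n * flat (n + 1) t) (at t)"
    using DERIV_divide[OF e p] greater
    by (simp add: flat_def diff_divide_distrib power_add power2_eq_square mult.assoc mult.left_commute
        mult.commute)
  then show ?thesis
    by (rule has_field_derivative_transform_within_open[of _ _ _ "{0<..}"])
      (use greater in \<open>auto simp: flat_def\<close>)
qed

lemma Ck_on_flat: "Ck_on k UNIV (flat n)"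
proof (induction k arbitrary: n)
  case 0
  then show ?case
    by (auto intro!: DERIV_continuous_on flat_has_derivative)
next
  case (Suc k)
  show ?case
  proof (rule Ck_on_SucI)
    fix t :: real
    show "(flat n has_derivative (\<lambda>w. w *\<^sub>R (flat (n + 2) t + (- real n) *\<^sub>R flat (n + 1) t))) (at t)"
      using flat_has_derivative[of n t]
      unfolding has_field_derivative_def by (rule has_derivative_eq_rhs) (auto simp: fun_eq_iff)
  next
    fix w :: real
    show "Ck_on k UNIV (\<lambda>x. w *\<^sub>R (flat (n + 2) x + - real n *\<^sub>R flat (n + 1) x))"
      by (intro Ck_on_scaleR Ck_on_add Ck_on_const Suc.IH open_UNIV)
  qed simp
qed

section \<open>Inner products on finite-dimensional subspaces\<close>

text \<open>Linearity is assumed on \<open>S\<close> only: the maps in question are arbitrary off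
  the tangent space, so the predicate \<open>linear\<close> is not at hand for them.\<close>

lemma combination_sum:
  fixes f :: "'v::real_vector \<Rightarrow> 'w::real_vector"
  assumes "subspace S"
    and f: "\<And>u v a b. u \<in> S \<Longrightarrow> v \<in> S \<Longrightarrow> f (a *\<^sub>R u + b *\<^sub>R v) = a *\<^sub>R f u + b *\<^sub>R f v"
    and x: "\<And>i. i \<in> I \<Longrightarrow> x i \<in> S"
  shows "f (\<Sum>i\<in>I. c i *\<^sub>R x i) = (\<Sum>i\<in>I. c i *\<^sub>R f (x i))"
proof -
  have f0: "f 0 = 0" using f[of 0 0 0 0] subspace_0[OF \<open>subspace S\<close>] by simp
  show ?thesis using x
  proof (induction I rule: infinite_finite_induct)
    case (insert j I)
    have "(\<Sum>i\<in>I. c i *\<^sub>R x i) \<in> S"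
      using insert.prems \<open>subspace S\<close> by (intro subspace_sum subspace_scale) auto
    then show ?case
      using f[of "x j" "\<Sum>i\<in>I. c i *\<^sub>R x i" "c j" 1] insert by simp
  qed (simp_all add: f0)
qed

text \<open>Finite dimension is expressed by a finite spanning set, which covers dimension 0 too;
  nothing is known about \<open>G\<close> off \<open>S\<close>.\<close>

locale inner_on =
  fixes S :: "'v::real_vector set" and G :: "'v \<Rightarrow> 'v \<Rightarrow> real"
  assumes fin: "\<exists>B. finite B \<and> span B = S"
    and lin: "\<And>u v w a b. u \<in> S \<Longrightarrow> v \<in> S \<Longrightarrow> w \<in> S \<Longrightarrow>
      G (a *\<^sub>R u + b *\<^sub>R v) w = a * G u w + b * G v w"
    and sym: "\<And>u v. u \<in> S \<Longrightarrow> v \<in> S \<Longrightarrow> G u v = G v u"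
    and pos: "\<And>u. u \<in> S \<Longrightarrow> u \<noteq> 0 \<Longrightarrow> G u u > 0"
begin

lemma subspace: "subspace S"
  using fin subspace_span by blast

lemmas S_closed = subspace_add[OF subspace] subspace_scale[OF subspace] subspace_0[OF subspace]
  subspace_diff[OF subspace] subspace_neg[OF subspace] subspace_sum[OF subspace]

lemma lin_right:
  assumes "u \<in> S" "v \<in> S" "w \<in> S"
  shows "G w (a *\<^sub>R u + b *\<^sub>R v) = a * G w u + b * G w v"
  using lin[OF assms, of a b] assms by (simp add: sym S_closed)

lemma G_simps:
  assumes "u \<in> S" "v \<in> S" "w \<in> S"
  shows "G (u + v) w = G u w + G v w" "G w (u + v) = G w u + G w v"
    "G (u - v) w = G u w - G v w" "G w (u - v) = G w u - G w v"
    "G (r *\<^sub>R u) w = r * G u w" "G w (r *\<^sub>R u) = r * G w u"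
    "G (- u) w = - G u w" "G w (- u) = - G w u" "G 0 w = 0" "G w 0 = 0"
  using lin[OF assms, of 1 1] lin[OF assms, of 1 "-1"] lin[OF assms, of r 0] lin[OF assms, of "-1" 0]
    lin[OF assms, of 0 0] lin_right[OF assms, of 1 1] lin_right[OF assms, of 1 "-1"]
    lin_right[OF assms, of r 0] lin_right[OF assms, of "-1" 0] lin_right[OF assms, of 0 0]
  by simp_all

lemma G_sum_left:
  assumes "\<And>i. i \<in> I \<Longrightarrow> x i \<in> S" "w \<in> S"
  shows "G (\<Sum>i\<in>I. c i *\<^sub>R x i) w = (\<Sum>i\<in>I. c i * G (x i) w)"
  using combination_sum[of S "\<lambda>u. G u w" I x c] subspace lin assms by simp

lemma G_sum_right:
  assumes "\<And>i. i \<in> I \<Longrightarrow> x i \<in> S" "w \<in> S"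
  shows "G w (\<Sum>i\<in>I. c i *\<^sub>R x i) = (\<Sum>i\<in>I. c i * G w (x i))"
  using combination_sum[of S "\<lambda>u. G w u" I x c] subspace lin_right assms by simp

lemma eq_0I:
  assumes "u \<in> S" "\<And>w. w \<in> S \<Longrightarrow> G u w = 0"
  shows "u = 0"
  using assms pos by fastforce

lemma eqI:
  assumes "u \<in> S" "v \<in> S" "\<And>w. w \<in> S \<Longrightarrow> G u w = G v w"
  shows "u = v"
  using eq_0I[of "u - v"] assms by (simp add: S_closed G_simps)

definition orthonormal :: "'v set \<Rightarrow> bool" where
  "orthonormal C \<longleftrightarrow> finite C \<and> C \<subseteq> S \<and> (\<forall>a\<in>C. \<forall>b\<in>C. G a b = (if a = b then 1 else 0))"

lemma orthonormal_expand:
  assumes "orthonormal C" "x \<in> span C"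
  shows "(\<Sum>c\<in>C. G x c *\<^sub>R c) = x"
proof -
  have C: "finite C" "C \<subseteq> S" using assms by (auto simp: orthonormal_def)
  obtain u where u: "x = (\<Sum>c\<in>C. u c *\<^sub>R c)"
    using assms(2) by (auto simp: span_finite[OF C(1)])
  have "G x d = u d" if "d \<in> C" for d
  proof -
    have "G x d = (\<Sum>c\<in>C. u c * G c d)"
      unfolding u by (rule G_sum_left) (use C that in auto)
    also have "\<dots> = (\<Sum>c\<in>C. if c = d then u c else 0)"
      using assms(1) that by (intro sum.cong) (auto simp: orthonormal_def)
    finally show ?thesis using that C by simp
  qed
  then show ?thesis unfolding u by (simp cong: sum.cong)
qed

lemma orthonormal_independent:
  assumes "orthonormal C"
  shows "independent C"
proof (rule real_vector.independent_if_scalars_zero)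
  show "finite C" using assms by (auto simp: orthonormal_def)
  fix u d assume z: "(\<Sum>c\<in>C. u c *\<^sub>R c) = 0" and d: "d \<in> C"
  have "0 = G (\<Sum>c\<in>C. u c *\<^sub>R c) d"
    using d assms by (auto simp: z G_simps orthonormal_def S_closed)
  also have "\<dots> = (\<Sum>c\<in>C. u c * G c d)"
    using d assms by (intro G_sum_left) (auto simp: orthonormal_def)
  also have "\<dots> = (\<Sum>c\<in>C. if c = d then u c else 0)"
    using assms d by (intro sum.cong) (auto simp: orthonormal_def)
  finally show "u d = 0" using d assms by (simp add: orthonormal_def)
qed

text \<open>Gram-Schmidt. A new vector that already lies in the span leaves the residual
  \<open>y\<close> = 0 and is dropped; otherwise the residual is normalised by
  \<open>k\<close>.\<close>

lemma orthonormal_exists_finite: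
  assumes "finite B" "B \<subseteq> S"
  shows "\<exists>C. orthonormal C \<and> span C = span B"
  using assms
proof (induction B)
  case empty
  then show ?case by (auto simp: orthonormal_def intro!: exI[of _ "{}"])
next
  case (insert x B)
  then obtain C where C: "orthonormal C" "span C = span B" by auto
  then have CS: "finite C" "C \<subseteq> S" by (auto simp: orthonormal_def)
  have x: "x \<in> S" using insert by auto
  define y where "y = x - (\<Sum>c\<in>C. G x c *\<^sub>R c)"
  have yC: "x - y \<in> span C"
    unfolding y_def by (simp add: span_sum span_scale span_base)
  show ?case
  proof (cases "y = 0")
    case True
    then have "x \<in> span B" using yC C by simp
    then have "span (insert x B) = span B" by (rule real_vector.span_redundant)
    then show ?thesis using C by auto
  next
    case False
    have y: "y \<in> S" unfolding y_def using x CS by (auto intro!: S_closed)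
    have yp: "G y y > 0" using pos y False by auto
    have orth: "G y d = 0" if "d \<in> C" for d
    proof -
      have d: "d \<in> S" using that CS by auto
      have "G y d = G x d - G (\<Sum>c\<in>C. G x c *\<^sub>R c) d"
        unfolding y_def using d x CS by (intro G_simps) (auto intro!: S_closed)
      also have "G (\<Sum>c\<in>C. G x c *\<^sub>R c) d = (\<Sum>c\<in>C. G x c * G c d)"
        by (rule G_sum_left) (use CS d in auto)
      also have "\<dots> = (\<Sum>c\<in>C. if c = d then G x c else 0)"
        using C(1) that by (intro sum.cong) (auto simp: orthonormal_def)
      finally show ?thesis using that CS by simp
    qed
    define k where "k = 1 / sqrt (G y y)"
    have kk: "k * k * G y y = 1" "k \<noteq> 0"
      using yp by (auto simp: k_def)
    let ?z = "k *\<^sub>R y"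
    have "orthonormal (insert ?z C)"
    proof -
      have "G ?z ?z = 1" using y kk by (simp add: G_simps S_closed)
      moreover have "G ?z d = 0" "G d ?z = 0" if "d \<in> C" for d
      proof -
        show z: "G ?z d = 0" using orth[OF that] that CS y by (auto simp: G_simps)
        show "G d ?z = 0" using z that CS y by (subst sym) (auto simp: S_closed)
      qed
      moreover have "?z \<notin> C" using \<open>\<And>d. d \<in> C \<Longrightarrow> G ?z d = 0\<close> \<open>G ?z ?z = 1\<close> by force
      ultimately show ?thesis using C CS y by (auto simp: orthonormal_def S_closed)
    qed
    moreover have "span (insert ?z C) = span (insert x B)"
    proof -
      have BC: "span C \<subseteq> span (insert x B)" unfolding C by (rule span_mono) auto
      have "y \<in> span (insert x B)"
        using span_diff[of x "insert x B" "x - y"] BC yC by (auto simp: span_base)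
      then have 1: "insert ?z C \<subseteq> span (insert x B)"
        using BC by (auto simp: span_scale span_base)
      have CZ: "span C \<subseteq> span (insert ?z C)" by (rule span_mono) auto
      have "(1 / k) *\<^sub>R ?z \<in> span (insert ?z C)" by (rule span_scale) (simp add: span_base)
      then have "y \<in> span (insert ?z C)" using kk by simp
      then have "x \<in> span (insert ?z C)"
        using span_add[of y "insert ?z C" "x - y"] CZ yC by auto
      moreover have "B \<subseteq> span (insert ?z C)" using CZ span_superset[of B] unfolding C by blast
      ultimately show ?thesis using 1 by (auto simp: real_vector.span_eq)
    qed
    ultimately show ?thesis by blast
  qed
qed

lemma orthonormal_exists:
  assumes "subspace V" "V \<subseteq> S"
  shows "\<exists>C. orthonormal C \<and> span C = V"
proof -
  obtain B0 where B0: "finite B0" "span B0 = S" using fin by auto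
  obtain B where B: "B \<subseteq> V" "independent B" "V \<subseteq> span B"
    using real_vector.maximal_independent_subset by blast
  have "finite B"
    using real_vector.independent_span_bound[OF B0(1) B(2)] B(1) assms B0 by auto
  moreover have "span B = V" using B assms by (simp add: span_minimal subset_antisym)
  ultimately show ?thesis using orthonormal_exists_finite[of B] B assms by auto
qed

text \<open>Finiteness is not part of \<open>orthonormal_basis\<close>; it follows because an
  independent set in the span of a finite set is finite.\<close>

lemma orthonormal_basis_iff:
  "orthonormal_basis G S C \<longleftrightarrow> orthonormal C \<and> span C = S"
proof
  assume L: "orthonormal_basis G S C"
  obtain B0 where B0: "finite B0" "span B0 = S" using fin by auto
  have "finite C"
    using real_vector.independent_span_bound[OF B0(1), of C] L B0 span_superset[of C]
    by (auto simp: orthonormal_basis_def)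
  then show "orthonormal C \<and> span C = S"
    using L span_superset[of C] by (auto simp: orthonormal_basis_def orthonormal_def)
next
  assume "orthonormal C \<and> span C = S"
  then show "orthonormal_basis G S C"
    using orthonormal_independent by (auto simp: orthonormal_basis_def orthonormal_def)
qed

lemma projection_exists:
  assumes "subspace V" "V \<subseteq> S" "u \<in> S"
  shows "\<exists>v\<in>V. \<forall>w\<in>V. G (u - v) w = 0"
proof -
  obtain C where C: "orthonormal C" "span C = V" using orthonormal_exists assms by blast
  \<comment> \<open>The Fourier sum of \<open>u\<close> in an orthonormal basis of
    \<open>V\<close>.\<close>
  let ?v = "\<Sum>c\<in>C. G u c *\<^sub>R c"
  have CS: "C \<subseteq> S" "finite C" using C by (auto simp: orthonormal_def)
  have v: "?v \<in> V" unfolding C(2)[symmetric] by (simp add: span_sum span_scale span_base)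
  have "G (u - ?v) w = 0" if "w \<in> V" for w
  proof -
    have w: "w \<in> S" "?v \<in> S" using that v assms by auto
    have "G ?v w = (\<Sum>c\<in>C. G u c * G c w)" by (rule G_sum_left) (use CS w in auto)
    moreover have "G u w = (\<Sum>c\<in>C. G w c * G u c)"
      using G_sum_right[of C "\<lambda>c. c" u "\<lambda>c. G w c"] orthonormal_expand[OF C(1), of w] C CS that assms
      by auto
    moreover have "G c w = G w c" if "c \<in> C" for c using that CS w sym by auto
    ultimately show ?thesis using w assms by (simp add: G_simps mult.commute)
  qed
  with v show ?thesis by blast
qed

lemma orthonormal_basis_union:
  assumes V: "subspace V" "V \<subseteq> S"
    and C: "orthonormal C" "span C = V"
    and D: "orthonormal D" "span D = {u \<in> S. \<forall>v\<in>V. G u v = 0}"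
  shows "orthonormal_basis G S (C \<union> D)" "C \<inter> D = {}"
proof -
  have CV: "C \<subseteq> V" using C span_superset by auto
  have DH: "D \<subseteq> {u \<in> S. \<forall>v\<in>V. G u v = 0}" using D span_superset by auto
  have CD: "G d c = 0 \<and> G c d = 0" if "c \<in> C" "d \<in> D" for c d
  proof -
    have "G d c = 0" using that CV DH by auto
    moreover have "G c d = G d c" using that CV DH V by (intro sym) auto
    ultimately show ?thesis by simp
  qed
  show i: "C \<inter> D = {}" using CD C by (force simp: orthonormal_def)
  have "orthonormal (C \<union> D)"
    using C(1) D(1) CD i by (auto simp: orthonormal_def)
  moreover have "span (C \<union> D) = S"
  proof
    have "C \<union> D \<subseteq> S" using CV V DH by auto
    then show "span (C \<union> D) \<subseteq> S" by (rule span_minimal[OF _ subspace])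
    show "S \<subseteq> span (C \<union> D)"
    proof
      fix u assume u: "u \<in> S"
      obtain v where v: "v \<in> V" "\<forall>w\<in>V. G (u - v) w = 0" using projection_exists[OF V u] by blast
      have "u - v \<in> span D" using v u V D by (auto intro!: S_closed)
      moreover have "v \<in> span C" using v C by simp
      ultimately have "u - v \<in> span (C \<union> D)" "v \<in> span (C \<union> D)"
        using span_mono[of D "C \<union> D"] span_mono[of C "C \<union> D"] by auto
      then show "u \<in> span (C \<union> D)" using span_add[of "u - v" _ v] by fastforce
    qed
  qed
  ultimately show "orthonormal_basis G S (C \<union> D)" by (simp add: orthonormal_basis_iff)
qed

text \<open>Expanding the second argument of each \<open>\<beta> c c\<close> in \<open>D\<close>,
  and the first argument of each \<open>\<beta> d d\<close> in \<open>C\<close>, turns both sums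
  into the same double sum. This removes the basis choice from \<open>metric_trace\<close>.\<close>

lemma bilinear_trace_eq:
  fixes \<beta> :: "'v \<Rightarrow> 'v \<Rightarrow> 'w::real_vector"
  assumes C: "orthonormal C" "span C = S" and D: "orthonormal D" "span D = S"
    and left: "\<And>u v w a b. u \<in> S \<Longrightarrow> v \<in> S \<Longrightarrow> w \<in> S \<Longrightarrow>
      \<beta> (a *\<^sub>R u + b *\<^sub>R v) w = a *\<^sub>R \<beta> u w + b *\<^sub>R \<beta> v w"
    and right: "\<And>u v w a b. u \<in> S \<Longrightarrow> v \<in> S \<Longrightarrow> w \<in> S \<Longrightarrow>
      \<beta> w (a *\<^sub>R u + b *\<^sub>R v) = a *\<^sub>R \<beta> w u + b *\<^sub>R \<beta> w v"
  shows "(\<Sum>c\<in>C. \<beta> c c) = (\<Sum>d\<in>D. \<beta> d d)"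
proof -
  have CS: "C \<subseteq> S" and DS: "D \<subseteq> S" and fC: "finite C" and fD: "finite D"
    using C D by (auto simp: orthonormal_def)
  have 1: "\<beta> c c = (\<Sum>d\<in>D. G c d *\<^sub>R \<beta> c d)" if "c \<in> C" for c
  proof -
    have "\<beta> c (\<Sum>d\<in>D. G c d *\<^sub>R d) = (\<Sum>d\<in>D. G c d *\<^sub>R \<beta> c d)"
      by (rule combination_sum[OF subspace]) (use right that CS DS in auto)
    moreover have "(\<Sum>d\<in>D. G c d *\<^sub>R d) = c"
      by (rule orthonormal_expand[OF D(1)]) (use D that CS in auto)
    ultimately show ?thesis by simp
  qed
  have 2: "\<beta> d d = (\<Sum>c\<in>C. G c d *\<^sub>R \<beta> c d)" if "d \<in> D" for d
  proof -
    have "\<beta> d d = (\<Sum>c\<in>C. G d c *\<^sub>R \<beta> c d)"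
    proof -
      have "\<beta> (\<Sum>c\<in>C. G d c *\<^sub>R c) d = (\<Sum>c\<in>C. G d c *\<^sub>R \<beta> c d)"
        by (rule combination_sum[OF subspace, of "\<lambda>x. \<beta> x d"]) (use left that CS DS in auto)
      moreover have "(\<Sum>c\<in>C. G d c *\<^sub>R c) = d"
        by (rule orthonormal_expand[OF C(1)]) (use C that DS in auto)
      ultimately show ?thesis by simp
    qed
    also have "\<dots> = (\<Sum>c\<in>C. G c d *\<^sub>R \<beta> c d)"
      using that CS DS by (intro sum.cong) (auto simp: sym subset_iff)
    finally show ?thesis .
  qed
  have "(\<Sum>c\<in>C. \<beta> c c) = (\<Sum>c\<in>C. \<Sum>d\<in>D. G c d *\<^sub>R \<beta> c d)" by (simp add: 1)
  also have "\<dots> = (\<Sum>d\<in>D. \<Sum>c\<in>C. G c d *\<^sub>R \<beta> c d)" by (rule sum.swap)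
  also have "\<dots> = (\<Sum>d\<in>D. \<beta> d d)" by (simp add: 2)
  finally show ?thesis .
qed

lemma metric_trace_eq:
  fixes \<beta> :: "'v \<Rightarrow> 'v \<Rightarrow> 'w::real_vector"
  assumes D: "orthonormal_basis G S D"
    and "\<And>u v w a b. u \<in> S \<Longrightarrow> v \<in> S \<Longrightarrow> w \<in> S \<Longrightarrow>
      \<beta> (a *\<^sub>R u + b *\<^sub>R v) w = a *\<^sub>R \<beta> u w + b *\<^sub>R \<beta> v w"
    and "\<And>u v w a b. u \<in> S \<Longrightarrow> v \<in> S \<Longrightarrow> w \<in> S \<Longrightarrow>
      \<beta> w (a *\<^sub>R u + b *\<^sub>R v) = a *\<^sub>R \<beta> w u + b *\<^sub>R \<beta> w v"
  shows "metric_trace G S \<beta> = (\<Sum>d\<in>D. \<beta> d d)"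
proof -
  have "orthonormal_basis G S (SOME B. orthonormal_basis G S B)"
    using D by (rule someI)
  then show ?thesis
    using D assms(2,3) unfolding metric_trace_def Let_def orthonormal_basis_iff
    by (intro bilinear_trace_eq) auto
qed

text \<open>The basis chosen in \<open>trace_on\<close> is arbitrary, so coefficients and inner
  products are mixed: both sides are the double sum of \<open>G b d\<close> times the
  \<open>b\<close>-coefficient of \<open>A d\<close>.\<close>

lemma trace_on_eq:
  assumes D: "orthonormal_basis G S D"
    and A: "\<And>u. u \<in> S \<Longrightarrow> A u \<in> S"
    and lin_A: "\<And>u v a b. u \<in> S \<Longrightarrow> v \<in> S \<Longrightarrow> A (a *\<^sub>R u + b *\<^sub>R v) = a *\<^sub>R A u + b *\<^sub>R A v"
  shows "trace_on S A = (\<Sum>d\<in>D. G (A d) d)"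
proof -
  have D': "orthonormal D" "span D = S" using D by (auto simp: orthonormal_basis_iff)
  have DS: "D \<subseteq> S" "finite D" using D' by (auto simp: orthonormal_def)
  define B where "B = (SOME B. independent B \<and> span B = S)"
  have "independent B \<and> span B = S"
    unfolding B_def by (rule someI[of _ D]) (use D in \<open>simp add: orthonormal_basis_def\<close>)
  then have B: "independent B" "span B = S" by auto
  have fB: "finite B"
    using real_vector.independent_span_bound[OF \<open>finite D\<close> B(1)] D' B span_superset[of B] by auto
  have BS: "B \<subseteq> S" using B span_superset by auto
  let ?R = "representation B"
  have 1: "?R (A b) b = (\<Sum>d\<in>D. G b d * ?R (A d) b)" if "b \<in> B" for b
  proof -
    have "A b = (\<Sum>d\<in>D. G b d *\<^sub>R A d)"
    proof -
      have "A (\<Sum>d\<in>D. G b d *\<^sub>R d) = (\<Sum>d\<in>D. G b d *\<^sub>R A d)"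
        by (rule combination_sum[OF subspace]) (use lin_A DS in auto)
      moreover have "(\<Sum>d\<in>D. G b d *\<^sub>R d) = b"
        by (rule orthonormal_expand[OF D'(1)]) (use D' that BS in auto)
      ultimately show ?thesis by simp
    qed
    then show ?thesis
      using B A DS
      by (auto simp: real_vector.representation_sum real_vector.representation_scale span_scale subset_iff
          intro!: sum.cong)
  qed
  have 2: "G (A d) d = (\<Sum>b\<in>B. G b d * ?R (A d) b)" if "d \<in> D" for d
  proof -
    have "A d = (\<Sum>b\<in>B. ?R (A d) b *\<^sub>R b)"
      using real_vector.sum_representation_eq[OF B(1), of "A d" B] A that DS B fB by auto
    moreover have "G (\<Sum>b\<in>B. ?R (A d) b *\<^sub>R b) d = (\<Sum>b\<in>B. ?R (A d) b * G b d)"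
      by (rule G_sum_left) (use BS DS that in auto)
    ultimately show ?thesis by (simp add: mult.commute)
  qed
  have "trace_on S A = (\<Sum>b\<in>B. \<Sum>d\<in>D. G b d * ?R (A d) b)"
    by (simp add: trace_on_def Let_def B_def[symmetric] 1)
  also have "\<dots> = (\<Sum>d\<in>D. \<Sum>b\<in>B. G b d * ?R (A d) b)" by (rule sum.swap)
  also have "\<dots> = (\<Sum>d\<in>D. G (A d) d)" by (simp add: 2)
  finally show ?thesis .
qed

end

lemma finite_orthonormal_basis:
  fixes B :: "'f::real_inner set"
  assumes "finite B" "span B = UNIV"
  shows "\<exists>C. finite C \<and> independent C \<and> span C = (UNIV :: 'f set) \<and> (\<forall>x. (\<Sum>c\<in>C. (c \<bullet> x) *\<^sub>R c) = x)"
proof -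
  interpret inner_on "UNIV :: 'f set" "(\<bullet>)"
    by standard (use assms in \<open>auto simp: inner_add_left intro: inner_commute\<close>)
  obtain C where C: "orthonormal C" "span C = UNIV"
    using orthonormal_exists[of UNIV] by auto
  then show ?thesis
    using orthonormal_expand[OF C(1)] orthonormal_independent[OF C(1)]
    by (auto simp: orthonormal_def inner_commute intro!: exI[of _ C])
qed

section \<open>Smooth functions and tangent vectors\<close>

lemma Cinf_on_cong: "open S \<Longrightarrow> (\<And>x. x \<in> S \<Longrightarrow> f x = g x) \<Longrightarrow> Cinf_on S f \<Longrightarrow> Cinf_on S g"
  unfolding Cinf_on_def by (auto intro: Ck_on_cong[of S f g])

lemma Cinf_on_mono: "Cinf_on S f \<Longrightarrow> T \<subseteq> S \<Longrightarrow> Cinf_on T f"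
  unfolding Cinf_on_def by (intro allI, rule Ck_on_mono) auto

lemma Cinf_on_local:
  "(\<And>x. x \<in> S \<Longrightarrow> \<exists>T. open T \<and> x \<in> T \<and> Cinf_on T f) \<Longrightarrow> Cinf_on S f"
  unfolding Cinf_on_def by (intro allI, rule Ck_on_local) fast

lemma Cinf_on_linear: "open S \<Longrightarrow> bounded_linear L \<Longrightarrow> Cinf_on S L"
  by (simp add: Cinf_on_def Ck_on_linear)

lemma Cinf_on_const: "open S \<Longrightarrow> Cinf_on S (\<lambda>x. k)"
  by (simp add: Cinf_on_def Ck_on_const)

lemma Cinf_on_add:
  "open S \<Longrightarrow> Cinf_on S f \<Longrightarrow> Cinf_on S g \<Longrightarrow> Cinf_on S (\<lambda>x. f x + g x)"
  by (simp add: Cinf_on_def Ck_on_add)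

lemma Cinf_on_mult:
  fixes f g :: "_ \<Rightarrow> real"
  shows "open S \<Longrightarrow> Cinf_on S f \<Longrightarrow> Cinf_on S g \<Longrightarrow> Cinf_on S (\<lambda>x. f x * g x)"
  unfolding Cinf_on_def using Ck_on_scaleR[of S _ f g] by simp

lemma Cinf_on_inverse:
  fixes f :: "_ \<Rightarrow> real"
  shows "open S \<Longrightarrow> Cinf_on S f \<Longrightarrow> (\<And>x. x \<in> S \<Longrightarrow> f x \<noteq> 0) \<Longrightarrow> Cinf_on S (\<lambda>x. inverse (f x))"
  by (simp add: Cinf_on_def Ck_on_inverse)

lemma act_simps [simp]:
  "act 0 f = 0" "act (u + v) f = act u f + act v f" "act (u - v) f = act u f - act v f"
  "act (- u) f = - act u f" "act (r *\<^sub>R u) f = r * act u f"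
  by (simp_all add: zero_tvec_def plus_tvec_def minus_tvec_def uminus_tvec_def scaleR_tvec_def)

lemma act_sum [simp]: "act (\<Sum>i\<in>I. u i) f = (\<Sum>i\<in>I. act (u i) f)"
  by (induction I rule: infinite_finite_induct) auto

locale manifold =
  fixes M :: "('a::{t2_space,second_countable_topology}, 'e::real_inner) atlas"
  assumes smooth_manifold: "smooth_manifold M"
begin

text \<open>Plays the role of \<open>Basis\<close> for a model space whose dimension may be
  0.\<close>

definition onb :: "'e set" where
  "onb = (SOME C. finite C \<and> independent C \<and> span C = (UNIV :: 'e set) \<and>
     (\<forall>x. (\<Sum>c\<in>C. (c \<bullet> x) *\<^sub>R c) = x))"

lemma onb: "finite onb" "independent onb" "span onb = UNIV" "(\<Sum>b\<in>onb. (b \<bullet> x) *\<^sub>R b) = x"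
proof -
  obtain B where "finite B" "span B = (UNIV :: 'e set)"
    using smooth_manifold by (auto simp: smooth_manifold_def)
  from someI_ex[OF finite_orthonormal_basis[OF this]]
  show "finite onb" "independent onb" "span onb = UNIV" "(\<Sum>b\<in>onb. (b \<bullet> x) *\<^sub>R b) = x"
    unfolding onb_def by auto
qed

lemma Cinf_on_compose:
  fixes f :: "'d::real_normed_vector \<Rightarrow> 'e" and g :: "'e \<Rightarrow> 'c::real_normed_vector"
  assumes "open S" "open T" "f ` S \<subseteq> T" "Cinf_on S f" "Cinf_on T g"
  shows "Cinf_on S (\<lambda>x. g (f x))"
  using assms(4,5) Ck_on_compose[OF onb(1,4) assms(1-3)] unfolding Cinf_on_def by blast

lemma ex_chart: obtains U c where "(U, c) \<in> M" "p \<in> U"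
proof -
  have "p \<in> (\<Union>(U, c)\<in>M. U)" using smooth_manifold by (simp add: smooth_manifold_def)
  then show ?thesis using that by auto
qed

lemma chartD:
  assumes "(U, c) \<in> M"
  shows "open U" "open (c ` U)" "homeomorphism U (c ` U) c (inv_into U c)"
  using smooth_manifold assms by (auto simp: smooth_manifold_def)

lemma inv_chart [simp]: "(U, c) \<in> M \<Longrightarrow> q \<in> U \<Longrightarrow> inv_into U c (c q) = q"
  using chartD(3) by (simp add: homeomorphism_def)

lemma open_chart_image:
  assumes "(U, c) \<in> M" "open W"
  shows "open (c ` (U \<inter> W))"
proof -
  have "c ` (U \<inter> W) = c ` U \<inter> inv_into U c -` W"
    using assms by auto
  moreover have "open (c ` U \<inter> inv_into U c -` W)"
    using chartD[OF assms(1)] assms(2)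
    by (intro continuous_open_preimage) (auto simp: homeomorphism_def)
  ultimately show ?thesis by simp
qed

lemma transition:
  "(U, c) \<in> M \<Longrightarrow> (V, d) \<in> M \<Longrightarrow> Cinf_on (c ` (U \<inter> V)) (\<lambda>y. d (inv_into U c y))"
  using smooth_manifold by (auto simp: smooth_manifold_def o_def)

lemma smooth_fun_iff:
  "smooth_fun M W f \<longleftrightarrow> (\<forall>U c. (U, c) \<in> M \<longrightarrow> Cinf_on (c ` (U \<inter> W)) (\<lambda>y. f (inv_into U c y)))"
  by (auto simp: smooth_fun_def o_def)

text \<open>One chart containing \<open>W\<close> is enough: any other coordinate expression is this
  one composed with a transition map.\<close>

lemma smooth_fun_chartI:
  assumes "(U, c) \<in> M" "open W" "W \<subseteq> U" "Cinf_on (c ` W) (\<lambda>y. f (inv_into U c y))"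
  shows "smooth_fun M W f"
  unfolding smooth_fun_iff
proof (intro allI impI)
  fix V d assume V: "(V, d) \<in> M"
  have oW: "open (c ` W)" using open_chart_image[OF assms(1,2)] assms(3) by (simp add: Int_absorb1)
  have o: "open (d ` (V \<inter> W))" using open_chart_image[OF V assms(2)] .
  have "Cinf_on (d ` (V \<inter> W)) (\<lambda>y. c (inv_into V d y))"
    by (rule Cinf_on_mono[OF transition[OF V assms(1)]]) (use assms(3) in auto)
  then have "Cinf_on (d ` (V \<inter> W)) (\<lambda>y. f (inv_into U c (c (inv_into V d y))))"
    using V by (intro Cinf_on_compose[OF o oW _ _ assms(4)]) auto
  then show "Cinf_on (d ` (V \<inter> W)) (\<lambda>y. f (inv_into V d y))"
  proof (rule Cinf_on_cong[OF o, rotated -1])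
    fix y assume "y \<in> d ` (V \<inter> W)"
    then obtain q where "q \<in> V" "q \<in> U" "y = d q" using assms(3) by blast
    then show "f (inv_into U c (c (inv_into V d y))) = f (inv_into V d y)"
      using V assms(1) by simp
  qed
qed

lemma smooth_fun_subset: "smooth_fun M W f \<Longrightarrow> V \<subseteq> W \<Longrightarrow> smooth_fun M V f"
  unfolding smooth_fun_iff
proof (intro allI impI)
  fix U c assume "\<forall>U c. (U, c) \<in> M \<longrightarrow> Cinf_on (c ` (U \<inter> W)) (\<lambda>y. f (inv_into U c y))"
    "V \<subseteq> W" "(U, c) \<in> M"
  then show "Cinf_on (c ` (U \<inter> V)) (\<lambda>y. f (inv_into U c y))"
    using Cinf_on_mono[of "c ` (U \<inter> W)" _ "c ` (U \<inter> V)"] by blast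
qed

lemma smooth_fun_cong:
  assumes "open W" "\<And>q. q \<in> W \<Longrightarrow> f q = g q" "smooth_fun M W f"
  shows "smooth_fun M W g"
  unfolding smooth_fun_iff
proof (intro allI impI)
  fix U c assume U: "(U, c) \<in> M"
  then have "Cinf_on (c ` (U \<inter> W)) (\<lambda>y. f (inv_into U c y))"
    using assms(3) by (auto simp: smooth_fun_iff)
  then show "Cinf_on (c ` (U \<inter> W)) (\<lambda>y. g (inv_into U c y))"
  proof (rule Cinf_on_cong[OF open_chart_image[OF U assms(1)], rotated -1])
    fix y assume "y \<in> c ` (U \<inter> W)"
    then show "f (inv_into U c y) = g (inv_into U c y)" using U assms(2) by auto
  qed
qed

lemma smooth_fun_local:
  assumes "\<And>q. q \<in> W \<Longrightarrow> \<exists>T. open T \<and> q \<in> T \<and> smooth_fun M T f"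
  shows "smooth_fun M W f"
  unfolding smooth_fun_iff
proof (intro allI impI)
  fix U c assume U: "(U, c) \<in> M"
  show "Cinf_on (c ` (U \<inter> W)) (\<lambda>y. f (inv_into U c y))"
  proof (rule Cinf_on_local)
    fix y assume "y \<in> c ` (U \<inter> W)"
    then obtain q where q: "q \<in> U" "q \<in> W" "y = c q" by auto
    then obtain T where T: "open T" "q \<in> T" "smooth_fun M T f" using assms by blast
    then have "open (c ` (U \<inter> T))" "y \<in> c ` (U \<inter> T)" "Cinf_on (c ` (U \<inter> T)) (\<lambda>y. f (inv_into U c y))"
      using U q open_chart_image by (auto simp: smooth_fun_iff)
    then show "\<exists>T. open T \<and> y \<in> T \<and> Cinf_on T (\<lambda>y. f (inv_into U c y))" by blast
  qed
qed

lemma smooth_fun_const: "open W \<Longrightarrow> smooth_fun M W (\<lambda>q. k)"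
  by (simp add: smooth_fun_iff Cinf_on_const open_chart_image)

lemma smooth_fun_add:
  "open W \<Longrightarrow> smooth_fun M W f \<Longrightarrow> smooth_fun M W g \<Longrightarrow> smooth_fun M W (\<lambda>q. f q + g q)"
  by (simp add: smooth_fun_iff Cinf_on_add open_chart_image)

lemma smooth_fun_mult:
  "open W \<Longrightarrow> smooth_fun M W f \<Longrightarrow> smooth_fun M W g \<Longrightarrow> smooth_fun M W (\<lambda>q. f q * g q)"
  by (simp add: smooth_fun_iff Cinf_on_mult open_chart_image)

lemma smooth_fun_minus: "open W \<Longrightarrow> smooth_fun M W f \<Longrightarrow> smooth_fun M W (\<lambda>q. - f q)"
  using smooth_fun_mult[of W "\<lambda>q. - 1" f] smooth_fun_const[of W "- 1"] by simp

lemma smooth_fun_inverse: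
  assumes "open W" "smooth_fun M W f" "\<And>q. q \<in> W \<Longrightarrow> f q \<noteq> 0"
  shows "smooth_fun M W (\<lambda>q. inverse (f q))"
  unfolding smooth_fun_iff
proof (intro allI impI)
  fix U c assume U: "(U, c) \<in> M"
  show "Cinf_on (c ` (U \<inter> W)) (\<lambda>y. inverse (f (inv_into U c y)))"
    by (rule Cinf_on_inverse[OF open_chart_image[OF U assms(1)]])
      (use U assms(2,3) in \<open>auto simp: smooth_fun_iff\<close>)
qed

lemma smooth_fun_sum:
  "open W \<Longrightarrow> (\<And>i. i \<in> I \<Longrightarrow> smooth_fun M W (f i)) \<Longrightarrow> smooth_fun M W (\<lambda>q. \<Sum>i\<in>I. f i q)"
  by (induction I rule: infinite_finite_induct) (simp_all add: smooth_fun_add smooth_fun_const)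

lemma smooth_fun_coordinate:
  assumes "(U, c) \<in> M"
  shows "smooth_fun M U (\<lambda>q. b \<bullet> c q)"
proof (rule smooth_fun_chartI[OF assms chartD(1)[OF assms]])
  have "Cinf_on (c ` U) (\<lambda>y. b \<bullet> y)"
    by (rule Cinf_on_linear[OF chartD(2)[OF assms] bounded_linear_inner_right])
  then show "Cinf_on (c ` U) (\<lambda>y. b \<bullet> c (inv_into U c y))"
    by (rule Cinf_on_cong[OF chartD(2)[OF assms], rotated -1]) (use assms in auto)
qed simp

lemma smooth_nearI: "open W \<Longrightarrow> p \<in> W \<Longrightarrow> smooth_fun M W f \<Longrightarrow> smooth_near M p f"
  by (auto simp: smooth_near_def)

lemma smooth_near2E:
  assumes "smooth_near M p f" "smooth_near M p g"
  obtains W where "open W" "p \<in> W" "smooth_fun M W f" "smooth_fun M W g"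
proof -
  obtain V W where "open V" "p \<in> V" "smooth_fun M V f" "open W" "p \<in> W" "smooth_fun M W g"
    using assms by (auto simp: smooth_near_def)
  then show ?thesis using smooth_fun_subset by (intro that[of "V \<inter> W"]) auto
qed

lemma smooth_near_cong:
  assumes "\<forall>\<^sub>F q in nhds p. f q = g q" "smooth_near M p f"
  shows "smooth_near M p g"
proof -
  obtain W where W: "open W" "p \<in> W" "smooth_fun M W f" using assms(2) by (auto simp: smooth_near_def)
  obtain V where V: "open V" "p \<in> V" "\<forall>q\<in>V. f q = g q" using assms(1) by (auto simp: eventually_nhds)
  have "smooth_fun M (V \<inter> W) g"
    by (rule smooth_fun_cong[of _ f]) (use V W smooth_fun_subset in auto)
  then show ?thesis using V W by (auto intro!: smooth_nearI[of "V \<inter> W"])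
qed

lemma smooth_near_cong_iff:
  assumes "\<forall>\<^sub>F q in nhds p. f q = g q"
  shows "smooth_near M p f \<longleftrightarrow> smooth_near M p g"
proof
  show "smooth_near M p g \<Longrightarrow> smooth_near M p f"
    by (rule smooth_near_cong[rotated]) (use assms in \<open>auto elim: eventually_mono\<close>)
qed (rule smooth_near_cong[OF assms])

lemma smooth_near_const: "smooth_near M p (\<lambda>q. k)"
  using smooth_fun_const[of UNIV k] by (auto intro: smooth_nearI)

lemma smooth_near_add: "smooth_near M p f \<Longrightarrow> smooth_near M p g \<Longrightarrow> smooth_near M p (\<lambda>q. f q + g q)"
  by (erule (1) smooth_near2E) (rule smooth_nearI[OF _ _ smooth_fun_add])

lemma smooth_near_minus: "smooth_near M p f \<Longrightarrow> smooth_near M p (\<lambda>q. - f q)"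
  unfolding smooth_near_def using smooth_fun_minus by blast

lemma has_derivative_chart:
  assumes "(U, c) \<in> M" "p \<in> U" "smooth_near M p f"
  shows "((\<lambda>y. f (inv_into U c y)) has_derivative
    frechet_derivative (\<lambda>y. f (inv_into U c y)) (at (c p))) (at (c p))"
proof -
  obtain W where W: "open W" "p \<in> W" "smooth_fun M W f" using assms(3) by (auto simp: smooth_near_def)
  then show ?thesis using assms
    by (intro Cinf_on_has_derivative[of "c ` (U \<inter> W)"]) (auto simp: smooth_fun_iff)
qed

lemma act_chart_vec:
  "smooth_near M p f \<Longrightarrow>
    act (chart_vec M (U, c) p w) f = frechet_derivative (\<lambda>y. f (inv_into U c y)) (at (c p)) w"
  by (simp add: chart_vec_def o_def)

lemma act_chart_vec_not_smooth: "\<not> smooth_near M p f \<Longrightarrow> act (chart_vec M \<kappa> p w) f = 0"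
  by (simp add: chart_vec_def)

lemma chart_vec_linear:
  assumes "(U, c) \<in> M" "p \<in> U"
  shows "linear (chart_vec M (U, c) p)"
proof (rule linearI)
  have l: "linear (frechet_derivative (\<lambda>y. f (inv_into U c y)) (at (c p)))" if "smooth_near M p f" for f
    using has_derivative_chart[OF assms that] has_derivative_linear by blast
  fix w w' r
  show "chart_vec M (U, c) p (w + w') = chart_vec M (U, c) p w + chart_vec M (U, c) p w'"
    using linear_add[OF l] by (intro tvec_eqI) (simp add: chart_vec_def o_def)
  show "chart_vec M (U, c) p (r *\<^sub>R w) = r *\<^sub>R chart_vec M (U, c) p w"
    using linear_cmul[OF l] by (intro tvec_eqI) (simp add: chart_vec_def o_def)
qed

text \<open>The chain rule for the transition map; on functions that are not smooth near
  \<open>p\<close> both sides are 0 by convention. Hence a single chart yields the whole tangent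
  space.\<close>

lemma chart_vec_change:
  assumes "(U, c) \<in> M" "p \<in> U" "(V, d) \<in> M" "p \<in> V"
  shows "chart_vec M (V, d) p w =
    chart_vec M (U, c) p (frechet_derivative (\<lambda>y. c (inv_into V d y)) (at (d p)) w)"
proof (rule tvec_eqI)
  fix f :: "'a \<Rightarrow> real"
  let ?t = "\<lambda>y. c (inv_into V d y)" and ?f = "\<lambda>y. f (inv_into U c y)"
  show "act (chart_vec M (V, d) p w) f =
    act (chart_vec M (U, c) p (frechet_derivative ?t (at (d p)) w)) f"
  proof (cases "smooth_near M p f")
    case True
    have t: "(?t has_derivative frechet_derivative ?t (at (d p))) (at (d p))"
      using transition[OF assms(3,1)] assms by (intro Cinf_on_has_derivative[of "d ` (V \<inter> U)"]) auto
    have "(?f has_derivative frechet_derivative ?f (at (?t (d p)))) (at (?t (d p)))"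
      using has_derivative_chart[OF assms(1,2) True] assms by simp
    from has_derivative_compose[OF t this]
    have "((\<lambda>y. ?f (?t y)) has_derivative
        (\<lambda>w. frechet_derivative ?f (at (c p)) (frechet_derivative ?t (at (d p)) w))) (at (d p))"
      using assms by simp
    then have "((\<lambda>y. f (inv_into V d y)) has_derivative
        (\<lambda>w. frechet_derivative ?f (at (c p)) (frechet_derivative ?t (at (d p)) w))) (at (d p))"
      by (rule has_derivative_transform_within_open[of _ _ _ _ "d ` (V \<inter> U)"])
        (use assms open_chart_image[OF assms(3) chartD(1)[OF assms(1)]] in auto)
    from frechet_derivative_at[OF this] show ?thesis
      by (simp add: act_chart_vec[OF True] fun_eq_iff)
  qed (simp add: act_chart_vec_not_smooth)
qed

lemma tangent_space_eq:
  assumes "(U, c) \<in> M" "p \<in> U"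
  shows "tangent_space M p = range (chart_vec M (U, c) p)"
proof
  show "tangent_space M p \<subseteq> range (chart_vec M (U, c) p)"
  proof
    fix v assume "v \<in> tangent_space M p"
    then obtain V d w where "v = chart_vec M (V, d) p w" "(V, d) \<in> M" "p \<in> V"
      by (auto simp: tangent_space_def)
    then show "v \<in> range (chart_vec M (U, c) p)" using chart_vec_change[OF assms] by auto
  qed
  show "range (chart_vec M (U, c) p) \<subseteq> tangent_space M p"
    using assms by (force simp: tangent_space_def)
qed

lemma chart_vec_in_tangent [intro]:
  "(U, c) \<in> M \<Longrightarrow> p \<in> U \<Longrightarrow> chart_vec M (U, c) p w \<in> tangent_space M p"
  by (simp add: tangent_space_eq)

lemma tangent_span:
  assumes "(U, c) \<in> M" "p \<in> U"
  shows "span (chart_vec M (U, c) p ` onb) = tangent_space M p"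
  using linear_span_image[OF chart_vec_linear[OF assms], of onb] onb(3)
  by (simp add: tangent_space_eq[OF assms])

lemma tangent_finite_dim: "\<exists>B. finite B \<and> span B = tangent_space M p"
proof -
  obtain U c where "(U, c) \<in> M" "p \<in> U" by (rule ex_chart)
  from tangent_span[OF this] onb(1) show ?thesis by blast
qed

lemma tangent_subspace: "subspace (tangent_space M p)"
proof -
  obtain B where "span B = tangent_space M p" using tangent_finite_dim by blast
  then show ?thesis using subspace_span[of B] by simp
qed

lemma act_not_smooth: "v \<in> tangent_space M p \<Longrightarrow> \<not> smooth_near M p f \<Longrightarrow> act v f = 0"
  by (auto simp: tangent_space_def act_chart_vec_not_smooth)

lemma tangent_eqI:
  assumes "u \<in> tangent_space M p" "v \<in> tangent_space M p"
    "\<And>f. smooth_near M p f \<Longrightarrow> act u f = act v f"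
  shows "u = v"
proof (rule tvec_eqI)
  show "act u f = act v f" for f
    using assms act_not_smooth by (cases "smooth_near M p f") auto
qed

text \<open>The coordinate functions recover \<open>w\<close>; injectivity of
  \<open>chart_vec\<close> and the expansion of a tangent vector in coordinate vectors both rest on
  this.\<close>

lemma act_coordinate:
  assumes "(U, c) \<in> M" "p \<in> U"
  shows "act (chart_vec M (U, c) p w) (\<lambda>q. b \<bullet> c q) = b \<bullet> w"
proof -
  have s: "smooth_near M p (\<lambda>q. b \<bullet> c q)"
    using assms by (intro smooth_nearI[OF chartD(1) _ smooth_fun_coordinate])
  have "((\<lambda>y. b \<bullet> y) has_derivative (\<lambda>w. b \<bullet> w)) (at (c p))"
    by (intro bounded_linear_imp_has_derivative bounded_linear_inner_right)
  then have "((\<lambda>y. b \<bullet> c (inv_into U c y)) has_derivative (\<lambda>w. b \<bullet> w)) (at (c p))"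
    by (rule has_derivative_transform_within_open[of _ _ _ _ "c ` U"])
      (use assms chartD(2)[OF assms(1)] in auto)
  from fun_cong[OF frechet_derivative_at[OF this], of w] show ?thesis
    by (simp only: act_chart_vec[OF s])
qed

lemma chart_vec_inj:
  assumes "(U, c) \<in> M" "p \<in> U"
  shows "inj (chart_vec M (U, c) p)"
proof (rule injI)
  fix w w' assume "chart_vec M (U, c) p w = chart_vec M (U, c) p w'"
  then have "b \<bullet> w = b \<bullet> w'" for b
    using act_coordinate[OF assms, of w b] act_coordinate[OF assms, of w' b] by simp
  then have "(\<Sum>b\<in>onb. (b \<bullet> w) *\<^sub>R b) = (\<Sum>b\<in>onb. (b \<bullet> w') *\<^sub>R b)" by simp
  then show "w = w'" by (simp only: onb)
qed

lemma tangent_expand: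
  assumes "(U, c) \<in> M" "p \<in> U" "v \<in> tangent_space M p"
  shows "(\<Sum>b\<in>onb. act v (\<lambda>q. b \<bullet> c q) *\<^sub>R chart_vec M (U, c) p b) = v"
proof -
  obtain w where w: "v = chart_vec M (U, c) p w" using assms by (auto simp: tangent_space_eq)
  have l: "linear (chart_vec M (U, c) p)" by (rule chart_vec_linear[OF assms(1,2)])
  have "(\<Sum>b\<in>onb. act v (\<lambda>q. b \<bullet> c q) *\<^sub>R chart_vec M (U, c) p b) =
      (\<Sum>b\<in>onb. chart_vec M (U, c) p ((b \<bullet> w) *\<^sub>R b))"
    unfolding w act_coordinate[OF assms(1,2)] by (simp only: linear_cmul[OF l])
  also have "\<dots> = chart_vec M (U, c) p (\<Sum>b\<in>onb. (b \<bullet> w) *\<^sub>R b)"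
    by (rule linear_sum[OF l, symmetric])
  finally show ?thesis by (simp only: onb w)
qed

text \<open>A tangent vector sees only germs. Functions not smooth near \<open>p\<close> form a
  separate case, in which both values are the default 0.\<close>

lemma act_cong:
  assumes "v \<in> tangent_space M p" "\<forall>\<^sub>F q in nhds p. f q = g q"
  shows "act v f = act v g"
proof (cases "smooth_near M p f")
  case True
  then have g: "smooth_near M p g" using smooth_near_cong[OF assms(2)] by simp
  obtain U c where U: "(U, c) \<in> M" "p \<in> U" by (rule ex_chart)
  then obtain w where w: "v = chart_vec M (U, c) p w" using assms by (auto simp: tangent_space_eq)
  obtain V where V: "open V" "p \<in> V" "\<forall>q\<in>V. f q = g q" using assms(2) by (auto simp: eventually_nhds)
  have "((\<lambda>y. g (inv_into U c y)) has_derivative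
      frechet_derivative (\<lambda>y. f (inv_into U c y)) (at (c p))) (at (c p))"
    by (rule has_derivative_transform_within_open[OF has_derivative_chart[OF U True], of "c ` (U \<inter> V)"])
      (use V U open_chart_image in auto)
  from frechet_derivative_at[OF this] show ?thesis by (simp add: w act_chart_vec True g)
next
  case False
  then show ?thesis using act_not_smooth[OF assms(1)] smooth_near_cong_iff[OF assms(2)] by simp
qed

lemma act_const: "v \<in> tangent_space M p \<Longrightarrow> act v (\<lambda>q. k) = 0"
  by (auto simp: tangent_space_def act_chart_vec smooth_near_const)

lemma act_add:
  assumes "v \<in> tangent_space M p" "smooth_near M p f" "smooth_near M p g"
  shows "act v (\<lambda>q. f q + g q) = act v f + act v g"
proof -
  obtain U c where U: "(U, c) \<in> M" "p \<in> U" by (rule ex_chart)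
  then obtain w where w: "v = chart_vec M (U, c) p w" using assms by (auto simp: tangent_space_eq)
  show ?thesis
    using fun_cong[OF frechet_derivative_at[OF has_derivative_add[OF has_derivative_chart[OF U assms(2)]
        has_derivative_chart[OF U assms(3)]]], of w]
    unfolding w act_chart_vec[OF assms(2)] act_chart_vec[OF assms(3)]
      act_chart_vec[OF smooth_near_add[OF assms(2,3)]] by simp
qed

lemma act_minus:
  assumes "v \<in> tangent_space M p"
  shows "act v (\<lambda>q. - f q) = - act v f"
proof (cases "smooth_near M p f")
  case True
  have "act v (\<lambda>q. f q + - f q) = act v f + act v (\<lambda>q. - f q)"
    by (rule act_add[OF assms True smooth_near_minus[OF True]])
  then show ?thesis using act_const[OF assms, of 0] by simp
next
  case False
  then have "\<not> smooth_near M p (\<lambda>q. - f q)" using smooth_near_minus[of p "\<lambda>q. - f q"] by auto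
  then show ?thesis using False act_not_smooth[OF assms] by simp
qed

text \<open>Read in the chart, the function is a directional derivative with fixed direction; this
  makes coordinate fields smooth.\<close>

lemma smooth_fun_chart_derivative:
  assumes "(U, c) \<in> M" "open W" "smooth_fun M W f"
  shows "smooth_fun M (U \<inter> W) (\<lambda>q. act (chart_vec M (U, c) q w) f)"
proof (rule smooth_fun_chartI[OF assms(1)])
  have o: "open (c ` (U \<inter> W))" using open_chart_image assms by blast
  have "Cinf_on (c ` (U \<inter> W)) (\<lambda>y. frechet_derivative (\<lambda>y. f (inv_into U c y)) (at y) w)"
    using assms by (intro Cinf_on_derivative) (auto simp: smooth_fun_iff)
  then show "Cinf_on (c ` (U \<inter> W)) (\<lambda>y. act (chart_vec M (U, c) (inv_into U c y) w) f)"
    by (rule Cinf_on_cong[OF o, rotated -1])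
      (use assms smooth_nearI[OF assms(2) _ assms(3)] in \<open>auto simp: act_chart_vec\<close>)
qed (use assms chartD(1) in auto)

end

section \<open>Sections along a map\<close>

text \<open>Sections along \<open>F\<close> serve two purposes: with \<open>F\<close> the identity
  they are vector fields, and in general they include the fields dF(X), which need not come from a
  field on \<open>N\<close>.\<close>

locale smooth_mapping = M: manifold M + N: manifold N
  for M :: "('a::{t2_space,second_countable_topology}, 'e::real_inner) atlas"
    and N :: "('b::{t2_space,second_countable_topology}, 'f::real_inner) atlas" +
  fixes F :: "'a \<Rightarrow> 'b"
  assumes smooth_map: "smooth_map M N F"
begin

lemma open_vimage_F: "open W \<Longrightarrow> open (F -` W)"
  using smooth_map by (simp add: smooth_map_def continuous_on_open_vimage)

lemma eventually_comp:
  assumes "\<forall>\<^sub>F y in nhds (F p). P y"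
  shows "\<forall>\<^sub>F q in nhds p. P (F q)"
proof -
  obtain W where W: "open W" "F p \<in> W" "\<forall>y\<in>W. P y" using assms by (auto simp: eventually_nhds)
  then show ?thesis using open_vimage_F[OF W(1)] by (auto simp: eventually_nhds)
qed

lemma smooth_fun_comp:
  assumes "open W" "smooth_fun N W h"
  shows "smooth_fun M (F -` W) (\<lambda>q. h (F q))"
proof (rule M.smooth_fun_local)
  fix q assume q: "q \<in> F -` W"
  obtain U c where U: "(U, c) \<in> M" "q \<in> U" by (rule M.ex_chart)
  obtain V d where V: "(V, d) \<in> N" "F q \<in> V" by (rule N.ex_chart)
  let ?O = "U \<inter> F -` (V \<inter> W)"
  have oO: "open ?O"
    using M.chartD(1)[OF U(1)] open_vimage_F N.chartD(1)[OF V(1)] assms(1) by (simp add: open_Int)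
  have o: "open (c ` ?O)" using M.open_chart_image[OF U(1) oO] by (simp add: Int_absorb1)
  have "Cinf_on (c ` (U \<inter> F -` V)) (\<lambda>y. d (F (inv_into U c y)))"
    using smooth_map U V by (force simp: smooth_map_def o_def)
  then have 1: "Cinf_on (c ` ?O) (\<lambda>y. d (F (inv_into U c y)))"
    by (rule Cinf_on_mono) auto
  have 2: "Cinf_on (d ` (V \<inter> W)) (\<lambda>z. h (inv_into V d z))"
    using assms(2) V by (simp add: N.smooth_fun_iff)
  have "Cinf_on (c ` ?O) (\<lambda>y. h (inv_into V d (d (F (inv_into U c y)))))"
    by (rule N.Cinf_on_compose[OF o N.open_chart_image[OF V(1) assms(1)] _ 1 2])
      (use U V in auto)
  then have "Cinf_on (c ` ?O) (\<lambda>y. h (F (inv_into U c y)))"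
  proof (rule Cinf_on_cong[OF o, rotated -1])
    fix y assume "y \<in> c ` ?O"
    then show "h (inv_into V d (d (F (inv_into U c y)))) = h (F (inv_into U c y))"
      using U V by auto
  qed
  then have "smooth_fun M ?O (\<lambda>q. h (F q))"
    by (rule M.smooth_fun_chartI[OF U(1) oO, rotated -1]) auto
  then show "\<exists>T. open T \<and> q \<in> T \<and> smooth_fun M T (\<lambda>q. h (F q))"
    using oO U V q by auto
qed

lemma smooth_near_comp: "smooth_near N (F p) h \<Longrightarrow> smooth_near M p (\<lambda>q. h (F q))"
  using smooth_fun_comp open_vimage_F unfolding smooth_near_def by blast

lemma section_tangent: "section_along M N F U s \<Longrightarrow> q \<in> U \<Longrightarrow> s q \<in> tangent_space N (F q)"
  by (simp add: section_along_def)

lemma section_act: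
  "section_along M N F U s \<Longrightarrow> open W \<Longrightarrow> smooth_fun N W h \<Longrightarrow>
    smooth_fun M (U \<inter> F -` W) (\<lambda>p. act (s p) h)"
  by (simp add: section_along_def)

lemma section_subset: "section_along M N F U s \<Longrightarrow> V \<subseteq> U \<Longrightarrow> section_along M N F V s"
  unfolding section_along_def
proof (intro conjI ballI allI impI, goal_cases)
  case (2 W h)
  then show ?case by (intro M.smooth_fun_subset[of "U \<inter> F -` W" _ "V \<inter> F -` W"]) auto
qed auto

lemma section_cong:
  assumes "open U" "\<And>q. q \<in> U \<Longrightarrow> s q = t q" "section_along M N F U s"
  shows "section_along M N F U t"
  unfolding section_along_def
proof (intro conjI ballI allI impI)
  fix W h assume W: "open W" "smooth_fun N W h"
  show "smooth_fun M (U \<inter> F -` W) (\<lambda>p. act (t p) h)"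
    by (rule M.smooth_fun_cong[OF _ _ section_act[OF assms(3) W]])
      (use assms W open_vimage_F in auto)
qed (use assms section_tangent[OF assms(3)] in \<open>simp add: assms(2)[symmetric]\<close>)

lemma section_local:
  assumes "\<And>q. q \<in> U \<Longrightarrow> \<exists>V. open V \<and> q \<in> V \<and> section_along M N F V s"
  shows "section_along M N F U s"
  unfolding section_along_def
proof (intro conjI ballI allI impI)
  fix W h assume W: "open W" "smooth_fun N W h"
  show "smooth_fun M (U \<inter> F -` W) (\<lambda>p. act (s p) h)"
  proof (rule M.smooth_fun_local)
    fix q assume q: "q \<in> U \<inter> F -` W"
    then obtain V where "open V" "q \<in> V" "section_along M N F V s" using assms by blast
    then show "\<exists>T. open T \<and> q \<in> T \<and> smooth_fun M T (\<lambda>p. act (s p) h)"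
      using section_act[of V s W h] W q open_vimage_F by (intro exI[of _ "V \<inter> F -` W"]) auto
  qed
next
  fix q assume "q \<in> U"
  then show "s q \<in> tangent_space N (F q)" using assms section_tangent by blast
qed

lemma section_add:
  assumes "open U" "section_along M N F U s" "section_along M N F U t"
  shows "section_along M N F U (\<lambda>q. s q + t q)"
  unfolding section_along_def
proof (intro conjI ballI allI impI)
  fix W h assume W: "open W" "smooth_fun N W h"
  show "smooth_fun M (U \<inter> F -` W) (\<lambda>p. act (s p + t p) h)"
    using M.smooth_fun_add[OF _ section_act[OF assms(2) W] section_act[OF assms(3) W]]
      assms(1) open_vimage_F[OF W(1)] by (simp add: open_Int)
qed (use section_tangent[OF assms(2)] section_tangent[OF assms(3)] in
    \<open>simp add: subspace_add[OF N.tangent_subspace]\<close>)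

lemma section_scale:
  assumes "open U" "smooth_fun M U f" "section_along M N F U s"
  shows "section_along M N F U (\<lambda>q. f q *\<^sub>R s q)"
  unfolding section_along_def
proof (intro conjI ballI allI impI)
  fix W h assume W: "open W" "smooth_fun N W h"
  have f: "smooth_fun M (U \<inter> F -` W) f" by (rule M.smooth_fun_subset[OF assms(2)]) auto
  show "smooth_fun M (U \<inter> F -` W) (\<lambda>p. act (f p *\<^sub>R s p) h)"
    using M.smooth_fun_mult[OF _ f section_act[OF assms(3) W]]
      assms(1) open_vimage_F[OF W(1)] by (simp add: open_Int)
qed (use section_tangent[OF assms(3)] in \<open>simp add: subspace_scale[OF N.tangent_subspace]\<close>)

lemma section_zero: "open U \<Longrightarrow> section_along M N F U (\<lambda>q. 0)"
  by (simp add: section_along_def subspace_0[OF N.tangent_subspace] M.smooth_fun_const open_Int open_vimage_F)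

lemma section_sum:
  "open U \<Longrightarrow> (\<And>i. i \<in> I \<Longrightarrow> section_along M N F U (s i)) \<Longrightarrow>
    section_along M N F U (\<lambda>q. \<Sum>i\<in>I. s i q)"
  by (induction I rule: infinite_finite_induct) (simp_all add: section_add section_zero)

lemma section_comp:
  assumes "open W" "vfield N W Z"
  shows "section_along M N F (F -` W) (\<lambda>q. Z (F q))"
  unfolding section_along_def
proof (intro conjI ballI allI impI)
  show "Z (F q) \<in> tangent_space N (F q)" if "q \<in> F -` W" for q
    using assms(2) that by (simp add: vfield_def section_along_def)
  fix O' h assume h: "open O'" "smooth_fun N O' h"
  then have "smooth_fun N (W \<inter> O') (\<lambda>p. act (Z p) h)"
    using assms(2) by (simp add: vfield_def section_along_def vimage_def)
  from smooth_fun_comp[OF _ this]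
  show "smooth_fun M (F -` W \<inter> F -` O') (\<lambda>p. act (Z (F p)) h)"
    using assms(1) h by (simp add: open_Int)
qed

lemma section_nearI: "open U \<Longrightarrow> p \<in> U \<Longrightarrow> section_along M N F U s \<Longrightarrow> section_near M N F p s"
  by (auto simp: section_near_def)

lemma section_near2E:
  assumes "section_near M N F p s" "section_near M N F p t"
  obtains U where "open U" "p \<in> U" "section_along M N F U s" "section_along M N F U t"
proof -
  obtain V W where "open V" "p \<in> V" "section_along M N F V s" "open W" "p \<in> W" "section_along M N F W t"
    using assms by (auto simp: section_near_def)
  then show ?thesis
    using section_subset[of V s "V \<inter> W"] section_subset[of W t "V \<inter> W"]
    by (intro that[of "V \<inter> W"]) auto
qed

lemma section_near_tangent: "section_near M N F p s \<Longrightarrow> s p \<in> tangent_space N (F p)"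
  using section_tangent by (auto simp: section_near_def)

lemma section_near_eventually:
  assumes "section_near M N F p s"
  shows "\<forall>\<^sub>F q in nhds p. section_near M N F q s"
proof -
  obtain U where "open U" "p \<in> U" "section_along M N F U s"
    using assms by (auto simp: section_near_def)
  then show ?thesis using section_nearI unfolding eventually_nhds by blast
qed

lemma section_near_cong:
  assumes "\<forall>\<^sub>F q in nhds p. s q = t q" "section_near M N F p s"
  shows "section_near M N F p t"
proof -
  obtain U where U: "open U" "p \<in> U" "section_along M N F U s"
    using assms(2) by (auto simp: section_near_def)
  obtain V where V: "open V" "p \<in> V" "\<forall>q\<in>V. s q = t q" using assms(1) by (auto simp: eventually_nhds)
  have "section_along M N F (U \<inter> V) t"
    by (rule section_cong[of _ s]) (use U V section_subset[OF U(3), of "U \<inter> V"] in auto)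
  then show ?thesis using U V by (intro section_nearI[of "U \<inter> V"]) auto
qed

lemma section_near_add:
  assumes "section_near M N F p s" "section_near M N F p t"
  shows "section_near M N F p (\<lambda>q. s q + t q)"
  using assms by (rule section_near2E) (rule section_nearI[OF _ _ section_add], assumption+)

lemma section_near_scale:
  assumes "smooth_near M p f" "section_near M N F p s"
  shows "section_near M N F p (\<lambda>q. f q *\<^sub>R s q)"
proof -
  obtain V W where VW: "open V" "p \<in> V" "smooth_fun M V f" "open W" "p \<in> W" "section_along M N F W s"
    using assms by (auto simp: smooth_near_def section_near_def)
  then have "section_along M N F (V \<inter> W) (\<lambda>q. f q *\<^sub>R s q)"
    using section_subset[of W s "V \<inter> W"] M.smooth_fun_subset[of V f "V \<inter> W"]
    by (intro section_scale) auto
  then show ?thesis using VW by (intro section_nearI[of "V \<inter> W"]) auto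
qed

lemma section_near_const_scale: "section_near M N F p s \<Longrightarrow> section_near M N F p (\<lambda>q. r *\<^sub>R s q)"
  by (rule section_near_scale[OF M.smooth_near_const])

lemma section_near_minus: "section_near M N F p s \<Longrightarrow> section_near M N F p (\<lambda>q. - s q)"
  using section_near_const_scale[of p s "- 1"] by simp

lemma section_near_diff:
  "section_near M N F p s \<Longrightarrow> section_near M N F p t \<Longrightarrow> section_near M N F p (\<lambda>q. s q - t q)"
  using section_near_add[OF _ section_near_minus, of p s t] by simp

lemma section_near_zero: "section_near M N F p (\<lambda>q. 0)"
  using section_zero[of UNIV] by (auto intro: section_nearI)

lemma section_near_sum:
  "(\<And>i. i \<in> I \<Longrightarrow> section_near M N F p (s i)) \<Longrightarrow> section_near M N F p (\<lambda>q. \<Sum>i\<in>I. s i q)"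
  by (induction I rule: infinite_finite_induct) (simp_all add: section_near_add section_near_zero)

lemma section_near_comp: "vfield_near N (F p) Z \<Longrightarrow> section_near M N F p (\<lambda>q. Z (F q))"
  unfolding vfield_near_def section_near_def vfield_def[symmetric]
  using section_comp open_vimage_F by blast

lemma section_near_act:
  assumes "section_near M N F p s" "smooth_near N (F p) h"
  shows "smooth_near M p (\<lambda>q. act (s q) h)"
proof -
  obtain U W where UW: "open U" "p \<in> U" "section_along M N F U s" "open W" "F p \<in> W" "smooth_fun N W h"
    using assms by (auto simp: smooth_near_def section_near_def)
  then show ?thesis using section_act[of U s W h] open_vimage_F[of W]
    by (intro M.smooth_nearI[of "U \<inter> F -` W"]) auto
qed

lemma act_pushforward:
  "smooth_near N (F p) h \<Longrightarrow> act (pushforward N F p v) h = act v (\<lambda>q. h (F q))"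
  by (simp add: pushforward_def o_def)

lemma linear_pushforward: "linear (pushforward N F p)"
  by (intro linearI tvec_eqI) (auto simp: pushforward_def)

end

sublocale manifold \<subseteq> id: smooth_mapping M M "\<lambda>p. p"
proof
  show "smooth_map M M (\<lambda>p. p)"
    using transition by (auto simp: smooth_map_def o_def)
qed

context manifold
begin

lemmas vfield_tangent = id.section_tangent[folded vfield_def]
  and vfield_act = id.section_act[folded vfield_def]
  and vfield_subset = id.section_subset[folded vfield_def]
  and vfield_cong = id.section_cong[folded vfield_def]
  and vfield_local = id.section_local[folded vfield_def]
  and vfield_add = id.section_add[folded vfield_def]
  and vfield_scale = id.section_scale[folded vfield_def]
  and vfield_zero = id.section_zero[folded vfield_def]
  and vfield_sum = id.section_sum[folded vfield_def]
  and vfield_nearI = id.section_nearI[folded vfield_def vfield_near_def]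
  and vfield_near2E = id.section_near2E[folded vfield_def vfield_near_def]
  and vfield_near_tangent = id.section_near_tangent[folded vfield_near_def]
  and vfield_near_eventually = id.section_near_eventually[folded vfield_near_def]
  and vfield_near_cong = id.section_near_cong[folded vfield_near_def]
  and vfield_near_add = id.section_near_add[folded vfield_near_def]
  and vfield_near_scale = id.section_near_scale[folded vfield_near_def]
  and vfield_near_const_scale = id.section_near_const_scale[folded vfield_near_def]
  and vfield_near_minus = id.section_near_minus[folded vfield_near_def]
  and vfield_near_diff = id.section_near_diff[folded vfield_near_def]
  and vfield_near_sum = id.section_near_sum[folded vfield_near_def]
  and vfield_near_act = id.section_near_act[folded vfield_near_def]

lemma vfield_chart:
  assumes "(U, c) \<in> M"
  shows "vfield M U (\<lambda>q. chart_vec M (U, c) q w)"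
  unfolding vfield_def section_along_def
  using assms smooth_fun_chart_derivative[OF assms] by auto

text \<open>The choice is justified by the field with constant coefficients in a chart.\<close>

lemma local_ext:
  assumes "v \<in> tangent_space M p"
  shows "vfield_near M p (local_ext M p v)" "local_ext M p v p = v"
proof -
  obtain U c where U: "(U, c) \<in> M" "p \<in> U" by (rule ex_chart)
  obtain w where "v = chart_vec M (U, c) p w" using assms tangent_space_eq[OF U] by auto
  then have "\<exists>X. vfield_near M p X \<and> X p = v"
    using vfield_nearI[OF chartD(1)[OF U(1)] U(2) vfield_chart[OF U(1)]] by blast
  from someI_ex[OF this] show "vfield_near M p (local_ext M p v)" "local_ext M p v p = v"
    unfolding local_ext_def by blast+
qed

end

section \<open>Riemannian metrics and horizontal lifts\<close>

locale riemannian = manifold M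
  for M :: "('a::{t2_space,second_countable_topology}, 'e::real_inner) atlas" +
  fixes g :: "'a \<Rightarrow> 'a tvec \<Rightarrow> 'a tvec \<Rightarrow> real"
  assumes metric: "riemannian_metric M g"
begin

sublocale T: inner_on "tangent_space M p" "g p" for p
  by standard (use metric tangent_finite_dim in \<open>auto simp: riemannian_metric_def\<close>)

lemma smooth_fun_metric:
  "open U \<Longrightarrow> vfield M U X \<Longrightarrow> vfield M U Y \<Longrightarrow> smooth_fun M U (\<lambda>q. g q (X q) (Y q))"
  using metric by (simp add: riemannian_metric_def)

lemma smooth_near_metric:
  "vfield_near M p X \<Longrightarrow> vfield_near M p Y \<Longrightarrow> smooth_near M p (\<lambda>q. g q (X q) (Y q))"
  by (erule (1) vfield_near2E) (rule smooth_nearI[OF _ _ smooth_fun_metric], assumption+)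

text \<open>Gram-Schmidt without normalisation, so that no square roots of smooth functions occur.\<close>

lemma orthogonal_frame_aux:
  assumes U: "(U, c) \<in> M" and I: "finite I" "I \<subseteq> onb"
  shows "\<exists>E. (\<forall>b\<in>I. vfield M U (E b)) \<and>
    (\<forall>q\<in>U. (\<forall>b\<in>I. g q (E b q) (E b q) > 0) \<and>
      (\<forall>a\<in>I. \<forall>b\<in>I. a \<noteq> b \<longrightarrow> g q (E a q) (E b q) = 0) \<and>
      span ((\<lambda>b. E b q) ` I) = span (chart_vec M (U, c) q ` I))"
  using I
proof (induction I)
  case empty
  then show ?case by auto
next
  case (insert b I)
  then obtain E where E0: "\<forall>b\<in>I. vfield M U (E b)"
    "\<forall>q\<in>U. (\<forall>b\<in>I. g q (E b q) (E b q) > 0) \<and>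
      (\<forall>a\<in>I. \<forall>b\<in>I. a \<noteq> b \<longrightarrow> g q (E a q) (E b q) = 0) \<and>
      span ((\<lambda>b. E b q) ` I) = span (chart_vec M (U, c) q ` I)"
    by auto
  have vE: "\<And>a. a \<in> I \<Longrightarrow> vfield M U (E a)"
    and E: "\<And>q a. q \<in> U \<Longrightarrow> a \<in> I \<Longrightarrow> g q (E a q) (E a q) > 0"
      "\<And>q a a'. q \<in> U \<Longrightarrow> a \<in> I \<Longrightarrow> a' \<in> I \<Longrightarrow> a \<noteq> a' \<Longrightarrow> g q (E a q) (E a' q) = 0"
      "\<And>q. q \<in> U \<Longrightarrow> span ((\<lambda>b. E b q) ` I) = span (chart_vec M (U, c) q ` I)"
    using E0 by simp_all
  have oU: "open U" by (rule chartD[OF U])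
  define X where "X = (\<lambda>q. chart_vec M (U, c) q b)"
  define k where "k = (\<lambda>a q. g q (X q) (E a q) * inverse (g q (E a q) (E a q)))"
  define Y where "Y = (\<lambda>q. X q + (\<Sum>a\<in>I. (- k a q) *\<^sub>R E a q))"
  have vX: "vfield M U X" unfolding X_def by (rule vfield_chart[OF U])
  have k: "smooth_fun M U (\<lambda>q. - k a q)" if "a \<in> I" for a
    unfolding k_def
    by (intro smooth_fun_minus[OF oU] smooth_fun_mult[OF oU] smooth_fun_inverse[OF oU]
        smooth_fun_metric[OF oU] vX vE[OF that]) (use E(1) that in force)
  have vY: "vfield M U Y"
    unfolding Y_def
    by (intro vfield_add[OF oU] vX vfield_sum[OF oU] vfield_scale[OF oU] k vE)
  have E': "E a q \<in> tangent_space M q" if "a \<in> I" "q \<in> U" for a q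
    using vfield_tangent[OF vE] that by blast
  have X': "X q \<in> tangent_space M q" if "q \<in> U" for q
    using vfield_tangent[OF vX that] .
  have Y': "Y q \<in> tangent_space M q" if "q \<in> U" for q
    using vfield_tangent[OF vY that] .
  have XY: "Y q - X q \<in> span ((\<lambda>b. E b q) ` I)" for q
  proof -
    have "Y q - X q = (\<Sum>a\<in>I. (- k a q) *\<^sub>R E a q)" by (simp add: Y_def)
    also have "\<dots> \<in> span ((\<lambda>b. E b q) ` I)"
      by (intro span_sum span_scale) (auto intro: span_base)
    finally show ?thesis .
  qed
  have orth: "g q (Y q) (E a q) = 0" if "q \<in> U" "a \<in> I" for q a
  proof -
    have "g q (\<Sum>a\<in>I. (- k a q) *\<^sub>R E a q) (E a q) = (\<Sum>a'\<in>I. (- k a' q) * g q (E a' q) (E a q))"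
      by (rule T.G_sum_left) (use E' that in auto)
    also have "\<dots> = (\<Sum>a'\<in>I. if a' = a then - k a q * g q (E a q) (E a q) else 0)"
      by (rule sum.cong) (use E(2) that in auto)
    also have "\<dots> = - k a q * g q (E a q) (E a q)" using that insert by simp
    also have "\<dots> = - g q (X q) (E a q)" using E(1)[OF that] by (simp add: k_def)
    finally show ?thesis
      using that E' X' unfolding Y_def
      by (subst T.G_simps) (auto intro!: T.S_closed(6) subspace_neg subspace_scale tangent_subspace)
  qed
  \<comment> \<open>Independence of the coordinate vectors enters here: a vanishing residual would
    put \<open>b\<close> into the span of the earlier elements of \<open>onb\<close>.\<close>
  have Y0: "Y q \<noteq> 0" if "q \<in> U" for q
  proof
    assume "Y q = 0"
    then have "- X q \<in> span (chart_vec M (U, c) q ` I)" using XY[of q] E(3)[OF that] by simp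
    then have "X q \<in> span (chart_vec M (U, c) q ` I)" using span_neg by fastforce
    then have "X q \<in> chart_vec M (U, c) q ` span I"
      using linear_span_image[OF chart_vec_linear[OF U that]] by blast
    then have "b \<in> span I" using chart_vec_inj[OF U that] unfolding X_def by (auto dest: injD)
    moreover have "I \<subseteq> onb - {b}" using insert by auto
    ultimately have "b \<in> span (onb - {b})" using span_mono by blast
    then show False using onb(2) insert.prems unfolding real_vector.dependent_def by auto
  qed
  have sp: "span (insert (Y q) ((\<lambda>b. E b q) ` I)) = span (insert (X q) (chart_vec M (U, c) q ` I))"
    if "q \<in> U" for q
  proof -
    have "span (insert (Y q) ((\<lambda>b. E b q) ` I)) = span (insert (X q) ((\<lambda>b. E b q) ` I))"
      using XY by (rule real_vector.eq_span_insert_eq)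
    also have "\<dots> = span (insert (X q) (chart_vec M (U, c) q ` I))"
      unfolding real_vector.span_insert E(3)[OF that] ..
    finally show ?thesis .
  qed
  show ?case
  proof (intro exI[of _ "E(b := Y)"] conjI ballI)
    fix a assume "a \<in> insert b I"
    then show "vfield M U ((E(b := Y)) a)" using vE vY by auto
  next
    fix q a assume "q \<in> U" "a \<in> insert b I"
    then show "g q ((E(b := Y)) a q) ((E(b := Y)) a q) > 0"
      using E(1) Y0 T.pos[OF Y'] by auto
  next
    fix q a a' assume q: "q \<in> U" and a: "a \<in> insert b I" "a' \<in> insert b I"
    have "g q (E a'' q) (Y q) = 0" if "a'' \<in> I" for a''
      using orth[OF q that] T.sym[OF E'[OF that q] Y'[OF q]] by simp
    then show "a \<noteq> a' \<longrightarrow> g q ((E(b := Y)) a q) ((E(b := Y)) a' q) = 0"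
      using a q E(2) orth by auto
  next
    fix q assume q: "q \<in> U"
    have "(\<lambda>a. (E(b := Y)) a q) ` insert b I = insert (Y q) ((\<lambda>b. E b q) ` I)"
      using insert(2) by (auto simp: image_iff)
    then show "span ((\<lambda>a. (E(b := Y)) a q) ` insert b I) = span (chart_vec M (U, c) q ` insert b I)"
      using sp[OF q] by (simp add: X_def)
  qed
qed

text \<open>The expansion formula holds on the frame vectors by orthogonality and extends to their
  span. Dividing by g(E, E) makes up for the missing normalisation.\<close>

lemma orthogonal_frame:
  assumes U: "(U, c) \<in> M"
  shows "\<exists>E. (\<forall>b\<in>onb. vfield M U (E b)) \<and>
    (\<forall>q\<in>U. (\<forall>b\<in>onb. g q (E b q) (E b q) \<noteq> 0) \<and>
      (\<forall>u\<in>tangent_space M q.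
        (\<Sum>b\<in>onb. (g q u (E b q) * inverse (g q (E b q) (E b q))) *\<^sub>R E b q) = u))"
proof -
  obtain E where E0: "\<forall>b\<in>onb. vfield M U (E b)"
    "\<forall>q\<in>U. (\<forall>b\<in>onb. g q (E b q) (E b q) > 0) \<and>
      (\<forall>a\<in>onb. \<forall>b\<in>onb. a \<noteq> b \<longrightarrow> g q (E a q) (E b q) = 0) \<and>
      span ((\<lambda>b. E b q) ` onb) = span (chart_vec M (U, c) q ` onb)"
    using orthogonal_frame_aux[OF U onb(1) order_refl] by auto
  have vE: "\<And>a. a \<in> onb \<Longrightarrow> vfield M U (E a)"
    and E: "\<And>q a. q \<in> U \<Longrightarrow> a \<in> onb \<Longrightarrow> g q (E a q) (E a q) > 0"
      "\<And>q a a'. q \<in> U \<Longrightarrow> a \<in> onb \<Longrightarrow> a' \<in> onb \<Longrightarrow> a \<noteq> a' \<Longrightarrow> g q (E a q) (E a' q) = 0"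
      "\<And>q. q \<in> U \<Longrightarrow> span ((\<lambda>b. E b q) ` onb) = tangent_space M q"
    using E0 tangent_span[OF U] by simp_all
  have "(\<Sum>b\<in>onb. (g q u (E b q) * inverse (g q (E b q) (E b q))) *\<^sub>R E b q) = u"
    if q: "q \<in> U" and u: "u \<in> tangent_space M q" for q u
  proof -
    have E': "E a q \<in> tangent_space M q" if "a \<in> onb" for a
      using vfield_tangent[OF vE] that q by blast
    let ?L = "\<lambda>u. \<Sum>b\<in>onb. (g q u (E b q) * inverse (g q (E b q) (E b q))) *\<^sub>R E b q"
    have "u \<in> span ((\<lambda>b. E b q) ` onb)" using u E(3)[OF q] by simp
    \<comment> \<open>Membership is carried through the induction because the metric is linear on
      the tangent space only.\<close>
    then have "u \<in> tangent_space M q \<and> ?L u = u"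
    proof (induction rule: real_vector.span_induct)
      case base
      show ?case
      proof (rule real_vector.subspaceI)
        let ?P = "{u. u \<in> tangent_space M q \<and> ?L u = u}"
        show "0 \<in> ?P"
          by (simp add: T.S_closed E' T.G_simps(9)[OF T.S_closed(3) T.S_closed(3)])
        fix x y assume "x \<in> ?P" "y \<in> ?P"
        then have xy: "x \<in> tangent_space M q" "y \<in> tangent_space M q" "?L x = x" "?L y = y" by auto
        have "?L (x + y) = ?L x + ?L y"
          unfolding sum.distrib[symmetric]
          by (rule sum.cong) (use xy E' in \<open>simp_all add: T.G_simps algebra_simps\<close>)
        then show "x + y \<in> ?P" using xy by (simp add: T.S_closed)
      next
        let ?P = "{u. u \<in> tangent_space M q \<and> ?L u = u}"
        fix r x assume "x \<in> ?P"
        then have x: "x \<in> tangent_space M q" "?L x = x" by auto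
        have "?L (r *\<^sub>R x) = r *\<^sub>R ?L x"
          unfolding scaleR_sum_right
          by (rule sum.cong) (use x E' in \<open>simp_all add: T.G_simps\<close>)
        then show "r *\<^sub>R x \<in> ?P" using x by (simp add: T.S_closed)
      qed
    next
      case (step x)
      then obtain a where a: "a \<in> onb" "x = E a q" by auto
      have "?L x = (\<Sum>b\<in>onb. if b = a then E a q else 0)"
      proof (rule sum.cong)
        fix b assume b: "b \<in> onb"
        show "(g q x (E b q) * inverse (g q (E b q) (E b q))) *\<^sub>R E b q = (if b = a then E a q else 0)"
          using E(1)[OF q b] E(2)[OF q a(1) b] a by auto
      qed simp
      then show ?case using a onb(1) E' by simp
    qed
    then show ?thesis by simp
  qed
  moreover have "g q (E b q) (E b q) \<noteq> 0" if "q \<in> U" "b \<in> onb" for q b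
    using E(1)[OF that] by simp
  ultimately show ?thesis using vE by (intro exI[of _ E]) simp
qed

end

text \<open>Smoothness of the metric is postulated for fields on \<open>N\<close> only. Expanding
  \<open>s\<close> and \<open>t\<close> in coordinate fields along \<open>F\<close> leaves smooth
  coefficients and metric coefficients composed with \<open>F\<close>.\<close>

lemma (in smooth_mapping) smooth_near_metric_along:
  assumes "riemannian_metric N g" "section_near M N F p s" "section_near M N F p t"
  shows "smooth_near M p (\<lambda>q. g (F q) (s q) (t q))"
proof -
  interpret R: riemannian N g using assms(1) by unfold_locales
  obtain V d where V: "(V, d) \<in> N" "F p \<in> V" by (rule N.ex_chart)
  obtain U where U: "open U" "p \<in> U" "section_along M N F U s" "section_along M N F U t"
    using assms(2,3) by (rule section_near2E)
  have oV: "open V" by (rule N.chartD[OF V(1)])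
  let ?W = "U \<inter> F -` V"
  have oW: "open ?W" using U(1) open_vimage_F[OF oV] by auto
  let ?X = "\<lambda>b y. chart_vec N (V, d) y b"
  have c: "smooth_fun M ?W (\<lambda>q. act (r q) (\<lambda>y. b \<bullet> d y))" if "section_along M N F U r" for r b
    by (rule section_act[OF that oV N.smooth_fun_coordinate[OF V(1)]])
  have m: "smooth_fun M ?W (\<lambda>q. g (F q) (?X a (F q)) (?X b (F q)))" for a b
    using smooth_fun_comp[OF oV R.smooth_fun_metric[OF oV N.vfield_chart[OF V(1)] N.vfield_chart[OF V(1)]]]
    by (rule M.smooth_fun_subset) auto
  have "smooth_fun M ?W (\<lambda>q. \<Sum>a\<in>N.onb. \<Sum>b\<in>N.onb. act (s q) (\<lambda>y. a \<bullet> d y) *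
      (act (t q) (\<lambda>y. b \<bullet> d y) * g (F q) (?X a (F q)) (?X b (F q))))"
    by (intro M.smooth_fun_sum[OF oW] M.smooth_fun_mult[OF oW] c m U)
  then have "smooth_fun M ?W (\<lambda>q. g (F q) (s q) (t q))"
  proof (rule M.smooth_fun_cong[OF oW, rotated -1])
    fix q assume q: "q \<in> ?W"
    then have Fq: "F q \<in> V" by auto
    have X: "?X a (F q) \<in> tangent_space N (F q)" for a
      using V Fq by blast
    have st: "s q \<in> tangent_space N (F q)" "t q \<in> tangent_space N (F q)"
      using q U section_tangent by auto
    have "g (F q) (s q) (t q) = g (F q) (\<Sum>a\<in>N.onb. act (s q) (\<lambda>y. a \<bullet> d y) *\<^sub>R ?X a (F q)) (t q)"
      using N.tangent_expand[OF V(1) Fq st(1)] by simp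
    also have "\<dots> = (\<Sum>a\<in>N.onb. act (s q) (\<lambda>y. a \<bullet> d y) * g (F q) (?X a (F q)) (t q))"
      by (rule R.T.G_sum_left) (use X st in auto)
    also have "\<dots> = (\<Sum>a\<in>N.onb. act (s q) (\<lambda>y. a \<bullet> d y) *
        (\<Sum>b\<in>N.onb. act (t q) (\<lambda>y. b \<bullet> d y) * g (F q) (?X a (F q)) (?X b (F q))))"
    proof (rule sum.cong)
      fix a
      have "g (F q) (?X a (F q)) (t q) =
          g (F q) (?X a (F q)) (\<Sum>b\<in>N.onb. act (t q) (\<lambda>y. b \<bullet> d y) *\<^sub>R ?X b (F q))"
        using N.tangent_expand[OF V(1) Fq st(2)] by simp
      also have "\<dots> = (\<Sum>b\<in>N.onb. act (t q) (\<lambda>y. b \<bullet> d y) * g (F q) (?X a (F q)) (?X b (F q)))"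
        by (rule R.T.G_sum_right) (use X st in auto)
      finally show "act (s q) (\<lambda>y. a \<bullet> d y) * g (F q) (?X a (F q)) (t q) =
        act (s q) (\<lambda>y. a \<bullet> d y) * (\<Sum>b\<in>N.onb. act (t q) (\<lambda>y. b \<bullet> d y) * g (F q) (?X a (F q)) (?X b (F q)))"
        by simp
    qed simp
    finally show "(\<Sum>a\<in>N.onb. \<Sum>b\<in>N.onb. act (s q) (\<lambda>y. a \<bullet> d y) *
        (act (t q) (\<lambda>y. b \<bullet> d y) * g (F q) (?X a (F q)) (?X b (F q)))) = g (F q) (s q) (t q)"
      by (simp add: sum_distrib_left)
  qed
  then show ?thesis using U V by (intro M.smooth_nearI[OF oW]) auto
qed

section \<open>Isometry, horizontal lifts and the two projections of a Riemannian submersion\<close>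

locale submersion = smooth_mapping M N F + M: riemannian M gM + N: riemannian N gN
  for M :: "('a::{t2_space,second_countable_topology}, 'e::real_inner) atlas"
    and N :: "('b::{t2_space,second_countable_topology}, 'f::real_inner) atlas"
    and F :: "'a \<Rightarrow> 'b" and gM gN +
  assumes submersion: "riemannian_submersion M N gM gN F"
begin

abbreviation "TM \<equiv> tangent_space M"
abbreviation "TN \<equiv> tangent_space N"
abbreviation "dF \<equiv> pushforward N F"
abbreviation "VS \<equiv> vertical_space M N F"
abbreviation "HS \<equiv> horizontal_space M N gM F"

lemma dF_image: "dF p ` TM p = TN (F p)"
  using submersion by (simp add: riemannian_submersion_def)

lemma dF_tangent: "u \<in> TM p \<Longrightarrow> dF p u \<in> TN (F p)"
  using dF_image by blast

lemmas dF_simps = linear_add[OF linear_pushforward] linear_diff[OF linear_pushforward]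
  linear_cmul[OF linear_pushforward] linear_0[OF linear_pushforward] linear_neg[OF linear_pushforward]

lemma vertical_iff: "u \<in> VS p \<longleftrightarrow> u \<in> TM p \<and> dF p u = 0"
  by (simp add: vertical_space_def)

lemma vertical_tangent: "u \<in> VS p \<Longrightarrow> u \<in> TM p"
  by (simp add: vertical_iff)

lemma horizontal_tangent: "u \<in> HS p \<Longrightarrow> u \<in> TM p"
  by (simp add: horizontal_space_def)

lemma vertical_subspace: "subspace (VS p)"
  by (rule real_vector.subspaceI) (auto simp: vertical_iff dF_simps M.T.S_closed)

lemma horizontal_vertical: "x \<in> HS p \<Longrightarrow> v \<in> VS p \<Longrightarrow> gM p x v = 0"
  by (simp add: horizontal_space_def)

lemma vertical_horizontal: "x \<in> HS p \<Longrightarrow> v \<in> VS p \<Longrightarrow> gM p v x = 0"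
  using horizontal_vertical[of x p v] M.T.sym[of v p x] horizontal_tangent vertical_tangent by simp

lemma horizontal_subspace: "subspace (HS p)"
  by (rule real_vector.subspaceI)
    (auto simp: horizontal_space_def M.T.S_closed M.T.G_simps vertical_tangent
      M.T.G_simps(9)[OF M.T.S_closed(3) M.T.S_closed(3)])

lemma decomposition: "u \<in> TM p \<Longrightarrow> \<exists>v\<in>VS p. u - v \<in> HS p"
  using M.T.projection_exists[OF vertical_subspace, of p p u] vertical_tangent
  by (force simp: horizontal_space_def M.T.S_closed)

text \<open>Polarisation of the length condition.\<close>

lemma isometry:
  assumes "x \<in> HS p" "y \<in> HS p"
  shows "gN (F p) (dF p x) (dF p y) = gM p x y"
proof -
  have n: "gN (F p) (dF p z) (dF p z) = gM p z z" if "z \<in> HS p" for z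
    using submersion that by (simp add: riemannian_submersion_def)
  have xy: "x + y \<in> HS p" using assms horizontal_subspace by (simp add: subspace_add)
  have T: "x \<in> TM p" "y \<in> TM p" using assms horizontal_tangent by auto
  then have D: "dF p x \<in> TN (F p)" "dF p y \<in> TN (F p)" by (auto intro: dF_tangent)
  show ?thesis
    using n[OF xy] n[OF assms(1)] n[OF assms(2)] M.T.sym[OF T] N.T.sym[OF D] T D
    by (simp add: dF_simps M.T.G_simps N.T.G_simps M.T.S_closed N.T.S_closed)
qed

lemma dF_inj_horizontal:
  assumes "x \<in> HS p" "y \<in> HS p" "dF p x = dF p y"
  shows "x = y"
proof -
  have d: "x - y \<in> HS p" using assms horizontal_subspace by (simp add: subspace_diff)
  have "gM p (x - y) (x - y) = gN (F p) 0 0" using isometry[OF d d] assms by (simp add: dF_simps)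
  also have "\<dots> = 0" by (rule N.T.G_simps(9)[OF N.T.S_closed(3) N.T.S_closed(3) N.T.S_closed(3)])
  finally show ?thesis using M.T.pos[OF horizontal_tangent[OF d]] by force
qed

definition lift :: "'a \<Rightarrow> 'b tvec \<Rightarrow> 'a tvec" where
  "lift p w = (THE x. x \<in> HS p \<and> dF p x = w)"

text \<open>The horizontal part of any preimage is a lift; it is the only one because
  \<open>dF p\<close> preserves lengths of horizontal vectors.\<close>

lemma lift:
  assumes "w \<in> TN (F p)"
  shows "lift p w \<in> HS p" "dF p (lift p w) = w"
proof -
  obtain u where u: "u \<in> TM p" "dF p u = w" using assms dF_image[of p] by force
  obtain v where v: "v \<in> VS p" "u - v \<in> HS p" using decomposition[OF u(1)] by blast
  have "\<exists>!x. x \<in> HS p \<and> dF p x = w"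
  proof (rule ex1I)
    show "u - v \<in> HS p \<and> dF p (u - v) = w" using u v by (simp add: dF_simps vertical_iff)
    then show "x = u - v" if "x \<in> HS p \<and> dF p x = w" for x using that dF_inj_horizontal by auto
  qed
  from theI'[OF this] show "lift p w \<in> HS p" "dF p (lift p w) = w" by (auto simp: lift_def)
qed

lemma lift_dF: "x \<in> HS p \<Longrightarrow> lift p (dF p x) = x"
  using dF_inj_horizontal lift[OF dF_tangent[OF horizontal_tangent]] by blast

text \<open>The lift is the adjoint of \<open>dF p\<close>: the vertical part of \<open>u\<close> is
  orthogonal to the lift and killed by \<open>dF p\<close>, and on the rest \<open>isometry\<close>
  applies.\<close>

lemma metric_lift:
  assumes "w \<in> TN (F p)" "u \<in> TM p"
  shows "gM p (lift p w) u = gN (F p) w (dF p u)"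
proof -
  obtain v where v: "v \<in> VS p" "u - v \<in> HS p" using decomposition[OF assms(2)] by blast
  have "gM p (lift p w) u = gM p (lift p w) (u - v)"
    using horizontal_vertical[OF lift(1)[OF assms(1)] v(1)] assms v lift(1)[OF assms(1)]
    by (simp add: M.T.G_simps horizontal_tangent vertical_tangent)
  also have "\<dots> = gN (F p) w (dF p (u - v))"
    using isometry[OF lift(1)[OF assms(1)] v(2)] lift(2)[OF assms(1)] by simp
  finally show ?thesis using v by (simp add: dF_simps vertical_iff)
qed

lemma lift_in_tangent: "w \<in> TN (F p) \<Longrightarrow> lift p w \<in> TM p"
  using lift(1) horizontal_tangent by blast

lemma diff_lift_vertical: "u \<in> TM p \<Longrightarrow> u - lift p (dF p u) \<in> VS p"
  using lift[OF dF_tangent] by (simp add: vertical_iff dF_simps M.T.S_closed horizontal_tangent)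

lemma horizontal_vertical_unique:
  assumes "x \<in> HS p" "y \<in> HS p" "u - x \<in> VS p" "u - y \<in> VS p"
  shows "x = y"
proof -
  have "u - x + x = u" "u - y + y = u" by auto
  then have "dF p x = dF p u" "dF p y = dF p u"
    using assms dF_simps(1)[of p "u - x" x] dF_simps(1)[of p "u - y" y] by (auto simp: vertical_iff)
  then show ?thesis using dF_inj_horizontal assms by simp
qed

lemma hor_proj_eq:
  assumes "u \<in> TM p"
  shows "hor_proj M N gM F p u = lift p (dF p u)"
  unfolding hor_proj_def
proof (rule the_equality)
  show "lift p (dF p u) \<in> HS p \<and> u - lift p (dF p u) \<in> VS p"
    using lift[OF dF_tangent[OF assms]] diff_lift_vertical[OF assms] by blast
  then show "x = lift p (dF p u)" if "x \<in> HS p \<and> u - x \<in> VS p" for x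
    using that horizontal_vertical_unique by blast
qed

lemma vert_proj_eq:
  assumes "u \<in> TM p"
  shows "vert_proj M N gM F p u = u - lift p (dF p u)"
  unfolding vert_proj_def
proof (rule the_equality)
  show l: "u - lift p (dF p u) \<in> VS p \<and> u - (u - lift p (dF p u)) \<in> HS p"
    using lift[OF dF_tangent[OF assms]] diff_lift_vertical[OF assms] by simp
  show "x = u - lift p (dF p u)" if "x \<in> VS p \<and> u - x \<in> HS p" for x
    using horizontal_vertical_unique[of "u - x" p "lift p (dF p u)" u] that l by (simp add: algebra_simps)
qed

lemma vert_proj_vertical: "v \<in> VS p \<Longrightarrow> vert_proj M N gM F p v = v"
  using lift_dF[of 0 p] by (simp add: vert_proj_eq vertical_tangent) (simp add: vertical_iff dF_simps
      subspace_0[OF horizontal_subspace])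

lemma hor_proj_vertical: "v \<in> VS p \<Longrightarrow> hor_proj M N gM F p v = 0"
  using lift_dF[of 0 p] by (simp add: hor_proj_eq vertical_tangent) (simp add: vertical_iff dF_simps
      subspace_0[OF horizontal_subspace])

lemma vert_proj_horizontal: "x \<in> HS p \<Longrightarrow> vert_proj M N gM F p x = 0"
  by (simp add: vert_proj_eq horizontal_tangent lift_dF)

lemma hor_proj_horizontal: "x \<in> HS p \<Longrightarrow> hor_proj M N gM F p x = x"
  by (simp add: hor_proj_eq horizontal_tangent lift_dF)

lemma hor_proj_in: "u \<in> TM p \<Longrightarrow> hor_proj M N gM F p u \<in> HS p"
  by (simp add: hor_proj_eq lift dF_tangent)

lemma vert_proj_in: "u \<in> TM p \<Longrightarrow> vert_proj M N gM F p u \<in> VS p"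
  by (simp add: vert_proj_eq diff_lift_vertical)

lemma proj_sum: "u \<in> TM p \<Longrightarrow> vert_proj M N gM F p u + hor_proj M N gM F p u = u"
  by (simp add: vert_proj_eq hor_proj_eq)

lemma section_near_pushforward:
  assumes "vfield_near M p X"
  shows "section_near M N F p (\<lambda>q. dF q (X q))"
proof -
  obtain U where U: "open U" "p \<in> U" "vfield M U X"
    using assms by (auto simp: vfield_near_def section_near_def vfield_def)
  have "section_along M N F U (\<lambda>q. dF q (X q))"
    unfolding section_along_def
  proof (intro conjI ballI allI impI)
    show "dF q (X q) \<in> TN (F q)" if "q \<in> U" for q
      using dF_tangent M.vfield_tangent[OF U(3) that] .
    fix W h assume W: "open W" "smooth_fun N W h"
    have o: "open (F -` W)" by (rule open_vimage_F[OF W(1)])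
    have "smooth_fun M (U \<inter> F -` W) (\<lambda>q. act (X q) (\<lambda>q. h (F q)))"
      using M.vfield_act[OF U(3) o smooth_fun_comp[OF W]] by (simp add: vimage_def)
    then show "smooth_fun M (U \<inter> F -` W) (\<lambda>q. act (dF q (X q)) h)"
    proof (rule M.smooth_fun_cong[rotated -1])
      fix q assume "q \<in> U \<inter> F -` W"
      then have "smooth_near N (F q) h" using N.smooth_nearI W by blast
      then show "act (X q) (\<lambda>q. h (F q)) = act (dF q (X q)) h" by (simp add: act_pushforward)
    qed (use U o in auto)
  qed
  then show ?thesis using U by (intro section_nearI[of U]) auto
qed

text \<open>The frame coefficients of the lift, taken on \<open>M\<close>, would presuppose its
  smoothness. By adjointness they equal gN(s, dF E) / gM(E, E), which is smooth without knowing
  anything about the lift.\<close>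

lemma vfield_near_lift:
  assumes "section_near M N F p s"
  shows "vfield_near M p (\<lambda>q. lift q (s q))"
proof -
  obtain U c where U: "(U, c) \<in> M" "p \<in> U" by (rule M.ex_chart)
  obtain E where E': "\<forall>b\<in>M.onb. vfield M U (E b)"
    "\<forall>q\<in>U. (\<forall>b\<in>M.onb. gM q (E b q) (E b q) \<noteq> 0) \<and> (\<forall>u\<in>TM q.
      (\<Sum>b\<in>M.onb. (gM q u (E b q) * inverse (gM q (E b q) (E b q))) *\<^sub>R E b q) = u)"
    using M.orthogonal_frame[OF U(1)] by auto
  have vE: "\<And>b. b \<in> M.onb \<Longrightarrow> vfield M U (E b)"
    and E0: "\<And>q b. q \<in> U \<Longrightarrow> b \<in> M.onb \<Longrightarrow> gM q (E b q) (E b q) \<noteq> 0"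
    and E: "\<And>q u. q \<in> U \<Longrightarrow> u \<in> TM q \<Longrightarrow>
      (\<Sum>b\<in>M.onb. (gM q u (E b q) * inverse (gM q (E b q) (E b q))) *\<^sub>R E b q) = u"
    using E' by simp_all
  have oU: "open U" by (rule M.chartD[OF U(1)])
  have nE: "vfield_near M p (E b)" if "b \<in> M.onb" for b
    by (rule M.vfield_nearI[OF oU U(2) vE[OF that]])
  have 1: "smooth_near M p (\<lambda>q. gN (F q) (s q) (dF q (E b q)))" if "b \<in> M.onb" for b
    by (rule smooth_near_metric_along[OF N.metric assms section_near_pushforward[OF nE[OF that]]])
  have 2: "smooth_near M p (\<lambda>q. inverse (gM q (E b q) (E b q)))" if "b \<in> M.onb" for b
    by (rule M.smooth_nearI[OF oU U(2) M.smooth_fun_inverse[OF oU M.smooth_fun_metric[OF oU]]])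
      (use vE[OF that] E0 that in auto)
  have 3: "smooth_near M p (\<lambda>q. gN (F q) (s q) (dF q (E b q)) * inverse (gM q (E b q) (E b q)))"
    if "b \<in> M.onb" for b
    by (rule M.smooth_near2E[OF 1[OF that] 2[OF that]])
      (rule M.smooth_nearI[OF _ _ M.smooth_fun_mult], assumption+)
  have "vfield_near M p (\<lambda>q. \<Sum>b\<in>M.onb.
      (gN (F q) (s q) (dF q (E b q)) * inverse (gM q (E b q) (E b q))) *\<^sub>R E b q)"
    by (rule M.vfield_near_sum, rule M.vfield_near_scale[OF 3 nE])
  then show ?thesis
  proof (rule M.vfield_near_cong[rotated])
    have "\<forall>\<^sub>F q in nhds p. q \<in> U" using oU U(2) by (rule eventually_nhds_in_open)
    with section_near_eventually[OF assms]
    show "\<forall>\<^sub>F q in nhds p. (\<Sum>b\<in>M.onb.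
      (gN (F q) (s q) (dF q (E b q)) * inverse (gM q (E b q) (E b q))) *\<^sub>R E b q) = lift q (s q)"
    proof eventually_elim
      case (elim q)
      have s: "s q \<in> TN (F q)" using section_near_tangent[OF elim(1)] .
      have "gN (F q) (s q) (dF q (E b q)) = gM q (lift q (s q)) (E b q)" if "b \<in> M.onb" for b
        using metric_lift[OF s] M.vfield_tangent[OF vE[OF that] elim(2)] by simp
      then show ?case using E[OF elim(2) lift_in_tangent[OF s]] by simp
    qed
  qed
qed

lemma vfield_near_hor_proj:
  assumes "vfield_near M p X"
  shows "vfield_near M p (\<lambda>q. hor_proj M N gM F q (X q))"
proof (rule M.vfield_near_cong[OF _ vfield_near_lift[OF section_near_pushforward[OF assms]]])
  show "\<forall>\<^sub>F q in nhds p. lift q (dF q (X q)) = hor_proj M N gM F q (X q)"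
    using M.vfield_near_eventually[OF assms]
    by eventually_elim (simp add: hor_proj_eq M.vfield_near_tangent)
qed

lemma vfield_near_vert_proj:
  assumes "vfield_near M p X"
  shows "vfield_near M p (\<lambda>q. vert_proj M N gM F q (X q))"
proof (rule M.vfield_near_cong[OF _ M.vfield_near_diff[OF assms vfield_near_hor_proj[OF assms]]])
  show "\<forall>\<^sub>F q in nhds p. X q - hor_proj M N gM F q (X q) = vert_proj M N gM F q (X q)"
    using M.vfield_near_eventually[OF assms]
    by eventually_elim (simp add: hor_proj_eq vert_proj_eq M.vfield_near_tangent)
qed

end

section \<open>Connections\<close>

text \<open>Near \<open>p\<close>, \<open>X - Y\<close> is a combination of coordinate fields whose coefficients vanish at \<open>p\<close>. The
  remainder vanishes near \<open>p\<close> and is unchanged by a factor that is 0 near \<open>p\<close> and 1 elsewhere.\<close>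

lemma (in manifold) tensorial:
  fixes L :: "('a \<Rightarrow> 'a tvec) \<Rightarrow> 'w::real_vector"
  assumes add: "\<And>X Y. vfield_near M p X \<Longrightarrow> vfield_near M p Y \<Longrightarrow> L (\<lambda>q. X q + Y q) = L X + L Y"
    and scale: "\<And>f X. smooth_near M p f \<Longrightarrow> vfield_near M p X \<Longrightarrow> L (\<lambda>q. f q *\<^sub>R X q) = f p *\<^sub>R L X"
    and X: "vfield_near M p X" and Y: "vfield_near M p Y" and XY: "X p = Y p"
  shows "L X = L Y"
proof -
  obtain U c where U: "(U, c) \<in> M" "p \<in> U" by (rule ex_chart)
  have oU: "open U" by (rule chartD[OF U(1)])
  define Z where "Z = (\<lambda>q. X q - Y q)"
  define f where "f = (\<lambda>b q. act (Z q) (\<lambda>q. b \<bullet> c q))"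
  define E where "E = (\<lambda>b q. chart_vec M (U, c) q b)"
  have Z: "vfield_near M p Z" unfolding Z_def by (rule vfield_near_diff[OF X Y])
  have f: "smooth_near M p (f b)" for b
    unfolding f_def by (rule vfield_near_act[OF Z smooth_nearI[OF oU U(2) smooth_fun_coordinate[OF U(1)]]])
  have E: "vfield_near M p (E b)" for b
    unfolding E_def by (rule vfield_nearI[OF oU U(2) vfield_chart[OF U(1)]])
  have fE: "vfield_near M p (\<lambda>q. f b q *\<^sub>R E b q)" for b by (rule vfield_near_scale[OF f E])
  have L0: "L (\<lambda>q. 0) = 0" using scale[OF smooth_near_const[of p 0] X] by simp
  have sum: "vfield_near M p (\<lambda>q. \<Sum>b\<in>I. f b q *\<^sub>R E b q) \<and> L (\<lambda>q. \<Sum>b\<in>I. f b q *\<^sub>R E b q) = 0"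
    for I
  proof (induction I rule: infinite_finite_induct)
    case (insert b I)
    have "L (\<lambda>q. f b q *\<^sub>R E b q + (\<Sum>b\<in>I. f b q *\<^sub>R E b q)) =
        f b p *\<^sub>R L (E b) + L (\<lambda>q. \<Sum>b\<in>I. f b q *\<^sub>R E b q)"
      using add[OF fE] insert.IH scale[OF f E] by simp
    also have "\<dots> = 0" using insert.IH XY by (simp add: f_def Z_def)
    finally show ?case using insert vfield_near_add[OF fE] by simp
  qed (simp_all add: L0 id.section_near_zero[folded vfield_near_def])
  define R where "R = (\<lambda>q. Z q - (\<Sum>b\<in>onb. f b q *\<^sub>R E b q))"
  have R: "vfield_near M p R" unfolding R_def by (rule vfield_near_diff) (use Z sum in auto)
  have "\<forall>\<^sub>F q in nhds p. R q = 0"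
    using vfield_near_eventually[OF Z] eventually_nhds_in_open[OF oU U(2)]
  proof eventually_elim
    case (elim q)
    then show ?case
      using tangent_expand[OF U(1) elim(2) vfield_near_tangent[OF elim(1)]]
      by (simp add: R_def f_def E_def)
  qed
  define k where "k = (\<lambda>q. if R q = 0 then 0 else 1 :: real)"
  have "smooth_near M p k"
    by (rule smooth_near_cong[OF _ smooth_near_const[of p 0]])
      (use \<open>\<forall>\<^sub>F q in nhds p. R q = 0\<close> in \<open>auto simp: k_def elim: eventually_mono\<close>)
  then have "L (\<lambda>q. k q *\<^sub>R R q) = k p *\<^sub>R L R" by (rule scale[OF _ R])
  moreover have "(\<lambda>q. k q *\<^sub>R R q) = R" by (auto simp: k_def)
  moreover have "k p = 0"
    using eventually_nhds_x_imp_x[OF \<open>\<forall>\<^sub>F q in nhds p. R q = 0\<close>] by (simp add: k_def)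
  ultimately have "L R = 0" by simp
  then have "L (\<lambda>q. R q + (\<Sum>b\<in>onb. f b q *\<^sub>R E b q)) = 0"
    using add[OF R, of "\<lambda>q. \<Sum>b\<in>onb. f b q *\<^sub>R E b q"] sum[of onb] by simp
  moreover have "(\<lambda>q. R q + (\<Sum>b\<in>onb. f b q *\<^sub>R E b q)) = Z" by (simp add: R_def)
  ultimately have "L Z = 0" by simp
  then have "L (\<lambda>q. Z q + Y q) = L Y" using add[OF Z Y] by simp
  moreover have "(\<lambda>q. Z q + Y q) = X" by (simp add: Z_def)
  ultimately show ?thesis by simp
qed

locale connection = smooth_mapping M N F
  for M :: "('a::{t2_space,second_countable_topology}, 'e::real_inner) atlas"
    and N :: "('b::{t2_space,second_countable_topology}, 'f::real_inner) atlas"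
    and F :: "'a \<Rightarrow> 'b" +
  fixes D :: "'a \<Rightarrow> 'a tvec \<Rightarrow> ('a \<Rightarrow> 'b tvec) \<Rightarrow> 'b tvec"
  assumes connection: "connection_along M N F D"
begin

lemma D_tangent:
  "section_near M N F p s \<Longrightarrow> u \<in> tangent_space M p \<Longrightarrow> D p u s \<in> tangent_space N (F p)"
  using connection by (simp add: connection_along_def)

lemma D_linear:
  "section_near M N F p s \<Longrightarrow> u \<in> tangent_space M p \<Longrightarrow> v \<in> tangent_space M p \<Longrightarrow>
    D p (a *\<^sub>R u + b *\<^sub>R v) s = a *\<^sub>R D p u s + b *\<^sub>R D p v s"
  using connection by (simp add: connection_along_def)

lemma D_add:
  "section_near M N F p s \<Longrightarrow> section_near M N F p t \<Longrightarrow> u \<in> tangent_space M p \<Longrightarrow>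
    D p u (\<lambda>q. s q + t q) = D p u s + D p u t"
  using connection by (simp add: connection_along_def)

lemma D_scale:
  "smooth_near M p f \<Longrightarrow> section_near M N F p s \<Longrightarrow> u \<in> tangent_space M p \<Longrightarrow>
    D p u (\<lambda>q. f q *\<^sub>R s q) = act u f *\<^sub>R s p + f p *\<^sub>R D p u s"
  using connection by (simp add: connection_along_def)

lemma D_const_scale:
  "section_near M N F p s \<Longrightarrow> u \<in> tangent_space M p \<Longrightarrow> D p u (\<lambda>q. r *\<^sub>R s q) = r *\<^sub>R D p u s"
  using D_scale[OF M.smooth_near_const] by (simp add: M.act_const)

lemma D_zero: "u \<in> tangent_space M p \<Longrightarrow> D p u (\<lambda>q. 0) = 0"
  using D_const_scale[OF section_near_zero, of u p 0] by simp

lemma D_minus: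
  "section_near M N F p s \<Longrightarrow> u \<in> tangent_space M p \<Longrightarrow> D p u (\<lambda>q. - s q) = - D p u s"
  using D_const_scale[of p s u "- 1"] by simp

lemma D_diff:
  "section_near M N F p s \<Longrightarrow> section_near M N F p t \<Longrightarrow> u \<in> tangent_space M p \<Longrightarrow>
    D p u (\<lambda>q. s q - t q) = D p u s - D p u t"
  using D_add[OF _ section_near_minus, of p s t u] by (simp add: D_minus)

text \<open>The difference \<open>R\<close> vanishes near \<open>p\<close> and equals
  \<open>k\<close> times itself, so the Leibniz rule gives 0. The cutoff \<open>k\<close> may be
  wild away from \<open>p\<close>, since only smoothness near \<open>p\<close> is asked for.\<close>

lemma D_cong:
  assumes "\<forall>\<^sub>F q in nhds p. s q = t q" "section_near M N F p s" "u \<in> tangent_space M p"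
  shows "D p u s = D p u t"
proof -
  have t: "section_near M N F p t" using section_near_cong[OF assms(1,2)] .
  define R where "R = (\<lambda>q. s q - t q)"
  have R: "section_near M N F p R" unfolding R_def by (rule section_near_diff[OF assms(2) t])
  define k where "k = (\<lambda>q. if R q = 0 then 0 else 1 :: real)"
  have "smooth_near M p k"
    by (rule M.smooth_near_cong[OF _ M.smooth_near_const[of p 0]])
      (use assms(1) in \<open>auto simp: k_def R_def elim: eventually_mono\<close>)
  from D_scale[OF this R assms(3)]
  have "D p u (\<lambda>q. k q *\<^sub>R R q) = act u k *\<^sub>R R p + k p *\<^sub>R D p u R" .
  moreover have "(\<lambda>q. k q *\<^sub>R R q) = R" by (auto simp: k_def)
  moreover have "R p = 0" "k p = 0"
    using eventually_nhds_x_imp_x[OF assms(1)] by (simp_all add: k_def R_def)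
  ultimately have "D p u R = 0" by simp
  then show ?thesis unfolding R_def using D_diff[OF assms(2) t assms(3)] by simp
qed

end

locale levi_civita_connection = riemannian M g
  for M :: "('a::{t2_space,second_countable_topology}, 'e::real_inner) atlas" and g +
  fixes D :: "'a \<Rightarrow> 'a tvec \<Rightarrow> ('a \<Rightarrow> 'a tvec) \<Rightarrow> 'a tvec"
  assumes levi_civita: "levi_civita M g D"
begin

sublocale C: connection M M "\<lambda>p. p" D
  by unfold_locales (use levi_civita in \<open>simp add: levi_civita_def\<close>)

lemmas D_tangent = C.D_tangent[folded vfield_near_def]
  and D_linear = C.D_linear[folded vfield_near_def]
  and D_add = C.D_add[folded vfield_near_def]
  and D_scale = C.D_scale[folded vfield_near_def]
  and D_zero = C.D_zero
  and D_minus = C.D_minus[folded vfield_near_def]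
  and D_diff = C.D_diff[folded vfield_near_def]
  and D_cong = C.D_cong[folded vfield_near_def]

lemma bracket:
  "vfield_near M p X \<Longrightarrow> vfield_near M p Y \<Longrightarrow> lie_bracket M X Y p = D p (X p) Y - D p (Y p) X"
  using levi_civita by (simp add: levi_civita_def)

lemma bracket_tangent:
  "vfield_near M p X \<Longrightarrow> vfield_near M p Y \<Longrightarrow> lie_bracket M X Y p \<in> tangent_space M p"
  by (simp add: bracket T.S_closed D_tangent vfield_near_tangent)

lemma metric_derivative:
  "vfield_near M p Y \<Longrightarrow> vfield_near M p Z \<Longrightarrow> u \<in> tangent_space M p \<Longrightarrow>
    act u (\<lambda>q. g q (Y q) (Z q)) = g p (D p u Y) (Z p) + g p (Y p) (D p u Z)"
  using levi_civita by (simp add: levi_civita_def)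

text \<open>Koszul's formula with two equal fields: g(X, D_X W) is replaced through the bracket by
  g(X, D_W X), which is half the derivative of g(X, X). The trace of the second fundamental form
  needs diagonal values only.\<close>

lemma koszul_diagonal:
  assumes X: "vfield_near M p X" and W: "vfield_near M p W"
  shows "g p (D p (X p) X) (W p) = act (X p) (\<lambda>q. g q (X q) (W q))
    - g p (X p) (lie_bracket M X W p) - act (W p) (\<lambda>q. g q (X q) (X q)) / 2"
proof -
  have t: "X p \<in> tangent_space M p" "W p \<in> tangent_space M p"
    using X W vfield_near_tangent by auto
  have s: "D p (X p) X \<in> tangent_space M p" "D p (X p) W \<in> tangent_space M p"
    "D p (W p) X \<in> tangent_space M p"
    using t X W D_tangent by auto
  show ?thesis
    using metric_derivative[OF X W t(1)] metric_derivative[OF X X t(2)] T.sym[OF t(1) s(3)] t s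
    by (simp add: bracket X W T.G_simps)
qed

end

section \<open>The structure equation of a cosymplectic manifold\<close>

locale cosymplectic_manifold = levi_civita_connection M g D
  for M :: "('a::{t2_space,second_countable_topology}, 'e::real_inner) atlas" and g D +
  fixes \<phi> :: "'a \<Rightarrow> 'a tvec \<Rightarrow> 'a tvec" and \<xi> :: "'a \<Rightarrow> 'a tvec" and \<eta> :: "'a \<Rightarrow> 'a tvec \<Rightarrow> real"
  assumes cosymplectic: "cosymplectic M \<phi> \<xi> \<eta> g"
begin

lemma acm: "almost_contact_metric M \<phi> \<xi> \<eta> g"
  using cosymplectic by (simp add: cosymplectic_def)

lemma \<phi>_linear:
  "u \<in> tangent_space M p \<Longrightarrow> v \<in> tangent_space M p \<Longrightarrow>
    \<phi> p (a *\<^sub>R u + b *\<^sub>R v) = a *\<^sub>R \<phi> p u + b *\<^sub>R \<phi> p v"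
  using acm by (simp add: almost_contact_metric_def endo_field_def)

lemma \<phi>_simps:
  assumes "u \<in> tangent_space M p" "v \<in> tangent_space M p"
  shows "\<phi> p (u + v) = \<phi> p u + \<phi> p v" "\<phi> p (u - v) = \<phi> p u - \<phi> p v"
    "\<phi> p (r *\<^sub>R u) = r *\<^sub>R \<phi> p u" "\<phi> p (- u) = - \<phi> p u" "\<phi> p 0 = 0"
  using \<phi>_linear[OF assms, of 1 1] \<phi>_linear[OF assms, of 1 "-1"] \<phi>_linear[OF assms, of r 0]
    \<phi>_linear[OF assms, of "-1" 0] \<phi>_linear[OF assms, of 0 0] by simp_all

lemma \<phi>_vfield_near:
  assumes "vfield_near M p X"
  shows "vfield_near M p (\<lambda>q. \<phi> q (X q))"
proof -
  obtain U where U: "open U" "p \<in> U" "vfield M U X"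
    using assms by (auto simp: vfield_near_def section_near_def vfield_def)
  then have "vfield M U (\<lambda>q. \<phi> q (X q))"
    using acm by (simp add: almost_contact_metric_def endo_field_def)
  with U show ?thesis by (intro vfield_nearI)
qed

text \<open>An endomorphism field is required to preserve smooth fields, so a single vector has to
  be extended to a field first.\<close>

lemma \<phi>_tangent: "u \<in> tangent_space M p \<Longrightarrow> \<phi> p u \<in> tangent_space M p"
  using vfield_near_tangent[OF \<phi>_vfield_near[OF local_ext(1)]] by (simp add: local_ext(2))

lemma \<xi>_vfield_near: "vfield_near M p \<xi>"
  using acm by (intro vfield_nearI[of UNIV]) (auto simp: almost_contact_metric_def)

lemma \<xi>_tangent: "\<xi> p \<in> tangent_space M p"
  by (rule vfield_near_tangent[OF \<xi>_vfield_near])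

lemma \<phi>_\<xi>: "\<phi> p (\<xi> p) = 0" and \<eta>_\<xi>: "\<eta> p (\<xi> p) = 1"
  using acm by (auto simp: almost_contact_metric_def)

lemma \<phi>_\<phi>: "u \<in> tangent_space M p \<Longrightarrow> \<phi> p (\<phi> p u) = - u + \<eta> p u *\<^sub>R \<xi> p"
  and \<eta>_\<phi>: "u \<in> tangent_space M p \<Longrightarrow> \<eta> p (\<phi> p u) = 0"
  and \<eta>_eq: "u \<in> tangent_space M p \<Longrightarrow> \<eta> p u = g p u (\<xi> p)"
  using acm by (simp_all add: almost_contact_metric_def)

lemma metric_\<phi>:
  "u \<in> tangent_space M p \<Longrightarrow> v \<in> tangent_space M p \<Longrightarrow>
    g p (\<phi> p u) (\<phi> p v) = g p u v - \<eta> p u * \<eta> p v"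
  using acm by (simp add: almost_contact_metric_def)

text \<open>Replace v by \<phi>v in the compatibility of the metric with \<phi> and use \<phi>^2 =
  -I + \<eta> \<xi>; the \<xi>-terms vanish since \<eta>(\<phi>u) = 0.\<close>

lemma \<phi>_skew:
  assumes u: "u \<in> tangent_space M p" and v: "v \<in> tangent_space M p"
  shows "g p (\<phi> p u) v = - g p u (\<phi> p v)"
proof -
  have "g p (\<phi> p u) (\<phi> p (\<phi> p v)) = g p u (\<phi> p v)"
    using metric_\<phi>[OF u \<phi>_tangent[OF v]] by (simp add: \<eta>_\<phi> v)
  moreover have "g p (\<phi> p u) (- v + \<eta> p v *\<^sub>R \<xi> p) = - g p (\<phi> p u) v + \<eta> p v * \<eta> p (\<phi> p u)"
    using u v by (simp add: T.G_simps T.S_closed \<phi>_tangent \<xi>_tangent \<eta>_eq)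
  ultimately show ?thesis by (simp add: \<phi>_\<phi> \<eta>_\<phi> u v)
qed

abbreviation \<Phi>F :: "('a \<Rightarrow> 'a tvec) \<Rightarrow> 'a \<Rightarrow> 'a tvec" where
  "\<Phi>F X \<equiv> \<lambda>q. \<phi> q (X q)"

text \<open>\<open>cov p X Y Z\<close> is \<open>g((\<nabla>\<^sub>X\<phi>)Y, Z)\<close> at \<open>p\<close>.\<close>

definition cov :: "'a \<Rightarrow> ('a \<Rightarrow> 'a tvec) \<Rightarrow> ('a \<Rightarrow> 'a tvec) \<Rightarrow> ('a \<Rightarrow> 'a tvec) \<Rightarrow> real" where
  "cov p X Y Z = g p (D p (X p) (\<Phi>F Y) - \<phi> p (D p (X p) Y)) (Z p)"

context
  fixes p :: 'a
begin

abbreviation "near \<equiv> vfield_near M p"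

lemmas near_simps = vfield_near_tangent[of p] \<phi>_tangent \<xi>_tangent D_tangent[of p] \<phi>_vfield_near
  \<xi>_vfield_near[of p] T.S_closed

lemma cov_eq:
  assumes "near X" "near Y" "near Z"
  shows "cov p X Y Z = g p (D p (X p) (\<Phi>F Y)) (Z p) + g p (D p (X p) Y) (\<phi> p (Z p))"
  using assms by (simp add: cov_def T.G_simps near_simps \<phi>_skew)

text \<open>The derivative of the identity g(\<phi>Y, Z) = - g(Y, \<phi>Z).\<close>

lemma cov_skew:
  assumes "near X" "near Y" "near Z"
  shows "cov p X Y Z = - cov p X Z Y"
proof -
  have X: "X p \<in> tangent_space M p" using assms near_simps by blast
  have "act (X p) (\<lambda>q. g q (\<Phi>F Y q) (Z q)) = act (X p) (\<lambda>q. - g q (Y q) (\<Phi>F Z q))"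
  proof (rule act_cong[OF X])
    show "\<forall>\<^sub>F q in nhds p. g q (\<Phi>F Y q) (Z q) = - g q (Y q) (\<Phi>F Z q)"
      using vfield_near_eventually[OF assms(2)] vfield_near_eventually[OF assms(3)]
      by eventually_elim (simp add: \<phi>_skew vfield_near_tangent)
  qed
  then have "g p (D p (X p) (\<Phi>F Y)) (Z p) + g p (\<phi> p (Y p)) (D p (X p) Z) =
      - (g p (D p (X p) Y) (\<phi> p (Z p)) + g p (Y p) (D p (X p) (\<Phi>F Z)))"
    unfolding act_minus[OF X] metric_derivative[OF \<phi>_vfield_near[OF assms(2)] assms(3) X]
      metric_derivative[OF assms(2) \<phi>_vfield_near[OF assms(3)] X] .
  moreover have "g p (\<phi> p (Y p)) (D p (X p) Z) = g p (D p (X p) Z) (\<phi> p (Y p))"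
    "g p (Y p) (D p (X p) (\<Phi>F Z)) = g p (D p (X p) (\<Phi>F Z)) (Y p)"
    using assms X by (intro T.sym; simp add: near_simps)+
  ultimately show ?thesis using assms by (simp add: cov_eq)
qed

text \<open>This is closedness of the fundamental form: with brackets written through the
  torsion-free connection, only derivatives of \<phi> survive.\<close>

lemma cov_cyclic:
  assumes "near X" "near Y" "near Z"
  shows "cov p X Y Z + cov p Y Z X + cov p Z X Y = 0"
proof -
  note t = assms vfield_near_tangent[OF assms(1)] vfield_near_tangent[OF assms(2)]
    vfield_near_tangent[OF assms(3)]
  have "ext_deriv2 M (fundamental_form \<phi> g) X Y Z p = 0"
    using cosymplectic assms by (simp add: cosymplectic_def)
  then have "(g p (D p (X p) Y) (\<phi> p (Z p)) + g p (Y p) (D p (X p) (\<Phi>F Z)))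
     + (g p (D p (Y p) Z) (\<phi> p (X p)) + g p (Z p) (D p (Y p) (\<Phi>F X)))
     + (g p (D p (Z p) X) (\<phi> p (Y p)) + g p (X p) (D p (Z p) (\<Phi>F Y)))
     - (g p (D p (X p) Y) (\<phi> p (Z p)) - g p (D p (Y p) X) (\<phi> p (Z p)))
     - (g p (D p (Y p) Z) (\<phi> p (X p)) - g p (D p (Z p) Y) (\<phi> p (X p)))
     - (g p (D p (Z p) X) (\<phi> p (Y p)) - g p (D p (X p) Z) (\<phi> p (Y p))) = 0"
    using t by (simp add: ext_deriv2_def fundamental_form_def metric_derivative \<phi>_vfield_near
        bracket T.G_simps D_tangent \<phi>_tangent)
  moreover have "g p (Y p) (D p (X p) (\<Phi>F Z)) = g p (D p (X p) (\<Phi>F Z)) (Y p)"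
    "g p (Z p) (D p (Y p) (\<Phi>F X)) = g p (D p (Y p) (\<Phi>F X)) (Z p)"
    "g p (X p) (D p (Z p) (\<Phi>F Y)) = g p (D p (Z p) (\<Phi>F Y)) (X p)"
    using t by (intro T.sym; simp add: D_tangent \<phi>_vfield_near)+
  ultimately show ?thesis
    using cov_skew[OF assms] cov_skew[OF assms(2,3,1)] cov_skew[OF assms(3,1,2)] assms
    by (simp add: cov_eq)
qed

lemma ext_deriv_\<eta>: "near X \<Longrightarrow> near Y \<Longrightarrow> ext_deriv1 M \<eta> X Y p = 0"
  using cosymplectic by (simp add: cosymplectic_def)

lemma nijenhuis_zero:
  assumes "near X" "near Y"
  shows "nijenhuis M \<phi> X Y p = 0"
proof -
  have "nijenhuis M \<phi> X Y p + (2 * ext_deriv1 M \<eta> X Y p) *\<^sub>R \<xi> p = 0"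
    using cosymplectic assms unfolding cosymplectic_def normal_structure_def by blast
  then show ?thesis using ext_deriv_\<eta>[OF assms] by simp
qed

text \<open>The Nijenhuis tensor paired with \<open>Z\<close>: brackets become differences of
  covariant derivatives, and skewness moves the outer \<phi> onto \<open>Z\<close>.\<close>

lemma cov_normal:
  assumes "near X" "near Y" "near Z"
  shows "cov p (\<Phi>F X) Y Z - cov p (\<Phi>F Y) X Z + cov p X Y (\<Phi>F Z) - cov p Y X (\<Phi>F Z) = 0"
proof -
  note t = assms vfield_near_tangent[OF assms(1)] vfield_near_tangent[OF assms(2)]
    vfield_near_tangent[OF assms(3)]
  have Dt: "D p (\<phi> p (X p)) (\<Phi>F Y) \<in> tangent_space M p" "D p (\<phi> p (X p)) Y \<in> tangent_space M p"
    "D p (\<phi> p (Y p)) (\<Phi>F X) \<in> tangent_space M p" "D p (\<phi> p (Y p)) X \<in> tangent_space M p"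
    "D p (X p) (\<Phi>F Y) \<in> tangent_space M p" "D p (X p) Y \<in> tangent_space M p"
    "D p (Y p) (\<Phi>F X) \<in> tangent_space M p" "D p (Y p) X \<in> tangent_space M p"
    "\<phi> p (Z p) \<in> tangent_space M p" "Z p \<in> tangent_space M p"
    using t by (simp_all add: D_tangent \<phi>_vfield_near \<phi>_tangent)
  have "g p (nijenhuis M \<phi> X Y p) (Z p) = 0"
    unfolding nijenhuis_zero[OF assms(1,2)] by (rule T.G_simps(9)[OF Dt(10) Dt(10) Dt(10)])
  then have "g p (\<phi> p (\<phi> p (D p (X p) Y - D p (Y p) X))
      + (D p (\<phi> p (X p)) (\<Phi>F Y) - D p (\<phi> p (Y p)) (\<Phi>F X))
      - \<phi> p (D p (\<phi> p (X p)) Y - D p (Y p) (\<Phi>F X))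
      - \<phi> p (D p (X p) (\<Phi>F Y) - D p (\<phi> p (Y p)) X)) (Z p) = 0"
    using t by (simp add: nijenhuis_def bracket \<phi>_vfield_near)
  then show ?thesis
    using Dt unfolding cov_def by (simp add: \<phi>_simps T.G_simps \<phi>_tangent T.S_closed \<phi>_skew)
qed

text \<open>Closedness of \<eta>, the metric dual of \<xi>, says that the endomorphism X -> D_X
  \<xi> is self-adjoint.\<close>

lemma D_\<xi>_sym:
  assumes "near X" "near Y"
  shows "g p (D p (X p) \<xi>) (Y p) = g p (D p (Y p) \<xi>) (X p)"
proof -
  note t = assms vfield_near_tangent[OF assms(1)] vfield_near_tangent[OF assms(2)]
  have e: "act u (\<lambda>q. \<eta> q (W q)) = g p (D p u W) (\<xi> p) + g p (W p) (D p u \<xi>)"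
    if W: "near W" and u: "u \<in> tangent_space M p" for W u
  proof -
    have "act u (\<lambda>q. \<eta> q (W q)) = act u (\<lambda>q. g q (W q) (\<xi> q))"
    proof (rule act_cong[OF u])
      show "\<forall>\<^sub>F q in nhds p. \<eta> q (W q) = g q (W q) (\<xi> q)"
        using vfield_near_eventually[OF W] by eventually_elim (simp add: \<eta>_eq vfield_near_tangent)
    qed
    then show ?thesis by (simp add: metric_derivative W u \<xi>_vfield_near)
  qed
  have "g p (Y p) (D p (X p) \<xi>) = g p (X p) (D p (Y p) \<xi>)"
    using ext_deriv_\<eta>[OF assms] t
    by (simp add: ext_deriv1_def e bracket \<eta>_eq T.S_closed T.G_simps D_tangent \<xi>_tangent)
  moreover have "g p (Y p) (D p (X p) \<xi>) = g p (D p (X p) \<xi>) (Y p)"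
    "g p (X p) (D p (Y p) \<xi>) = g p (D p (Y p) \<xi>) (X p)"
    using t by (intro T.sym; simp add: D_tangent \<xi>_vfield_near)+
  ultimately show ?thesis by simp
qed

text \<open>\<xi> has constant length 1.\<close>

lemma D_\<xi>_\<xi>:
  assumes u: "u \<in> tangent_space M p"
  shows "g p (D p u \<xi>) (\<xi> p) = 0"
proof -
  have "act u (\<lambda>q. g q (\<xi> q) (\<xi> q)) = 0"
    using act_const[OF u, of 1] by (simp add: \<eta>_eq[symmetric] \<xi>_tangent \<eta>_\<xi>)
  moreover have "g p (\<xi> p) (D p u \<xi>) = g p (D p u \<xi>) (\<xi> p)"
    using u by (intro T.sym) (simp_all add: D_tangent \<xi>_vfield_near \<xi>_tangent)
  ultimately show ?thesis by (simp add: metric_derivative[OF \<xi>_vfield_near \<xi>_vfield_near u])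
qed

lemma cov_\<xi>:
  assumes "near X" "near Z"
  shows "cov p X \<xi> Z = g p (D p (X p) \<xi>) (\<phi> p (Z p))"
proof -
  have "X p \<in> tangent_space M p" "Z p \<in> tangent_space M p" using assms vfield_near_tangent by auto
  then show ?thesis
    by (simp add: cov_def \<phi>_\<xi> D_zero T.G_simps \<phi>_tangent D_tangent \<xi>_vfield_near \<phi>_skew)
qed

text \<open>The covariant derivative of \<phi>^2 = -I + \<eta> \<xi>. The right side collects the
  derivatives of \<eta> and of \<xi>.\<close>

lemma cov_\<phi>:
  assumes "near X" "near Y" "near Z"
  shows "cov p X (\<Phi>F Y) Z - cov p X Y (\<Phi>F Z) =
    g p (D p (X p) \<xi>) (Y p) * \<eta> p (Z p) + \<eta> p (Y p) * g p (D p (X p) \<xi>) (Z p)"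
proof -
  note t = assms vfield_near_tangent[OF assms(1)] vfield_near_tangent[OF assms(2)]
    vfield_near_tangent[OF assms(3)]
  have Dt: "D p (X p) (\<Phi>F Y) \<in> tangent_space M p" "D p (X p) Y \<in> tangent_space M p"
    "D p (X p) \<xi> \<in> tangent_space M p" "\<phi> p (Z p) \<in> tangent_space M p"
    using t by (simp_all add: D_tangent \<phi>_vfield_near \<phi>_tangent \<xi>_vfield_near)
  have sm: "smooth_near M p (\<lambda>q. g q (Y q) (\<xi> q))"
    by (rule smooth_near_metric[OF assms(2) \<xi>_vfield_near])
  have "D p (X p) (\<Phi>F (\<Phi>F Y)) = D p (X p) (\<lambda>q. - Y q + g q (Y q) (\<xi> q) *\<^sub>R \<xi> q)"
  proof (rule D_cong)
    show "\<forall>\<^sub>F q in nhds p. \<Phi>F (\<Phi>F Y) q = - Y q + g q (Y q) (\<xi> q) *\<^sub>R \<xi> q"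
      using vfield_near_eventually[OF assms(2)]
      by eventually_elim (simp add: \<phi>_\<phi> \<eta>_eq vfield_near_tangent)
  qed (use t \<phi>_vfield_near in auto)
  also have "\<dots> = - D p (X p) Y + (act (X p) (\<lambda>q. g q (Y q) (\<xi> q)) *\<^sub>R \<xi> p
      + g p (Y p) (\<xi> p) *\<^sub>R D p (X p) \<xi>)"
    unfolding D_add[OF vfield_near_minus[OF assms(2)] vfield_near_scale[OF sm \<xi>_vfield_near] t(4)]
      D_minus[OF assms(2) t(4)] D_scale[OF sm \<xi>_vfield_near t(4)] ..
  finally have e: "D p (X p) (\<Phi>F (\<Phi>F Y)) = - D p (X p) Y
      + ((\<eta> p (D p (X p) Y) + g p (Y p) (D p (X p) \<xi>)) *\<^sub>R \<xi> p + \<eta> p (Y p) *\<^sub>R D p (X p) \<xi>)"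
    using t Dt by (simp add: metric_derivative \<xi>_vfield_near \<eta>_eq)
  have s: "g p (Y p) (D p (X p) \<xi>) = g p (D p (X p) \<xi>) (Y p)" "g p (\<xi> p) (Z p) = \<eta> p (Z p)"
    using t Dt by (simp_all add: T.sym[of "Y p"] T.sym[of "\<xi> p"] \<eta>_eq \<xi>_tangent)
  have "cov p X Y (\<Phi>F Z) = g p (D p (X p) (\<Phi>F Y)) (\<phi> p (Z p)) + g p (D p (X p) Y) (\<phi> p (\<phi> p (Z p)))"
    using t by (simp add: cov_eq \<phi>_vfield_near)
  moreover have "g p (D p (X p) Y) (\<phi> p (\<phi> p (Z p))) = - g p (D p (X p) Y) (Z p) + \<eta> p (Z p) * \<eta> p (D p (X p) Y)"
    using t Dt by (simp add: \<phi>_\<phi> T.G_simps T.S_closed \<xi>_tangent \<eta>_eq)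
  moreover have "cov p X (\<Phi>F Y) Z = g p (D p (X p) (\<Phi>F (\<Phi>F Y))) (Z p) + g p (D p (X p) (\<Phi>F Y)) (\<phi> p (Z p))"
    using t by (simp add: cov_eq \<phi>_vfield_near)
  moreover have "g p (D p (X p) (\<Phi>F (\<Phi>F Y))) (Z p) = - g p (D p (X p) Y) (Z p)
      + (\<eta> p (D p (X p) Y) + g p (D p (X p) \<xi>) (Y p)) * \<eta> p (Z p) + \<eta> p (Y p) * g p (D p (X p) \<xi>) (Z p)"
    unfolding e using t Dt by (simp add: T.G_simps T.S_closed \<xi>_tangent s)
  ultimately show ?thesis by (simp add: algebra_simps)
qed

text \<open>Compare \<open>cov_normal\<close> and \<open>cov_cyclic\<close> at \<open>\<xi>\<close>.\<close>

lemma D_\<xi>_\<phi>\<phi>: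
  assumes "near Y" "near Z"
  shows "g p (D p (\<phi> p (Y p)) \<xi>) (\<phi> p (Z p)) = 0"
proof -
  note t = assms \<xi>_vfield_near[of p] \<phi>_vfield_near[OF assms(1)] \<phi>_vfield_near[OF assms(2)]
    vfield_near_tangent[OF assms(1)] vfield_near_tangent[OF assms(2)] \<xi>_tangent[of p]
  \<comment> \<open>The direction \<phi>\<xi> is 0, and D is linear in the direction.\<close>
  have z: "cov p (\<Phi>F \<xi>) Y Z = 0"
  proof -
    have "D p 0 W = 0" if "near W" for W using D_linear[OF that t(8) t(8), of 0 0] by simp
    then show ?thesis
      using t T.G_simps(9)[OF t(7) t(7) t(7)] by (simp add: cov_def \<phi>_\<xi> \<phi>_simps(5)[OF t(8) t(8)])
  qed
  have e: "g p (D p (Y p) \<xi>) (\<phi> p (\<phi> p (Z p))) = - g p (D p (Y p) \<xi>) (Z p)"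
    using t D_\<xi>_\<xi>[OF t(6)] by (simp add: \<phi>_\<phi> T.G_simps T.S_closed D_tangent)
  have 1: "- g p (D p (\<phi> p (Y p)) \<xi>) (\<phi> p (Z p)) + cov p \<xi> Y (\<Phi>F Z) + g p (D p (Y p) \<xi>) (Z p) = 0"
    using cov_normal[OF t(3) t(1,2)] z cov_\<xi>[OF t(4,2)] cov_\<xi>[OF t(1,5)] e by simp
  \<comment> \<open>With A the expression to be shown zero and R the sum of the two other terms,
    equation \<open>1\<close> reads R - A = 0, while the cyclic identity becomes R + A = 0.\<close>
  have "cov p \<xi> Y (\<Phi>F Z) + cov p Y (\<Phi>F Z) \<xi> + cov p (\<Phi>F Z) \<xi> Y = 0"
    by (rule cov_cyclic[OF t(3,1,5)])
  moreover have "cov p Y (\<Phi>F Z) \<xi> = g p (D p (Y p) \<xi>) (Z p)"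
    using cov_skew[OF t(1,5,3)] cov_\<xi>[OF t(1,5)] e by simp
  moreover have "cov p (\<Phi>F Z) \<xi> Y = g p (D p (\<phi> p (Y p)) \<xi>) (\<phi> p (Z p))"
    using cov_\<xi>[OF t(5,1)] D_\<xi>_sym[OF t(5,4)] by simp
  ultimately show ?thesis using 1 by simp
qed

text \<open>Apply \<open>D_\<xi>_\<phi>\<phi>\<close> with one further \<phi> in each slot, so that
  \<phi>^2 appears in both. The \<xi>-corrections vanish: D\<xi> is orthogonal to \<xi>, hence by
  symmetry D_\<xi> \<xi> = 0 too. Thus \<xi> is parallel.\<close>

lemma D_\<xi>:
  assumes "near Y" "near Z"
  shows "g p (D p (Y p) \<xi>) (Z p) = 0"
proof -
  note \<xi> = \<xi>_vfield_near[of p] \<xi>_tangent[of p]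
  have Z: "g p (D p (\<phi> p (W p)) \<xi>) (V p) = 0" if W: "near W" and V: "near V" for W V
  proof -
    note t = W V vfield_near_tangent[OF W] vfield_near_tangent[OF V]
    have "g p (D p (\<phi> p (W p)) \<xi>) (\<phi> p (\<phi> p (V p))) = 0"
      using D_\<xi>_\<phi>\<phi>[OF W \<phi>_vfield_near[OF V]] .
    moreover have "g p (D p (\<phi> p (W p)) \<xi>) (\<phi> p (\<phi> p (V p))) =
        - g p (D p (\<phi> p (W p)) \<xi>) (V p) + \<eta> p (V p) * g p (D p (\<phi> p (W p)) \<xi>) (\<xi> p)"
      using t \<xi> by (simp add: \<phi>_\<phi> T.G_simps T.S_closed D_tangent \<phi>_tangent)
    ultimately show ?thesis using D_\<xi>_\<xi>[OF \<phi>_tangent[OF t(3)]] by simp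
  qed
  note t = assms vfield_near_tangent[OF assms(1)] vfield_near_tangent[OF assms(2)]
  have "D p ((-1) *\<^sub>R Y p + \<eta> p (Y p) *\<^sub>R \<xi> p) \<xi> = - D p (Y p) \<xi> + \<eta> p (Y p) *\<^sub>R D p (\<xi> p) \<xi>"
    using D_linear[OF \<xi>(1) t(3) \<xi>(2), of "-1" "\<eta> p (Y p)"] by simp
  then have "g p (D p (\<phi> p (\<phi> p (Y p))) \<xi>) (Z p) =
      - g p (D p (Y p) \<xi>) (Z p) + \<eta> p (Y p) * g p (D p (\<xi> p) \<xi>) (Z p)"
    using t \<xi> by (simp add: \<phi>_\<phi> T.G_simps T.S_closed D_tangent)
  then show ?thesis
    using Z[OF \<phi>_vfield_near[OF assms(1)] assms(2)] D_\<xi>_sym[OF \<xi>(1) assms(2)] D_\<xi>_\<xi>[OF t(4)] by simp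
qed

lemma cov_zero:
  assumes "near X" "near Y" "near Z"
  shows "cov p X Y Z = 0"
proof -
  \<comment> \<open>With \<xi> parallel, the derivative of \<phi>^2 vanishes, so \<phi> moves freely
    between the last two slots.\<close>
  have sw: "cov p X (\<Phi>F Y) Z = cov p X Y (\<Phi>F Z)" if "near X" "near Y" "near Z" for X Y Z
    using cov_\<phi>[OF that] D_\<xi>[OF that(1,2)] D_\<xi>[OF that(1,3)] by simp
  \<comment> \<open>A linear system. The two cyclic identities eliminate the terms in directions
    \<phi>A and \<phi>B from \<open>cov_normal\<close>; after \<open>sw\<close> and skewness the
    terms in directions A and B cancel, leaving twice the claimed one.\<close>
  have b: "cov p C B (\<Phi>F A) = 0" if n: "near A" "near B" "near C" for A B C
  proof -
    note f = \<phi>_vfield_near[OF n(1)] \<phi>_vfield_near[OF n(2)] \<phi>_vfield_near[OF n(3)]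
    show ?thesis
      using cov_normal[OF n] cov_cyclic[OF f(1) n(2,3)] cov_cyclic[OF f(2) n(1,3)]
        sw[OF n(3,1,2)] sw[OF n(3,2,1)] sw[OF n(2,1,3)] sw[OF n(1,2,3)]
        cov_skew[OF n(3,1) f(2)] cov_skew[OF n(2,3) f(1)] cov_skew[OF n(1,3) f(2)]
      by linarith
  qed
  note t = assms vfield_near_tangent[OF assms(1)] vfield_near_tangent[OF assms(2)]
    vfield_near_tangent[OF assms(3)]
  \<comment> \<open>Taking \<phi>Z for A in \<open>b\<close> puts \<phi>^2 in the last slot, which
    is -I up to a \<xi>-term.\<close>
  have "cov p X Y (\<Phi>F (\<Phi>F Z)) = - cov p X Y Z + \<eta> p (Z p) * cov p X Y \<xi>"
    using t by (simp add: cov_def \<phi>_\<phi> T.G_simps T.S_closed D_tangent \<phi>_tangent \<phi>_vfield_near \<xi>_tangent)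
  moreover have "cov p X Y \<xi> = 0"
    using cov_skew[OF assms(1,2) \<xi>_vfield_near] cov_\<xi>[OF assms(1,2)]
      D_\<xi>[OF assms(1) \<phi>_vfield_near[OF assms(2)]] by simp
  ultimately show ?thesis using b[OF \<phi>_vfield_near[OF assms(3)] assms(2,1)] by simp
qed

end

lemma D_\<phi>:
  assumes Y: "vfield_near M p Y" and u: "u \<in> tangent_space M p"
  shows "D p u (\<Phi>F Y) = \<phi> p (D p u Y)"
proof -
  have t: "D p u (\<Phi>F Y) \<in> tangent_space M p" "\<phi> p (D p u Y) \<in> tangent_space M p"
    using Y u by (simp_all add: D_tangent \<phi>_tangent \<phi>_vfield_near)
  show ?thesis
  proof (rule T.eqI[OF t])
    fix w assume w: "w \<in> tangent_space M p"
    show "g p (D p u (\<Phi>F Y)) w = g p (\<phi> p (D p u Y)) w"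
      using cov_zero[OF local_ext(1)[OF u] Y local_ext(1)[OF w]] t w
      by (simp add: cov_def local_ext(2) u T.G_simps)
  qed
qed

end

section \<open>Global extensions\<close>

context manifold
begin

text \<open>Heine-Borel by hand: a ball lies in a box of bounded \<open>onb\<close>-coordinates, and
  a box is a finite sum of compact segments. The bound on the coordinates is Cauchy-Schwarz.\<close>

lemma compact_cball: "compact (cball (y :: 'e) r)"
proof -
  define K where "K I = {\<Sum>b\<in>I. t b *\<^sub>R b | t. \<forall>b\<in>I. \<bar>t b\<bar> \<le> r * norm b}" for I :: "'e set"
  have K: "compact (K I)" if "finite I" for I
    using that
  proof (induction I)
    case empty
    then show ?case by (simp add: K_def)
  next
    case (insert b I)
    have "K (insert b I) = {x + y | x y. x \<in> (\<lambda>t. t *\<^sub>R b) ` {- (r * norm b)..r * norm b} \<and> y \<in> K I}"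
      (is "_ = ?R")
    proof
      show "K (insert b I) \<subseteq> ?R"
      proof
        fix z assume "z \<in> K (insert b I)"
        then obtain t where t: "z = (\<Sum>b\<in>insert b I. t b *\<^sub>R b)" "\<forall>b\<in>insert b I. \<bar>t b\<bar> \<le> r * norm b"
          by (auto simp: K_def)
        have "z = t b *\<^sub>R b + (\<Sum>b\<in>I. t b *\<^sub>R b)" using t insert by simp
        moreover have "(\<Sum>b\<in>I. t b *\<^sub>R b) \<in> K I" using t unfolding K_def by blast
        moreover have "t b \<in> {- (r * norm b)..r * norm b}" using t by auto
        ultimately show "z \<in> ?R" by blast
      qed
      show "?R \<subseteq> K (insert b I)"
      proof
        fix z assume "z \<in> ?R"
        then obtain s t where st: "z = s *\<^sub>R b + (\<Sum>b\<in>I. t b *\<^sub>R b)" "\<bar>s\<bar> \<le> r * norm b"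
          "\<forall>b\<in>I. \<bar>t b\<bar> \<le> r * norm b"
          by (auto simp: K_def)
        have "(\<Sum>a\<in>I. (t(b := s)) a *\<^sub>R a) = (\<Sum>b\<in>I. t b *\<^sub>R b)"
          by (rule sum.cong) (use insert in auto)
        then have "z = (\<Sum>a\<in>insert b I. (t(b := s)) a *\<^sub>R a)" using st insert by simp
        moreover have "\<forall>a\<in>insert b I. \<bar>(t(b := s)) a\<bar> \<le> r * norm a" using st insert by auto
        ultimately show "z \<in> K (insert b I)" unfolding K_def by blast
      qed
    qed
    moreover have "compact ((\<lambda>t. t *\<^sub>R b) ` {- (r * norm b)..r * norm b})"
      by (intro compact_continuous_image continuous_intros compact_Icc)
    ultimately show ?case using insert by (simp add: compact_sums)
  qed
  have "cball 0 r \<subseteq> K onb"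
  proof
    fix x :: 'e assume "x \<in> cball 0 r"
    then have "\<bar>b \<bullet> x\<bar> \<le> r * norm b" for b
      using Cauchy_Schwarz_ineq2[of b x] mult_left_mono[of "norm x" r "norm b"]
      by (simp add: mult.commute)
    then show "x \<in> K onb" using onb(4)[of x] unfolding K_def by (auto intro!: exI[of _ "\<lambda>b. b \<bullet> x"])
  qed
  then have "compact (cball (0 :: 'e) r)"
    using compact_Int_closed[OF K[OF onb(1)] closed_cball[of 0 r]] by (simp add: Int_absorb1)
  from compact_translation[OF this, of y] show ?thesis by (simp add: cball_translation)
qed

text \<open>\<open>K\<close> is the preimage of a closed ball in a chart. It is compact, hence
  closed in the Hausdorff space, so the function is smooth on the open sets \<open>U\<close> and
  \<open>- K\<close>, which together cover everything.\<close>

lemma bump_function: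
  assumes W: "open W" "p \<in> W"
  obtains \<rho> K where "smooth_fun M UNIV \<rho>" "\<rho> p = 1" "closed K" "K \<subseteq> W" "\<forall>q. q \<notin> K \<longrightarrow> \<rho> q = 0"
proof -
  obtain U c where U: "(U, c) \<in> M" "p \<in> U" by (rule ex_chart)
  have oU: "open U" and oc: "open (c ` U)" by (rule chartD[OF U(1)])+
  obtain r where r: "r > 0" "cball (c p) r \<subseteq> c ` (U \<inter> W)"
    using open_chart_image[OF U(1) W(1)] U W open_contains_cball by blast
  define K where "K = inv_into U c ` cball (c p) r"
  have "continuous_on (cball (c p) r) (inv_into U c)"
    using chartD(3)[OF U(1)] r(2) unfolding homeomorphism_def by (auto intro: continuous_on_subset)
  then have "compact K" unfolding K_def using compact_cball by (rule compact_continuous_image)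
  then have cK: "closed K" by (rule compact_imp_closed)
  have K: "q \<in> K" if "q \<in> U" "dist (c p) (c q) \<le> r" for q
    using that inv_chart[OF U(1) that(1)] unfolding K_def by force
  have KW: "K \<subseteq> U \<inter> W"
  proof
    fix q assume "q \<in> K"
    then obtain y where y: "q = inv_into U c y" "y \<in> c ` (U \<inter> W)" using r(2) unfolding K_def by auto
    then show "q \<in> U \<inter> W" using U by auto
  qed
  \<comment> \<open>The sum is the squared distance to \<open>c p\<close> in orthonormal
    coordinates, so \<open>h\<close> is positive exactly on the open ball of radius
    \<open>r\<close>; \<open>*\<^sub>R\<close> is used to match \<open>Ck_on_scaleR\<close>.\<close>
  define h where "h y = flat 0 (r\<^sup>2 + - (\<Sum>b\<in>onb. (b \<bullet> (y - c p)) *\<^sub>R (b \<bullet> (y - c p))))" for y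
  have nrm: "(\<Sum>b\<in>onb. (b \<bullet> x) * (b \<bullet> x)) = (norm x)\<^sup>2" for x
  proof -
    have "(norm x)\<^sup>2 = (\<Sum>b\<in>onb. (b \<bullet> x) *\<^sub>R b) \<bullet> x"
      using onb(4)[of x] by (simp add: power2_norm_eq_inner)
    then show ?thesis by (simp add: inner_sum_left)
  qed
  have "Ck_on k (c ` U) h" for k
  proof -
    have lin: "Ck_on k (c ` U) (\<lambda>y. b \<bullet> (y - c p))" for b
      using Ck_on_linear_comp[OF oc bounded_linear_inner_right[of b]
          Ck_on_add[OF oc Ck_on_linear[OF oc bounded_linear_ident] Ck_on_const[OF oc, of k "- c p"]]]
      by simp
    have "Ck_on k (c ` U) (\<lambda>y. r\<^sup>2 + - (\<Sum>b\<in>onb. (b \<bullet> (y - c p)) *\<^sub>R (b \<bullet> (y - c p))))"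
      by (rule Ck_on_add[OF oc Ck_on_const[OF oc] Ck_on_linear_comp[OF oc
            bounded_linear_minus[OF bounded_linear_ident] Ck_on_sum[OF oc Ck_on_scaleR[OF oc lin lin]]]])
    from Ck_on_compose[of "{1 :: real}", OF _ _ oc open_UNIV _ this Ck_on_flat]
    show ?thesis unfolding h_def by simp
  qed
  then have h: "Cinf_on (c ` U) h" by (simp add: Cinf_on_def)
  \<comment> \<open>The constant factor normalises the value at \<open>p\<close> to 1.\<close>
  define \<rho> where "\<rho> q = (if q \<in> U then h (c q) * inverse (h (c p)) else 0)" for q
  have z: "\<rho> q = 0" if "q \<notin> K" for q
  proof (cases "q \<in> U")
    case True
    then have "r < norm (c q - c p)" using K that by (force simp: dist_norm norm_minus_commute)
    then have "r\<^sup>2 < (norm (c q - c p))\<^sup>2" using r(1) by (simp add: power_strict_mono)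
    then show ?thesis by (simp add: \<rho>_def h_def nrm flat_def)
  qed (simp add: \<rho>_def)
  have "smooth_fun M U (\<lambda>q. h (c q))"
  proof (rule smooth_fun_chartI[OF U(1) oU order_refl])
    show "Cinf_on (c ` U) (\<lambda>y. h (c (inv_into U c y)))"
      by (rule Cinf_on_cong[OF oc _ h]) (use U(1) in auto)
  qed
  then have "smooth_fun M U (\<lambda>q. h (c q) * inverse (h (c p)))"
    by (rule smooth_fun_mult[OF oU _ smooth_fun_const[OF oU]])
  then have sU: "smooth_fun M U \<rho>" by (rule smooth_fun_cong[OF oU, rotated -1]) (simp add: \<rho>_def)
  have sK: "smooth_fun M (- K) \<rho>"
    by (rule smooth_fun_cong[OF _ _ smooth_fun_const[of _ 0]]) (use cK z in \<open>auto simp: open_Compl\<close>)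
  have "smooth_fun M UNIV \<rho>"
  proof (rule smooth_fun_local)
    fix q :: 'a
    show "\<exists>T. open T \<and> q \<in> T \<and> smooth_fun M T \<rho>"
    proof (cases "q \<in> U")
      case True
      then show ?thesis using sU oU by blast
    next
      case False
      then have "q \<in> - K" using KW by auto
      then show ?thesis using sK cK open_Compl by blast
    qed
  qed
  moreover have "\<rho> p = 1" using U r by (simp add: \<rho>_def h_def nrm flat_def)
  ultimately show ?thesis using that cK KW z by blast
qed

text \<open>Multiplication with a bump function extends a local field, staying in every field of
  subspaces.\<close>

lemma global_extension:
  assumes X: "vfield_near M p X" and S: "\<And>q. subspace (S q)" "\<forall>\<^sub>F q in nhds p. X q \<in> S q"
  shows "\<exists>Y. vfield M UNIV Y \<and> Y p = X p \<and> (\<forall>q. Y q \<in> S q)"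
proof -
  obtain U where U: "open U" "p \<in> U" "vfield M U X"
    using X by (auto simp: vfield_near_def section_near_def vfield_def)
  obtain V where V: "open V" "p \<in> V" "\<forall>q\<in>V. X q \<in> S q" using S(2) by (auto simp: eventually_nhds)
  let ?W = "U \<inter> V"
  have W: "open ?W" "p \<in> ?W" using U V by auto
  have vX: "vfield M ?W X" by (rule vfield_subset[OF U(3)]) auto
  obtain \<rho> K where \<rho>: "smooth_fun M UNIV \<rho>" "\<rho> p = 1" "closed K" "K \<subseteq> ?W" "\<forall>q. q \<notin> K \<longrightarrow> \<rho> q = 0"
    by (rule bump_function[OF W])
  define Y where "Y q = (if q \<in> ?W then \<rho> q *\<^sub>R X q else 0)" for q
  have "vfield M UNIV Y"
  proof (rule vfield_local)
    fix q :: 'a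
    have 1: "vfield M ?W Y"
      by (rule vfield_cong[OF W(1) _ vfield_scale[OF W(1) smooth_fun_subset[OF \<rho>(1)] vX]])
        (auto simp: Y_def)
    have "open (- K)" using \<rho>(3) by (rule open_Compl)
    moreover from this have "vfield M (- K) Y"
      by (rule vfield_cong[OF _ _ vfield_zero]) (use \<rho>(3,5) in \<open>auto simp: Y_def open_Compl\<close>)
    ultimately show "\<exists>V. open V \<and> q \<in> V \<and> vfield M V Y"
      using 1 W \<rho>(4) by (cases "q \<in> ?W") blast+
  qed
  moreover have "Y q \<in> S q" for q
    using V S(1) by (simp add: Y_def subspace_scale subspace_0)
  moreover have "Y p = X p" using W \<rho>(2) by (simp add: Y_def)
  ultimately show ?thesis by blast
qed

end

section \<open>The tension field and the trace of \<open>\<phi>T\<^sub>V\<close>\<close>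

locale pullback_submersion = submersion M N F gM gN + M: levi_civita_connection M gM DM
    + N: levi_civita_connection N gN DN + P: connection M N F DF
  for M :: "('a::{t2_space,second_countable_topology}, 'e::real_inner) atlas"
    and N :: "('b::{t2_space,second_countable_topology}, 'f::real_inner) atlas"
    and F :: "'a \<Rightarrow> 'b" and gM gN DM DN DF +
  assumes pullback: "pullback_connection M N F DN DF"
begin

text \<open>For F-related fields, differentiating \<open>f\<close> composed with \<open>F\<close>
  along one field gives a function that is again a composite with \<open>F\<close> near
  \<open>p\<close>. Applying this twice yields both terms of the bracket.\<close>

lemma bracket_related:
  assumes X: "vfield_near M p X" "vfield_near N (F p) Z" "\<forall>\<^sub>F q in nhds p. dF q (X q) = Z (F q)"
    and Y: "vfield_near M p Y" "vfield_near N (F p) Z'" "\<forall>\<^sub>F q in nhds p. dF q (Y q) = Z' (F q)"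
  shows "dF p (lie_bracket M X Y p) = lie_bracket N Z Z' (F p)"
proof (rule N.tangent_eqI)
  show "dF p (lie_bracket M X Y p) \<in> TN (F p)"
    using M.bracket_tangent X Y by (intro dF_tangent) auto
  show "lie_bracket N Z Z' (F p) \<in> TN (F p)" using N.bracket_tangent X Y by auto
next
  fix f assume f: "smooth_near N (F p) f"
  have fF: "smooth_near M p (\<lambda>q. f (F q))" by (rule smooth_near_comp[OF f])
  have ev: "\<forall>\<^sub>F q in nhds p. smooth_near N (F q) f"
  proof -
    obtain W where "open W" "F p \<in> W" "smooth_fun N W f" using f by (auto simp: smooth_near_def)
    then have "\<forall>\<^sub>F y in nhds (F p). smooth_near N y f"
      unfolding eventually_nhds by (intro exI[of _ W]) (auto intro: N.smooth_nearI)
    then show ?thesis by (rule eventually_comp)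
  qed
  have 1: "act (A p) (\<lambda>q. act (B q) (\<lambda>r. f (F r))) = act (C (F p)) (\<lambda>y. act (C' y) f)"
    if A: "vfield_near M p A" "\<forall>\<^sub>F q in nhds p. dF q (A q) = C (F q)"
      and B: "vfield_near N (F p) C'" "\<forall>\<^sub>F q in nhds p. dF q (B q) = C' (F q)" for A B C C'
  proof -
    have t: "A p \<in> TM p" by (rule M.vfield_near_tangent[OF A(1)])
    have "act (A p) (\<lambda>q. act (B q) (\<lambda>r. f (F r))) = act (A p) (\<lambda>q. act (C' (F q)) f)"
    proof (rule M.act_cong[OF t])
      show "\<forall>\<^sub>F q in nhds p. act (B q) (\<lambda>r. f (F r)) = act (C' (F q)) f"
        using ev B(2) by eventually_elim (metis act_pushforward)
    qed
    also have "\<dots> = act (dF p (A p)) (\<lambda>y. act (C' y) f)"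
      using act_pushforward[OF N.vfield_near_act[OF B(1) f]] by simp
    finally show ?thesis using eventually_nhds_x_imp_x[OF A(2)] by simp
  qed
  have "act (dF p (lie_bracket M X Y p)) f = act (lie_bracket M X Y p) (\<lambda>q. f (F q))"
    by (rule act_pushforward[OF f])
  also have "\<dots> = act (lie_bracket N Z Z' (F p)) f"
    using 1[OF X(1,3) Y(2,3)] 1[OF Y(1,3) X(2,3)] f fF by (simp add: lie_bracket_def)
  finally show "act (dF p (lie_bracket M X Y p)) f = act (lie_bracket N Z Z' (F p)) f" .
qed

subsection \<open>The second fundamental form\<close>

text \<open>The first field enters the second fundamental form only through its value, so just this
  vector is kept and tensoriality concerns the second argument alone.\<close>

definition sff :: "'a \<Rightarrow> 'a tvec \<Rightarrow> ('a \<Rightarrow> 'a tvec) \<Rightarrow> 'b tvec" where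
  "sff p u Y = DF p u (\<lambda>q. dF q (Y q)) - dF p (DM p u Y)"

lemma second_fundamental_form_eq: "second_fundamental_form N F DM DF X Y p = sff p (X p) Y"
  by (simp add: second_fundamental_form_def sff_def)

lemma sff_add:
  assumes "u \<in> TM p" "vfield_near M p X" "vfield_near M p Y"
  shows "sff p u (\<lambda>q. X q + Y q) = sff p u X + sff p u Y"
  using P.D_add[OF section_near_pushforward[OF assms(2)] section_near_pushforward[OF assms(3)] assms(1)]
    M.D_add[OF assms(2,3,1)]
  by (simp add: sff_def dF_simps)

text \<open>The Leibniz terms of the two connections are both the derivative of \<open>f\<close>
  times dF(X), and cancel.\<close>

lemma sff_scale:
  assumes "u \<in> TM p" "smooth_near M p f" "vfield_near M p X"
  shows "sff p u (\<lambda>q. f q *\<^sub>R X q) = f p *\<^sub>R sff p u X"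
  using P.D_scale[OF assms(2) section_near_pushforward[OF assms(3)] assms(1)]
    M.D_scale[OF assms(2,3,1)]
  by (simp add: sff_def dF_simps algebra_simps)

lemma sff_tensorial:
  assumes "u \<in> TM p" "vfield_near M p X" "vfield_near M p Y" "X p = Y p"
  shows "sff p u X = sff p u Y"
  using M.tensorial[of p "sff p u", OF sff_add[OF assms(1)] sff_scale[OF assms(1)] assms(2-4)] .

lemma sff_linear:
  assumes "u \<in> TM p" "v \<in> TM p" "vfield_near M p Y"
  shows "sff p (a *\<^sub>R u + b *\<^sub>R v) Y = a *\<^sub>R sff p u Y + b *\<^sub>R sff p v Y"
  using P.D_linear[OF section_near_pushforward[OF assms(3)] assms(1,2)]
    M.D_linear[OF assms(3,1,2)]
  by (simp add: sff_def dF_simps algebra_simps)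

text \<open>Basic fields \<open>X\<close>, \<open>W\<close> turn Koszul's formula on \<open>M\<close> into the one on \<open>N\<close>.\<close>

lemma sff_horizontal:
  assumes x: "x \<in> HS p"
  shows "sff p x (local_ext M p x) = 0"
proof -
  have xT: "x \<in> TM p" by (rule horizontal_tangent[OF x])
  define z where "z = dF p x"
  have z: "z \<in> TN (F p)" unfolding z_def by (rule dF_tangent[OF xT])
  define Z where "Z = local_ext N (F p) z"
  have Z: "vfield_near N (F p) Z" "Z (F p) = z" unfolding Z_def using N.local_ext[OF z] by auto
  \<comment> \<open>The basic field over a field of \<open>N\<close>: horizontal and F-related to
    it.\<close>
  define hl where "hl = (\<lambda>Z q. lift q (Z (F q)))"
  have hl: "vfield_near M p (hl Z)" "\<forall>\<^sub>F q in nhds p. Z (F q) \<in> TN (F q)"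
    "\<forall>\<^sub>F q in nhds p. dF q (hl Z q) = Z (F q)" if Z: "vfield_near N (F p) Z" for Z
  proof -
    show "vfield_near M p (hl Z)" unfolding hl_def by (rule vfield_near_lift[OF section_near_comp[OF Z]])
    have "\<forall>\<^sub>F y in nhds (F p). Z y \<in> TN y"
      using N.vfield_near_eventually[OF Z] by eventually_elim (rule N.vfield_near_tangent)
    then show t: "\<forall>\<^sub>F q in nhds p. Z (F q) \<in> TN (F q)" by (rule eventually_comp)
    show "\<forall>\<^sub>F q in nhds p. dF q (hl Z q) = Z (F q)"
      using t by eventually_elim (simp add: hl_def lift)
  qed
  have met: "act u (\<lambda>q. gM q (hl Z q) (hl W q)) = act (dF p u) (\<lambda>y. gN y (Z y) (W y))"
    if ZW: "vfield_near N (F p) Z" "vfield_near N (F p) W" and u: "u \<in> TM p" for Z W u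
  proof -
    have "act u (\<lambda>q. gM q (hl Z q) (hl W q)) = act u (\<lambda>q. gN (F q) (Z (F q)) (W (F q)))"
    proof (rule M.act_cong[OF u])
      show "\<forall>\<^sub>F q in nhds p. gM q (hl Z q) (hl W q) = gN (F q) (Z (F q)) (W (F q))"
        using hl(2)[OF ZW(1)] hl(2)[OF ZW(2)]
        by eventually_elim (simp add: hl_def metric_lift lift_in_tangent lift)
    qed
    also have "\<dots> = act (dF p u) (\<lambda>y. gN y (Z y) (W y))"
      by (rule act_pushforward[OF N.smooth_near_metric[OF ZW], symmetric])
    finally show ?thesis .
  qed
  let ?X = "hl Z"
  have X: "?X p = x" using lift_dF[OF x] by (simp add: hl_def Z z_def)
  have DX: "DM p x ?X \<in> TM p" by (rule M.D_tangent[OF hl(1)[OF Z(1)] xT])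
  have DZ: "DN (F p) z Z \<in> TN (F p)" by (rule N.D_tangent[OF Z(1) z])
  \<comment> \<open>Tested against each \<open>w\<close>, the left side is Koszul's expression on
    \<open>M\<close> for basic fields; its three terms are pulled back from \<open>N\<close> one by
    one.\<close>
  have "dF p (DM p x ?X) = DN (F p) z Z"
  proof (rule N.T.eqI[OF dF_tangent[OF DX] DZ])
    fix w assume w: "w \<in> TN (F p)"
    define W where "W = local_ext N (F p) w"
    have W: "vfield_near N (F p) W" "W (F p) = w" unfolding W_def using N.local_ext[OF w] by auto
    have lw: "hl W p = lift p w" by (simp add: hl_def W)
    have lwT: "lift p w \<in> TM p" by (rule lift_in_tangent[OF w])
    have br: "lie_bracket M ?X (hl W) p \<in> TM p"
      by (rule M.bracket_tangent[OF hl(1)[OF Z(1)] hl(1)[OF W(1)]])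
    have "gN (F p) (dF p (DM p x ?X)) w = gN (F p) w (dF p (DM p x ?X))"
      by (rule N.T.sym[OF dF_tangent[OF DX] w])
    also have "\<dots> = gM p (lift p w) (DM p x ?X)" by (rule metric_lift[OF w DX, symmetric])
    also have "\<dots> = gM p (DM p x ?X) (lift p w)" by (rule M.T.sym[OF lwT DX])
    also have "\<dots> = act x (\<lambda>q. gM q (?X q) (hl W q)) - gM p x (lie_bracket M ?X (hl W) p)
        - act (lift p w) (\<lambda>q. gM q (?X q) (?X q)) / 2"
      using M.koszul_diagonal[OF hl(1)[OF Z(1)] hl(1)[OF W(1)]] by (simp add: X lw)
    also have "gM p x (lie_bracket M ?X (hl W) p) = gN (F p) z (dF p (lie_bracket M ?X (hl W) p))"
      using metric_lift[OF z br] lift_dF[OF x] by (simp add: z_def)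
    also have "dF p (lie_bracket M ?X (hl W) p) = lie_bracket N Z W (F p)"
      by (rule bracket_related[OF hl(1)[OF Z(1)] Z(1) hl(3)[OF Z(1)] hl(1)[OF W(1)] W(1) hl(3)[OF W(1)]])
    also have "act x (\<lambda>q. gM q (?X q) (hl W q)) = act z (\<lambda>y. gN y (Z y) (W y))"
      using met[OF Z(1) W(1) xT] by (simp add: z_def)
    also have "act (lift p w) (\<lambda>q. gM q (?X q) (?X q)) = act w (\<lambda>y. gN y (Z y) (Z y))"
      using met[OF Z(1) Z(1) lwT] by (simp add: lift[OF w])
    also have "act z (\<lambda>y. gN y (Z y) (W y)) - gN (F p) z (lie_bracket N Z W (F p))
        - act w (\<lambda>y. gN y (Z y) (Z y)) / 2 = gN (F p) (DN (F p) z Z) w"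
      using N.koszul_diagonal[OF Z(1) W(1)] by (simp add: Z W)
    finally show "gN (F p) (dF p (DM p x ?X)) w = gN (F p) (DN (F p) z Z) w" .
  qed
  moreover have "DF p x (\<lambda>q. dF q (?X q)) = DF p x (\<lambda>q. Z (F q))"
    by (rule P.D_cong[OF hl(3)[OF Z(1)] section_near_pushforward[OF hl(1)[OF Z(1)]] xT])
  moreover have "DF p x (\<lambda>q. Z (F q)) = DN (F p) z Z"
    using pullback Z(1) xT unfolding pullback_connection_def z_def by blast
  ultimately have "sff p x ?X = 0" by (simp add: sff_def)
  \<comment> \<open>Tensoriality exchanges the basic field for the extension chosen by
    \<open>local_ext\<close>.\<close>
  then show ?thesis
    using sff_tensorial[OF xT hl(1)[OF Z(1)] M.local_ext(1)[OF xT]] M.local_ext(2)[OF xT] X by simp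
qed

text \<open>The projection makes the extension vertical on a neighbourhood and not merely at
  \<open>p\<close>.\<close>

definition vext :: "'a \<Rightarrow> 'a tvec \<Rightarrow> 'a \<Rightarrow> 'a tvec" where
  "vext p v = (\<lambda>q. vert_proj M N gM F q (local_ext M p v q))"

lemma vext:
  assumes "v \<in> VS p"
  shows "vfield_near M p (vext p v)" "vext p v p = v" "\<forall>\<^sub>F q in nhds p. vext p v q \<in> VS q"
proof -
  have t: "v \<in> TM p" by (rule vertical_tangent[OF assms])
  show "vfield_near M p (vext p v)"
    unfolding vext_def by (rule vfield_near_vert_proj[OF M.local_ext(1)[OF t]])
  show "vext p v p = v" by (simp add: vext_def M.local_ext(2)[OF t] vert_proj_vertical[OF assms])
  show "\<forall>\<^sub>F q in nhds p. vext p v q \<in> VS q"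
    using M.vfield_near_eventually[OF M.local_ext(1)[OF t]]
    by eventually_elim (simp add: vext_def vert_proj_in M.vfield_near_tangent)
qed

text \<open>By tensoriality the extension may be taken vertical; its push-forward is then 0 near
  \<open>p\<close>, and only the term from the connection of \<open>M\<close> remains.\<close>

lemma sff_vertical:
  assumes v: "v \<in> VS p"
  shows "sff p v (local_ext M p v) = - dF p (DM p v (vext p v))"
proof -
  have t: "v \<in> TM p" by (rule vertical_tangent[OF v])
  have "DF p v (\<lambda>q. dF q (vext p v q)) = DF p v (\<lambda>q. 0)"
  proof (rule P.D_cong[OF _ section_near_pushforward[OF vext(1)[OF v]] t])
    show "\<forall>\<^sub>F q in nhds p. dF q (vext p v q) = 0"
      using vext(3)[OF v] by eventually_elim (simp add: vertical_iff)
  qed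
  then have "sff p v (vext p v) = - dF p (DM p v (vext p v))" by (simp add: sff_def P.D_zero[OF t])
  then show ?thesis
    using sff_tensorial[OF t vext(1)[OF v] M.local_ext(1)[OF t]] by (simp add: vext(2)[OF v] M.local_ext(2)[OF t])
qed

lemma adapted_basis:
  obtains C B where "M.T.orthonormal p C" "span C = VS p" "M.T.orthonormal p B" "span B = HS p"
    "orthonormal_basis (gM p) (TM p) (C \<union> B)" "C \<inter> B = {}"
proof -
  have V: "VS p \<subseteq> TM p" using vertical_tangent by auto
  have H': "HS p \<subseteq> TM p" using horizontal_tangent by auto
  have H: "HS p = {u \<in> TM p. \<forall>v\<in>VS p. gM p u v = 0}" by (simp add: horizontal_space_def)
  obtain C where C: "M.T.orthonormal p C" "span C = VS p"
    using M.T.orthonormal_exists[OF vertical_subspace V] by auto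
  obtain B where B: "M.T.orthonormal p B" "span B = HS p"
    using M.T.orthonormal_exists[OF horizontal_subspace H'] by auto
  from that[OF C B] M.T.orthonormal_basis_union[OF vertical_subspace V C B(1)] B(2) H
  show ?thesis by simp
qed

lemma tension_field:
  assumes C: "M.T.orthonormal p C" "span C = VS p" and B: "M.T.orthonormal p B" "span B = HS p"
    and CB: "orthonormal_basis (gM p) (TM p) (C \<union> B)" "C \<inter> B = {}"
  shows "metric_trace (gM p) (TM p)
      (\<lambda>x y. second_fundamental_form N F DM DF (local_ext M p x) (local_ext M p y) p) =
    - dF p (\<Sum>c\<in>C. DM p c (vext p c))"
proof -
  let ?b = "\<lambda>x y. second_fundamental_form N F DM DF (local_ext M p x) (local_ext M p y) p"
  have b: "?b x y = sff p x (local_ext M p y)" if "x \<in> TM p" for x y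
    by (simp add: second_fundamental_form_eq M.local_ext(2)[OF that])
  have "metric_trace (gM p) (TM p) ?b = (\<Sum>e\<in>C \<union> B. ?b e e)"
  proof (rule M.T.metric_trace_eq[OF CB(1)])
    fix u v w :: "'a tvec" and a b :: real
    assume t: "u \<in> TM p" "v \<in> TM p" "w \<in> TM p"
    have l: "a *\<^sub>R u + b *\<^sub>R v \<in> TM p" using t by (simp add: M.T.S_closed)
    show "?b (a *\<^sub>R u + b *\<^sub>R v) w = a *\<^sub>R ?b u w + b *\<^sub>R ?b v w"
      using t l by (simp add: b sff_linear M.local_ext)
    have n: "vfield_near M p (\<lambda>q. a *\<^sub>R local_ext M p u q)" "vfield_near M p (\<lambda>q. b *\<^sub>R local_ext M p v q)"
      using t by (auto intro!: M.vfield_near_const_scale M.local_ext)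
    \<comment> \<open>\<open>local_ext\<close> is a choice and need not be additive; the combined
      field has the same value at \<open>p\<close>, so tensoriality supplies linearity.\<close>
    have "sff p w (local_ext M p (a *\<^sub>R u + b *\<^sub>R v)) =
        sff p w (\<lambda>q. a *\<^sub>R local_ext M p u q + b *\<^sub>R local_ext M p v q)"
      by (rule sff_tensorial[OF t(3) M.local_ext(1)[OF l] M.vfield_near_add[OF n]])
        (simp add: M.local_ext t l)
    also have "\<dots> = a *\<^sub>R sff p w (local_ext M p u) + b *\<^sub>R sff p w (local_ext M p v)"
      using sff_add[OF t(3) n] sff_scale[OF t(3) M.smooth_near_const M.local_ext(1)[OF t(1)]]
        sff_scale[OF t(3) M.smooth_near_const M.local_ext(1)[OF t(2)]] by simp
    finally show "?b w (a *\<^sub>R u + b *\<^sub>R v) = a *\<^sub>R ?b w u + b *\<^sub>R ?b w v" by (simp add: b t)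
  qed
  also have "\<dots> = (\<Sum>c\<in>C. ?b c c) + (\<Sum>d\<in>B. ?b d d)"
    using C B CB(2) by (intro sum.union_disjoint) (auto simp: M.T.orthonormal_def)
  also have "(\<Sum>d\<in>B. ?b d d) = 0"
  proof (rule sum.neutral, rule ballI)
    fix d assume "d \<in> B"
    then have "d \<in> HS p" using B(2) span_base by blast
    then show "?b d d = 0" by (simp add: b horizontal_tangent sff_horizontal)
  qed
  also have "(\<Sum>c\<in>C. ?b c c) = (\<Sum>c\<in>C. - dF p (DM p c (vext p c)))"
  proof (rule sum.cong)
    fix c assume "c \<in> C"
    then have "c \<in> VS p" using C(2) span_base by blast
    then show "?b c c = - dF p (DM p c (vext p c))" by (simp add: b vertical_tangent sff_vertical)
  qed simp
  finally show ?thesis by (simp add: linear_sum[OF linear_pushforward] sum_negf)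
qed

subsection \<open>O'Neill's tensor\<close>

text \<open>O'Neill's tensor with its first argument reduced to a vertical vector, on which the
  projection acts as the identity.\<close>

definition oneill_at :: "'a \<Rightarrow> 'a tvec \<Rightarrow> ('a \<Rightarrow> 'a tvec) \<Rightarrow> 'a tvec" where
  "oneill_at p v G = hor_proj M N gM F p (DM p v (\<lambda>q. vert_proj M N gM F q (G q)))
    + vert_proj M N gM F p (DM p v (\<lambda>q. hor_proj M N gM F q (G q)))"

lemma oneill_T_eq: "E p \<in> VS p \<Longrightarrow> oneill_T M N gM DM F E G p = oneill_at p (E p) G"
  by (simp add: oneill_T_def oneill_at_def vert_proj_vertical)

lemma proj_add:
  assumes "x \<in> TM p" "y \<in> TM p"
  shows "hor_proj M N gM F p (x + y) = hor_proj M N gM F p x + hor_proj M N gM F p y"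
    and "vert_proj M N gM F p (x + y) = vert_proj M N gM F p x + vert_proj M N gM F p y"
proof -
  have "lift p (dF p x) + lift p (dF p y) \<in> HS p"
    using subspace_add[OF horizontal_subspace lift(1)[OF dF_tangent[OF assms(1)]] lift(1)[OF dF_tangent[OF assms(2)]]] .
  then have "lift p (dF p x + dF p y) = lift p (dF p x) + lift p (dF p y)"
    using lift_dF lift(2)[OF dF_tangent] assms by (metis dF_simps(1))
  then show "hor_proj M N gM F p (x + y) = hor_proj M N gM F p x + hor_proj M N gM F p y"
    "vert_proj M N gM F p (x + y) = vert_proj M N gM F p x + vert_proj M N gM F p y"
    using assms by (simp_all add: hor_proj_eq vert_proj_eq dF_simps M.T.S_closed)
qed

lemma proj_scale:
  assumes "x \<in> TM p"
  shows "hor_proj M N gM F p (r *\<^sub>R x) = r *\<^sub>R hor_proj M N gM F p x"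
    and "vert_proj M N gM F p (r *\<^sub>R x) = r *\<^sub>R vert_proj M N gM F p x"
proof -
  have "r *\<^sub>R lift p (dF p x) \<in> HS p"
    using subspace_scale[OF horizontal_subspace lift(1)[OF dF_tangent[OF assms(1)]]] .
  then have "lift p (r *\<^sub>R dF p x) = r *\<^sub>R lift p (dF p x)"
    using lift_dF lift(2)[OF dF_tangent] assms by (metis dF_simps(3))
  then show "hor_proj M N gM F p (r *\<^sub>R x) = r *\<^sub>R hor_proj M N gM F p x"
    "vert_proj M N gM F p (r *\<^sub>R x) = r *\<^sub>R vert_proj M N gM F p x"
    using assms by (simp_all add: hor_proj_eq vert_proj_eq dF_simps M.T.S_closed scaleR_diff_right)
qed

lemma oneill_at_add:
  assumes v: "v \<in> TM p" and X: "vfield_near M p X" and Y: "vfield_near M p Y"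
  shows "oneill_at p v (\<lambda>q. X q + Y q) = oneill_at p v X + oneill_at p v Y"
proof -
  note ev = M.vfield_near_eventually[OF X] M.vfield_near_eventually[OF Y]
  note n = vfield_near_vert_proj[OF X] vfield_near_vert_proj[OF Y] vfield_near_hor_proj[OF X] vfield_near_hor_proj[OF Y]
  have 1: "DM p v (\<lambda>q. vert_proj M N gM F q (X q + Y q)) =
      DM p v (\<lambda>q. vert_proj M N gM F q (X q) + vert_proj M N gM F q (Y q))"
  proof (rule M.D_cong[OF _ vfield_near_vert_proj[OF M.vfield_near_add[OF X Y]] v])
    show "\<forall>\<^sub>F q in nhds p. vert_proj M N gM F q (X q + Y q) =
        vert_proj M N gM F q (X q) + vert_proj M N gM F q (Y q)"
      using ev by eventually_elim (simp add: proj_add M.vfield_near_tangent)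
  qed
  have 2: "DM p v (\<lambda>q. hor_proj M N gM F q (X q + Y q)) =
      DM p v (\<lambda>q. hor_proj M N gM F q (X q) + hor_proj M N gM F q (Y q))"
  proof (rule M.D_cong[OF _ vfield_near_hor_proj[OF M.vfield_near_add[OF X Y]] v])
    show "\<forall>\<^sub>F q in nhds p. hor_proj M N gM F q (X q + Y q) =
        hor_proj M N gM F q (X q) + hor_proj M N gM F q (Y q)"
      using ev by eventually_elim (simp add: proj_add M.vfield_near_tangent)
  qed
  show ?thesis
    unfolding oneill_at_def 1 2 M.D_add[OF n(1,2) v] M.D_add[OF n(3,4) v]
    using n v by (simp add: proj_add M.D_tangent)
qed

lemma oneill_at_scale:
  assumes v: "v \<in> TM p" and f: "smooth_near M p f" and X: "vfield_near M p X"
  shows "oneill_at p v (\<lambda>q. f q *\<^sub>R X q) = f p *\<^sub>R oneill_at p v X"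
proof -
  note ev = M.vfield_near_eventually[OF X]
  note n = vfield_near_vert_proj[OF X] vfield_near_hor_proj[OF X]
  have t: "X p \<in> TM p" by (rule M.vfield_near_tangent[OF X])
  have 1: "DM p v (\<lambda>q. vert_proj M N gM F q (f q *\<^sub>R X q)) =
      DM p v (\<lambda>q. f q *\<^sub>R vert_proj M N gM F q (X q))"
  proof (rule M.D_cong[OF _ vfield_near_vert_proj[OF M.vfield_near_scale[OF f X]] v])
    show "\<forall>\<^sub>F q in nhds p. vert_proj M N gM F q (f q *\<^sub>R X q) = f q *\<^sub>R vert_proj M N gM F q (X q)"
      using ev by eventually_elim (simp add: proj_scale M.vfield_near_tangent)
  qed
  have 2: "DM p v (\<lambda>q. hor_proj M N gM F q (f q *\<^sub>R X q)) =
      DM p v (\<lambda>q. f q *\<^sub>R hor_proj M N gM F q (X q))"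
  proof (rule M.D_cong[OF _ vfield_near_hor_proj[OF M.vfield_near_scale[OF f X]] v])
    show "\<forall>\<^sub>F q in nhds p. hor_proj M N gM F q (f q *\<^sub>R X q) = f q *\<^sub>R hor_proj M N gM F q (X q)"
      using ev by eventually_elim (simp add: proj_scale M.vfield_near_tangent)
  qed
  \<comment> \<open>The derivative of \<open>f\<close> multiplies a vertical vector under the
    horizontal projection, and a horizontal one under the vertical projection; both terms
    vanish.\<close>
  have z: "hor_proj M N gM F p (vert_proj M N gM F p (X p)) = 0"
    "vert_proj M N gM F p (hor_proj M N gM F p (X p)) = 0"
    using t by (simp_all add: hor_proj_vertical vert_proj_in vert_proj_horizontal hor_proj_in)
  show ?thesis
    unfolding oneill_at_def 1 2 M.D_scale[OF f n(1) v] M.D_scale[OF f n(2) v]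
    using M.D_tangent[OF n(1) v] M.D_tangent[OF n(2) v] M.vfield_near_tangent[OF n(1)]
      M.vfield_near_tangent[OF n(2)]
    by (simp add: proj_add proj_scale M.T.S_closed z scaleR_add_right)
qed

lemma oneill_at_tensorial:
  assumes "v \<in> TM p" "vfield_near M p X" "vfield_near M p Y" "X p = Y p"
  shows "oneill_at p v X = oneill_at p v Y"
  using M.tensorial[of p "oneill_at p v", OF oneill_at_add[OF assms(1)] oneill_at_scale[OF assms(1)] assms(2-4)] .

lemma oneill_at_local_ext_linear:
  assumes v: "v \<in> TM p" and x: "x \<in> TM p" and y: "y \<in> TM p"
  shows "oneill_at p v (local_ext M p (a *\<^sub>R x + b *\<^sub>R y)) =
    a *\<^sub>R oneill_at p v (local_ext M p x) + b *\<^sub>R oneill_at p v (local_ext M p y)"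
proof -
  have l: "a *\<^sub>R x + b *\<^sub>R y \<in> TM p" using x y by (simp add: M.T.S_closed)
  have n: "vfield_near M p (\<lambda>q. a *\<^sub>R local_ext M p x q)" "vfield_near M p (\<lambda>q. b *\<^sub>R local_ext M p y q)"
    using x y by (auto intro!: M.vfield_near_const_scale M.local_ext)
  have "oneill_at p v (local_ext M p (a *\<^sub>R x + b *\<^sub>R y)) =
      oneill_at p v (\<lambda>q. a *\<^sub>R local_ext M p x q + b *\<^sub>R local_ext M p y q)"
    by (rule oneill_at_tensorial[OF v M.local_ext(1)[OF l] M.vfield_near_add[OF n]]) (simp add: M.local_ext x y l)
  also have "\<dots> = a *\<^sub>R oneill_at p v (local_ext M p x) + b *\<^sub>R oneill_at p v (local_ext M p y)"
    using oneill_at_add[OF v n] oneill_at_scale[OF v M.smooth_near_const M.local_ext(1)[OF x]]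
      oneill_at_scale[OF v M.smooth_near_const M.local_ext(1)[OF y]] by simp
  finally show ?thesis .
qed

lemma oneill_at_in: "v \<in> TM p \<Longrightarrow> vfield_near M p X \<Longrightarrow> oneill_at p v X \<in> TM p"
  unfolding oneill_at_def
  by (intro M.T.S_closed(1) horizontal_tangent[OF hor_proj_in] vertical_tangent[OF vert_proj_in]
      M.D_tangent vfield_near_vert_proj vfield_near_hor_proj)

text \<open>Verticality near \<open>p\<close> is required, since the other summand differentiates
  the horizontal part, which must vanish as a germ.\<close>

lemma oneill_at_vertical:
  assumes v: "v \<in> TM p" and X: "vfield_near M p X" and V: "\<forall>\<^sub>F q in nhds p. X q \<in> VS q"
  shows "oneill_at p v X = hor_proj M N gM F p (DM p v X)"
proof -
  have z: "vert_proj M N gM F p 0 = 0"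
    using vert_proj_vertical[OF subspace_0[OF vertical_subspace]] .
  have "DM p v (\<lambda>q. vert_proj M N gM F q (X q)) = DM p v X"
  proof (rule M.D_cong[OF _ vfield_near_vert_proj[OF X] v])
    show "\<forall>\<^sub>F q in nhds p. vert_proj M N gM F q (X q) = X q"
      using V by eventually_elim (rule vert_proj_vertical)
  qed
  moreover have "DM p v (\<lambda>q. hor_proj M N gM F q (X q)) = DM p v (\<lambda>q. 0)"
  proof (rule M.D_cong[OF _ vfield_near_hor_proj[OF X] v])
    show "\<forall>\<^sub>F q in nhds p. hor_proj M N gM F q (X q) = 0"
      using V by eventually_elim (rule hor_proj_vertical)
  qed
  ultimately show ?thesis by (simp add: oneill_at_def M.D_zero[OF v] z)
qed

lemma oneill_at_horizontal:
  assumes v: "v \<in> TM p" and X: "vfield_near M p X" and H: "\<forall>\<^sub>F q in nhds p. X q \<in> HS q"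
  shows "oneill_at p v X = vert_proj M N gM F p (DM p v X)"
proof -
  have z: "hor_proj M N gM F p 0 = 0"
    using hor_proj_horizontal[OF subspace_0[OF horizontal_subspace]] .
  have "DM p v (\<lambda>q. hor_proj M N gM F q (X q)) = DM p v X"
  proof (rule M.D_cong[OF _ vfield_near_hor_proj[OF X] v])
    show "\<forall>\<^sub>F q in nhds p. hor_proj M N gM F q (X q) = X q"
      using H by eventually_elim (rule hor_proj_horizontal)
  qed
  moreover have "DM p v (\<lambda>q. vert_proj M N gM F q (X q)) = DM p v (\<lambda>q. 0)"
  proof (rule M.D_cong[OF _ vfield_near_vert_proj[OF X] v])
    show "\<forall>\<^sub>F q in nhds p. vert_proj M N gM F q (X q) = 0"
      using H by eventually_elim (rule vert_proj_horizontal)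
  qed
  ultimately show ?thesis by (simp add: oneill_at_def M.D_zero[OF v] z)
qed

end

section \<open>Submersions for which \<phi> exchanges vertical and horizontal vectors\<close>

locale lagrangian_submersion = pullback_submersion M N F gM gN DM DN DF
    + M: cosymplectic_manifold M gM DM \<phi> \<xi> \<eta>
  for M :: "('a::{t2_space,second_countable_topology}, 'e::real_inner) atlas"
    and N :: "('b::{t2_space,second_countable_topology}, 'f::real_inner) atlas"
    and F :: "'a \<Rightarrow> 'b" and gM gN DM DN DF \<phi> \<xi> \<eta> +
  assumes \<phi>_image: "\<phi> p ` vertical_space M N F p = horizontal_space M N gM F p"
begin

lemma \<phi>_vertical: "v \<in> VS p \<Longrightarrow> \<phi> p v \<in> HS p"
  using \<phi>_image by blast

text \<open>The horizontal part of \<xi> is \<phi>w for some vertical w. Its squared length is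
  g(\<phi>w, \<xi>) = \<eta>(\<phi>w) = 0.\<close>

lemma \<xi>_vertical: "\<xi> p \<in> VS p"
proof -
  obtain v where v: "v \<in> VS p" "\<xi> p - v \<in> HS p" using decomposition[OF M.\<xi>_tangent] by blast
  then obtain w where w: "w \<in> VS p" "\<xi> p - v = \<phi> p w" using \<phi>_image by force
  have wT: "w \<in> TM p" "\<phi> p w \<in> TM p" using w vertical_tangent M.\<phi>_tangent by auto
  have "gM p (\<phi> p w) (\<phi> p w) = gM p (\<phi> p w) (\<xi> p) - gM p (\<phi> p w) v"
    using wT v(1) by (simp add: w(2)[symmetric] M.T.G_simps M.\<xi>_tangent vertical_tangent M.T.S_closed)
  also have "\<dots> = 0"
    using horizontal_vertical[OF \<phi>_vertical[OF w(1)] v(1)] wT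
    by (simp add: M.\<eta>_eq[symmetric] M.\<eta>_\<phi>)
  finally have "\<phi> p w = 0" using M.T.pos[OF wT(2)] by force
  then show ?thesis using w v by simp
qed

text \<open>For x = \<phi>w the image is \<phi>^2 w = -w + \<eta>(w) \<xi>, and \<xi> is
  vertical.\<close>

lemma \<phi>_horizontal:
  assumes "x \<in> HS p"
  shows "\<phi> p x \<in> VS p"
proof -
  obtain w where w: "w \<in> VS p" "x = \<phi> p w" using \<phi>_image assms by force
  have "- w + \<eta> p w *\<^sub>R \<xi> p \<in> VS p"
    using w \<xi>_vertical
    by (intro subspace_add[OF vertical_subspace] subspace_neg[OF vertical_subspace]
        subspace_scale[OF vertical_subspace])
  then show ?thesis using w by (simp add: M.\<phi>_\<phi> vertical_tangent)
qed

lemma metric_hor_proj: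
  assumes "u \<in> TM p" "x \<in> HS p"
  shows "gM p (hor_proj M N gM F p u) x = gM p u x"
proof -
  have "gM p (vert_proj M N gM F p u + hor_proj M N gM F p u) x = gM p (hor_proj M N gM F p u) x"
    using assms vertical_horizontal[OF assms(2) vert_proj_in[OF assms(1)]]
    by (subst M.T.G_simps) (simp_all add: vertical_tangent[OF vert_proj_in] horizontal_tangent[OF hor_proj_in]
        horizontal_tangent)
  then show ?thesis by (simp add: proj_sum assms)
qed

lemma metric_vert_proj:
  assumes "u \<in> TM p" "v \<in> VS p"
  shows "gM p (vert_proj M N gM F p u) v = gM p u v"
proof -
  have "gM p (vert_proj M N gM F p u + hor_proj M N gM F p u) v = gM p (vert_proj M N gM F p u) v"
    using assms horizontal_vertical[OF hor_proj_in[OF assms(1)] assms(2)]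
    by (subst M.T.G_simps) (simp_all add: vertical_tangent[OF vert_proj_in] horizontal_tangent[OF hor_proj_in]
        vertical_tangent)
  then show ?thesis by (simp add: proj_sum assms)
qed

text \<open>Torsion-freeness and verticality of brackets of vertical fields move the derivative from
  \<open>E\<close> along \<open>V\<close> to \<open>V\<close> along \<open>E\<close>; then \<open>\<nabla>\<phi> = 0\<close> applies.\<close>

lemma vertical_derivative_swap:
  assumes V: "vfield_near M p V" "\<forall>\<^sub>F q in nhds p. V q \<in> VS q"
    and E: "vfield_near M p E" "\<forall>\<^sub>F q in nhds p. E q \<in> VS q"
  shows "gM p (DM p (V p) E) (\<phi> p (E p)) = gM p (\<phi> p (V p)) (DM p (E p) E)"
proof -
  have v: "V p \<in> VS p" "E p \<in> VS p"
    using eventually_nhds_x_imp_x[OF V(2)] eventually_nhds_x_imp_x[OF E(2)] by auto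
  have t: "V p \<in> TM p" "E p \<in> TM p" using v vertical_tangent by auto
  have d: "DM p (V p) E \<in> TM p" "DM p (E p) V \<in> TM p" "DM p (E p) E \<in> TM p" "\<phi> p (E p) \<in> TM p"
    "\<phi> p (V p) \<in> TM p" "DM p (E p) (\<lambda>q. \<phi> q (E q)) \<in> TM p"
    using t V E by (simp_all add: M.D_tangent M.\<phi>_tangent M.\<phi>_vfield_near)
  \<comment> \<open>Vertical fields are F-related to the zero field of \<open>N\<close>; hence their
    bracket is vertical.\<close>
  have zero: "vfield_near N (F p) (\<lambda>y. 0)" using N.id.section_near_zero by (simp add: vfield_near_def)
  have zT: "0 \<in> TN (F p)" by (rule N.T.S_closed)
  have dV: "\<forall>\<^sub>F q in nhds p. dF q (V q) = 0" using V(2) by eventually_elim (simp add: vertical_iff)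
  have dE: "\<forall>\<^sub>F q in nhds p. dF q (E q) = 0" using E(2) by eventually_elim (simp add: vertical_iff)
  have "dF p (lie_bracket M V E p) = lie_bracket N (\<lambda>y. 0) (\<lambda>y. 0) (F p)"
    by (rule bracket_related[OF V(1) zero dV E(1) zero dE])
  also have "\<dots> = 0" by (simp add: N.bracket[OF zero zero] N.D_zero[OF zT])
  finally have "DM p (V p) E - DM p (E p) V \<in> VS p"
    using M.bracket_tangent[OF V(1) E(1)] by (simp add: vertical_iff M.bracket V E)
  then have "gM p (DM p (V p) E - DM p (E p) V) (\<phi> p (E p)) = 0"
    using vertical_horizontal[OF \<phi>_vertical[OF v(2)]] by blast
  then have 1: "gM p (DM p (V p) E) (\<phi> p (E p)) = gM p (DM p (E p) V) (\<phi> p (E p))"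
    using d by (simp add: M.T.G_simps)
  \<comment> \<open>Differentiating g(V, \<phi>E) = 0 along \<open>E\<close> shifts the derivative
    to \<phi>E, where it commutes with \<phi>.\<close>
  have "act (E p) (\<lambda>q. gM q (V q) (\<phi> q (E q))) = act (E p) (\<lambda>q. 0)"
  proof (rule M.act_cong[OF t(2)])
    show "\<forall>\<^sub>F q in nhds p. gM q (V q) (\<phi> q (E q)) = 0"
      using V(2) E(2) by eventually_elim (rule vertical_horizontal[OF \<phi>_vertical])
  qed
  then have "gM p (DM p (E p) V) (\<phi> p (E p)) + gM p (V p) (DM p (E p) (\<lambda>q. \<phi> q (E q))) = 0"
    unfolding M.metric_derivative[OF V(1) M.\<phi>_vfield_near[OF E(1)] t(2)] by (simp add: M.act_const[OF t(2)])
  then have "gM p (DM p (E p) V) (\<phi> p (E p)) = - gM p (V p) (\<phi> p (DM p (E p) E))"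
    unfolding M.D_\<phi>[OF E(1) t(2)] by simp
  then show ?thesis using 1 M.\<phi>_skew[OF t(1) d(3)] by simp
qed

text \<open>The diagonal entries over \<open>C\<close> are - g(T_V c, \<phi>c) by skewness of
  \<phi>, and those over \<open>B\<close> have the same sum. The torsion-free swap identifies g(T_V
  c, \<phi>c) with a term of g(\<phi>V, K).\<close>

lemma trace_phi_T:
  assumes V: "V \<in> vertical_sections M N F"
    and C: "M.T.orthonormal p C" "span C = VS p" and B: "M.T.orthonormal p B" "span B = HS p"
    and CB: "orthonormal_basis (gM p) (TM p) (C \<union> B)" "C \<inter> B = {}"
  shows "trace_on (TM p) (phi_T M N \<phi> gM DM F V p) =
    - 2 * gM p (\<phi> p (V p)) (\<Sum>c\<in>C. DM p c (vext p c))"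
proof -
  have nV: "vfield_near M p V" "\<forall>\<^sub>F q in nhds p. V q \<in> VS q"
    using V M.vfield_nearI[of UNIV p V] by (auto simp: vertical_sections_def)
  define v where "v = V p"
  have v: "v \<in> VS p" unfolding v_def by (rule eventually_nhds_x_imp_x[OF nV(2)])
  have vT: "v \<in> TM p" by (rule vertical_tangent[OF v])
  define \<tau> where "\<tau> w = oneill_at p v (local_ext M p w)" for w
  have phiT: "phi_T M N \<phi> gM DM F V p = (\<lambda>e. \<phi> p (\<tau> e))"
    using oneill_T_eq[of V p] v by (auto simp: phi_T_def \<tau>_def v_def)
  have \<tau>T: "\<tau> w \<in> TM p" if "w \<in> TM p" for w
    unfolding \<tau>_def by (rule oneill_at_in[OF vT M.local_ext(1)[OF that]])
  have \<tau>_lin: "\<tau> (a *\<^sub>R x + b *\<^sub>R y) = a *\<^sub>R \<tau> x + b *\<^sub>R \<tau> y" if "x \<in> TM p" "y \<in> TM p" for a b x y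
    unfolding \<tau>_def by (rule oneill_at_local_ext_linear[OF vT that])
  have \<tau>_eq: "\<tau> (X p) = oneill_at p v X" if "vfield_near M p X" for X
    unfolding \<tau>_def using M.vfield_near_tangent[OF that]
    by (intro oneill_at_tensorial[OF vT M.local_ext(1) that]) (simp_all add: M.local_ext)
  have CV: "c \<in> VS p" "c \<in> TM p" if "c \<in> C" for c
    using C(2) span_base that vertical_tangent by blast+
  have BH: "d \<in> HS p" "d \<in> TM p" if "d \<in> B" for d
    using B(2) span_base that horizontal_tangent by blast+
  have fin: "finite C" "finite B" "C \<subseteq> TM p" "B \<subseteq> TM p"
    using C B by (auto simp: M.T.orthonormal_def)
  have vert: "gM p (\<phi> p (\<tau> c)) c = - gM p (\<tau> c) (\<phi> p c)" if "c \<in> TM p" for c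
    using M.\<phi>_skew[OF \<tau>T[OF that] that] .
  \<comment> \<open>\<phi>c is horizontal, so the projection in \<open>\<tau> c\<close> drops out;
    the swap then turns the derivative along \<open>v\<close> into one along
    \<open>c\<close>.\<close>
  have C_term: "gM p (\<tau> c) (\<phi> p c) = gM p (\<phi> p v) (DM p c (vext p c))" if c: "c \<in> C" for c
  proof -
    note x = vext[OF CV(1)[OF c]]
    have "\<tau> c = hor_proj M N gM F p (DM p v (vext p c))"
      using \<tau>_eq[OF x(1)] oneill_at_vertical[OF vT x(1,3)] by (simp add: x(2))
    then have "gM p (\<tau> c) (\<phi> p c) = gM p (DM p v (vext p c)) (\<phi> p c)"
      by (simp add: metric_hor_proj M.D_tangent x(1) vT \<phi>_vertical CV c)
    then show ?thesis
      using vertical_derivative_swap[OF nV x(1,3)] by (simp add: x(2) v_def)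
  qed
  \<comment> \<open>Skewness of T_V between \<open>d\<close> and \<phi>d, obtained by
    differentiating g(X, \<phi>X) = 0 for a horizontal extension X of \<open>d\<close>; the sign
    cancels that of the skewness of \<phi>.\<close>
  have B_term: "gM p (\<phi> p (\<tau> d)) d = gM p (\<tau> (\<phi> p d)) d" if d: "d \<in> B" for d
  proof -
    define X where "X q = hor_proj M N gM F q (local_ext M p d q)" for q
    have nX: "vfield_near M p X"
      unfolding X_def by (rule vfield_near_hor_proj[OF M.local_ext(1)[OF BH(2)[OF d]]])
    have XH: "\<forall>\<^sub>F q in nhds p. X q \<in> HS q"
      using M.vfield_near_eventually[OF M.local_ext(1)[OF BH(2)[OF d]]]
      by eventually_elim (simp add: X_def hor_proj_in M.vfield_near_tangent)
    have Xp: "X p = d" by (simp add: X_def M.local_ext(2) BH d hor_proj_horizontal)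
    define Y where "Y q = \<phi> q (X q)" for q
    have nY: "vfield_near M p Y" unfolding Y_def by (rule M.\<phi>_vfield_near[OF nX])
    have YV: "\<forall>\<^sub>F q in nhds p. Y q \<in> VS q"
      using XH by eventually_elim (simp add: Y_def \<phi>_horizontal)
    have Yp: "Y p = \<phi> p d" by (simp add: Y_def Xp)
    have Dt: "DM p v X \<in> TM p" "DM p v Y \<in> TM p" using nX nY vT by (simp_all add: M.D_tangent)
    have "act v (\<lambda>q. gM q (X q) (Y q)) = act v (\<lambda>q. 0)"
    proof (rule M.act_cong[OF vT])
      show "\<forall>\<^sub>F q in nhds p. gM q (X q) (Y q) = 0"
        using XH YV by eventually_elim (rule horizontal_vertical)
    qed
    then have "gM p (DM p v X) (\<phi> p d) + gM p d (DM p v Y) = 0"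
      unfolding M.metric_derivative[OF nX nY vT] by (simp add: M.act_const[OF vT] Xp Yp)
    moreover have "gM p d (DM p v Y) = gM p (DM p v Y) d" by (rule M.T.sym[OF BH(2)[OF d] Dt(2)])
    moreover have "gM p (\<tau> d) (\<phi> p d) = gM p (DM p v X) (\<phi> p d)"
      using \<tau>_eq[OF nX] oneill_at_horizontal[OF vT nX XH] metric_vert_proj[OF Dt(1) \<phi>_horizontal[OF BH(1)[OF d]]]
      by (simp add: Xp)
    moreover have "gM p (\<tau> (\<phi> p d)) d = gM p (DM p v Y) d"
      using \<tau>_eq[OF nY] oneill_at_vertical[OF vT nY YV] metric_hor_proj[OF Dt(2) BH(1)[OF d]]
      by (simp add: Yp)
    ultimately show ?thesis using vert[OF BH(2)[OF d]] by simp
  qed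
  \<comment> \<open>Expand \<phi>d in \<open>C\<close>, exchange the sums and reassemble \<phi>c in
    \<open>B\<close>. The minus sign is g(\<phi>d, c) = - g(\<phi>c, d).\<close>
  have "(\<Sum>d\<in>B. gM p (\<tau> (\<phi> p d)) d) = (\<Sum>d\<in>B. \<Sum>c\<in>C. gM p (\<phi> p d) c * gM p (\<tau> c) d)"
  proof (rule sum.cong)
    fix d assume d: "d \<in> B"
    have "\<tau> (\<Sum>c\<in>C. gM p (\<phi> p d) c *\<^sub>R c) = (\<Sum>c\<in>C. gM p (\<phi> p d) c *\<^sub>R \<tau> c)"
      by (rule combination_sum[OF M.T.subspace]) (use \<tau>_lin CV in auto)
    moreover have "(\<Sum>c\<in>C. gM p (\<phi> p d) c *\<^sub>R c) = \<phi> p d"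
      by (rule M.T.orthonormal_expand[OF C(1)]) (simp add: C(2) \<phi>_horizontal BH d)
    ultimately have "gM p (\<tau> (\<phi> p d)) d = gM p (\<Sum>c\<in>C. gM p (\<phi> p d) c *\<^sub>R \<tau> c) d" by simp
    also have "\<dots> = (\<Sum>c\<in>C. gM p (\<phi> p d) c * gM p (\<tau> c) d)"
      by (rule M.T.G_sum_left) (use \<tau>T CV BH d in auto)
    finally show "gM p (\<tau> (\<phi> p d)) d = (\<Sum>c\<in>C. gM p (\<phi> p d) c * gM p (\<tau> c) d)" .
  qed simp
  also have "\<dots> = (\<Sum>c\<in>C. \<Sum>d\<in>B. gM p (\<phi> p d) c * gM p (\<tau> c) d)" by (rule sum.swap)
  also have "\<dots> = (\<Sum>c\<in>C. - gM p (\<tau> c) (\<phi> p c))"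
  proof (rule sum.cong)
    fix c assume c: "c \<in> C"
    have "gM p (\<tau> c) (\<Sum>d\<in>B. gM p (\<phi> p c) d *\<^sub>R d) = (\<Sum>d\<in>B. gM p (\<phi> p c) d * gM p (\<tau> c) d)"
      by (rule M.T.G_sum_right) (use \<tau>T CV BH c in auto)
    moreover have "(\<Sum>d\<in>B. gM p (\<phi> p c) d *\<^sub>R d) = \<phi> p c"
      by (rule M.T.orthonormal_expand[OF B(1)]) (simp add: B(2) \<phi>_vertical CV c)
    moreover have "gM p (\<phi> p d) c = - gM p (\<phi> p c) d" if "d \<in> B" for d
      using M.\<phi>_skew[OF BH(2)[OF that] CV(2)[OF c]]
        M.T.sym[OF BH(2)[OF that] M.\<phi>_tangent[OF CV(2)[OF c]]] by simp
    ultimately show "(\<Sum>d\<in>B. gM p (\<phi> p d) c * gM p (\<tau> c) d) = - gM p (\<tau> c) (\<phi> p c)"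
      by (simp add: sum_negf)
  qed simp
  finally have B_sum: "(\<Sum>d\<in>B. gM p (\<tau> (\<phi> p d)) d) = (\<Sum>c\<in>C. - gM p (\<tau> c) (\<phi> p c))" .
  have "trace_on (TM p) (\<lambda>e. \<phi> p (\<tau> e)) = (\<Sum>e\<in>C \<union> B. gM p (\<phi> p (\<tau> e)) e)"
    by (rule M.T.trace_on_eq[OF CB(1)]) (simp_all add: M.\<phi>_tangent \<tau>T \<tau>_lin M.\<phi>_linear)
  also have "\<dots> = (\<Sum>c\<in>C. gM p (\<phi> p (\<tau> c)) c) + (\<Sum>d\<in>B. gM p (\<phi> p (\<tau> d)) d)"
    by (rule sum.union_disjoint[OF fin(1,2) CB(2)])
  also have "(\<Sum>d\<in>B. gM p (\<phi> p (\<tau> d)) d) = (\<Sum>c\<in>C. - gM p (\<tau> c) (\<phi> p c))"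
    unfolding B_sum[symmetric] by (rule sum.cong) (simp_all add: B_term)
  also have "(\<Sum>c\<in>C. gM p (\<phi> p (\<tau> c)) c) = (\<Sum>c\<in>C. - gM p (\<tau> c) (\<phi> p c))"
    by (rule sum.cong) (simp_all add: vert CV)
  \<comment> \<open>The factors 1 only bring the sum into the shape expected by
    \<open>G_sum_right\<close>.\<close>
  also have "(\<Sum>c\<in>C. - gM p (\<tau> c) (\<phi> p c)) = - (\<Sum>c\<in>C. 1 * gM p (\<phi> p v) (DM p c (vext p c)))"
    by (simp add: C_term sum_negf)
  also have "(\<Sum>c\<in>C. 1 * gM p (\<phi> p v) (DM p c (vext p c))) =
      gM p (\<phi> p v) (\<Sum>c\<in>C. 1 *\<^sub>R DM p c (vext p c))"
    by (rule M.T.G_sum_right[symmetric])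
      (use CV vext M.D_tangent M.\<phi>_tangent[OF vT] in auto)
  finally show ?thesis by (simp add: phiT v_def)
qed

lemma harmonic_iff_trace:
  "harmonic_map M N gM F DM DF \<longleftrightarrow>
    (\<forall>V\<in>vertical_sections M N F. \<forall>p. trace_on (TM p) (phi_T M N \<phi> gM DM F V p) = 0)"
proof
  assume h: "harmonic_map M N gM F DM DF"
  show "\<forall>V\<in>vertical_sections M N F. \<forall>p. trace_on (TM p) (phi_T M N \<phi> gM DM F V p) = 0"
  proof (intro ballI allI)
    fix V p assume V: "V \<in> vertical_sections M N F"
    obtain C B where CB: "M.T.orthonormal p C" "span C = VS p" "M.T.orthonormal p B" "span B = HS p"
      "orthonormal_basis (gM p) (TM p) (C \<union> B)" "C \<inter> B = {}" by (rule adapted_basis)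
    have C: "c \<in> VS p" if "c \<in> C" for c using CB(2) span_base that by blast
    let ?K = "\<Sum>c\<in>C. DM p c (vext p c)"
    have "?K \<in> TM p"
      by (rule M.T.S_closed(6)) (use C M.D_tangent vext(1) vertical_tangent in auto)
    moreover have "dF p ?K = 0" using h tension_field[OF CB] by (simp add: harmonic_map_def)
    \<comment> \<open>Harmonicity makes \<open>?K\<close> vertical, and \<phi>V is
      horizontal.\<close>
    ultimately have "?K \<in> VS p" by (simp add: vertical_iff)
    moreover have "V p \<in> VS p" using V by (simp add: vertical_sections_def)
    ultimately have "gM p (\<phi> p (V p)) ?K = 0" using horizontal_vertical[OF \<phi>_vertical] by blast
    then show "trace_on (TM p) (phi_T M N \<phi> gM DM F V p) = 0" by (simp add: trace_phi_T[OF V CB])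
  qed
next
  assume t: "\<forall>V\<in>vertical_sections M N F. \<forall>p. trace_on (TM p) (phi_T M N \<phi> gM DM F V p) = 0"
  show "harmonic_map M N gM F DM DF"
    unfolding harmonic_map_def
  proof
    fix p
    obtain C B where CB: "M.T.orthonormal p C" "span C = VS p" "M.T.orthonormal p B" "span B = HS p"
      "orthonormal_basis (gM p) (TM p) (C \<union> B)" "C \<inter> B = {}" by (rule adapted_basis)
    have C: "c \<in> VS p" if "c \<in> C" for c using CB(2) span_base that by blast
    let ?K = "\<Sum>c\<in>C. DM p c (vext p c)"
    have K: "?K \<in> TM p"
      by (rule M.T.S_closed(6)) (use C M.D_tangent vext(1) vertical_tangent in auto)
    have KT: "dF p ?K \<in> TN (F p)" by (rule dF_tangent[OF K])
    \<comment> \<open>The horizontal part of \<open>?K\<close> is itself the image under \<phi> of a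
      vertical vector; this is the test direction.\<close>
    obtain w where w: "w \<in> VS p" "lift p (dF p ?K) = \<phi> p w"
      using lift(1)[OF KT] \<phi>_image[of p] by force
    \<comment> \<open>The trace condition speaks of global sections, so \<open>vext p w\<close> is
      cut off without leaving the vertical spaces.\<close>
    obtain V where V: "vfield M UNIV V" "V p = vext p w p" "\<forall>q. V q \<in> VS q"
      using M.global_extension[OF vext(1)[OF w(1)] vertical_subspace vext(3)[OF w(1)]] by blast
    then have Vs: "V \<in> vertical_sections M N F" by (simp add: vertical_sections_def)
    then have "gM p (\<phi> p w) ?K = 0"
      using t trace_phi_T[OF Vs CB] V(2) vext(2)[OF w(1)] by simp
    \<comment> \<open>By adjointness of the lift, g(\<phi>w, K) is the squared length of
      dF(K).\<close>
    then have "gN (F p) (dF p ?K) (dF p ?K) = 0" using metric_lift[OF KT K] w(2) by simp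
    then have "dF p ?K = 0" using N.T.pos[OF KT] by force
    then show "metric_trace (gM p) (TM p)
        (\<lambda>x y. second_fundamental_form N F DM DF (local_ext M p x) (local_ext M p y) p) = 0"
      by (simp add: tension_field[OF CB])
  qed
qed

end

theorem theorem7:
  fixes M :: "('a::{t2_space,second_countable_topology}, 'e::real_inner) atlas"
    and N :: "('b::{t2_space,second_countable_topology}, 'f::real_inner) atlas"
    and \<phi> :: "'a \<Rightarrow> 'a tvec \<Rightarrow> 'a tvec"
    and \<xi> :: "'a \<Rightarrow> 'a tvec"
    and \<eta> :: "'a \<Rightarrow> 'a tvec \<Rightarrow> real"
    and gM :: "'a \<Rightarrow> 'a tvec \<Rightarrow> 'a tvec \<Rightarrow> real"
    and gN :: "'b \<Rightarrow> 'b tvec \<Rightarrow> 'b tvec \<Rightarrow> real"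
    and F :: "'a \<Rightarrow> 'b"
    and nablaM :: "'a \<Rightarrow> 'a tvec \<Rightarrow> ('a \<Rightarrow> 'a tvec) \<Rightarrow> 'a tvec"
    and nablaN :: "'b \<Rightarrow> 'b tvec \<Rightarrow> ('b \<Rightarrow> 'b tvec) \<Rightarrow> 'b tvec"
    and nablaF :: "'a \<Rightarrow> 'a tvec \<Rightarrow> ('a \<Rightarrow> 'b tvec) \<Rightarrow> 'b tvec"
  assumes "cosymplectic M \<phi> \<xi> \<eta> gM"
    and "riemannian_manifold N gN"
    and "levi_civita M gM nablaM"
    and "levi_civita N gN nablaN"
    and "pullback_connection M N F nablaN nablaF"
    and "anti_invariant_submersion M N \<phi> gM gN F"
    and "\<And>p. \<phi> p ` vertical_space M N F p = horizontal_space M N gM F p"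
  shows "harmonic_map M N gM F nablaM nablaF \<longleftrightarrow>
    (\<forall>V\<in>vertical_sections M N F. \<forall>p.
       trace_on (tangent_space M p) (phi_T M N \<phi> gM nablaM F V p) = 0)"
proof -
  have "riemannian_submersion M N gM gN F"
    using assms(6) by (simp add: anti_invariant_submersion_def)
  moreover from this have "smooth_map M N F" by (simp add: riemannian_submersion_def)
  moreover have "smooth_manifold M" "riemannian_metric M gM"
    using assms(1) by (simp_all add: cosymplectic_def almost_contact_metric_def riemannian_manifold_def)
  moreover have "smooth_manifold N" "riemannian_metric N gN"
    using assms(2) by (simp_all add: riemannian_manifold_def)
  moreover have "connection_along M N F nablaF"
    using assms(5) by (simp add: pullback_connection_def)
  ultimately interpret lagrangian_submersion M N F gM gN nablaM nablaN nablaF \<phi> \<xi> \<eta>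
    by unfold_locales (use assms in auto)
  show ?thesis by (rule harmonic_iff_trace)
qed

end
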